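(* For every integer $L\ge 0$ there is a constant $C_L$ depending only on $L$ such that for every $\eta>0$ and every $R_*>0$ there exist simple uniformly separated sets $\Lambda_+,\Lambda_-\subset\mathbb C$ and a bijection $T:\Lambda_+\to\Lambda_-$ with the following properties. (i) Each of $\Lambda_+,\Lambda_-$ admits a bounded matching to the lattice $\mathcal L=\sqrt\pi(\mathbb Z+i\mathbb Z)$, and $$\sup_{w\in\mathbb C}\bigl|\#(\Lambda_\pm\cap D(w,r))-r^2\bigr|=O(r)\qquad(r\to\infty).$$ (ii) $|T\lambda|=|\lambda|$ for all $\lambda\in\Lambda_+$, and $T$ is the identity in the disk $D_{R_*}$ (so that $\Lambda_+$ and $\Lambda_-$ coincide there). Moreover, $$\sup_{\lambda\in\Lambda_+}|T\lambda-\lambda|<\eta,\qquad |T\lambda-\lambda|\le C_L\,\frac{\log^2(2+|\lambda|)}{1+|\lambda|}\quad(\lambda\in\Lambda_+).$$ (iii) The radial counting functions of $\Lambda_+$ and $\Lambda_-$ agree at every radius. For every $\rho>0$ and every integer $1\le j\le L$, $$\sum_{\lambda\in\Lambda_+,\ |\lambda|=\rho}e^{ij\arg\lambda}=\sum_{\mu\in\Lambda_-,\ |\mu|=\rho}e^{ij\arg\mu},$$ and these moments vanish for all $\rho$ outside a fixed disk (i.e. for all $\rho>\rho_0$, for some $\rho_0$). (iv) Every finite modification of $\Lambda_+$ is a zero set for $\mathcal F^2$, and every finite modification of $\Lambda_-$ is a uniqueness multiset.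
   Context: $dA$ is planar Lebesgue measure. The Bargmann–Fock space $\mathcal F^2$ is the space of entire functions $f$ with $\|f\|_2^2:=\frac1\pi\int_{\mathbb C}|f(z)|^2e^{-|z|^2}\,dA(z)<\infty$. Notation: $D(w,r)=\{z:|z-w|<r\}$, $D_R=\{z:|z|\le R\}$. A multiset in $\mathbb C$ is a locally finite one with finite multiplicities, identified with its counting measure; a set is regarded as a multiset with all multiplicities one ("simple"). For a nonzero entire function $f$, $\mathcal Z(f)$ denotes its zero multiset (with multiplicities). A multiset $\Lambda$ is a zero set for $\mathcal F^2$ (exact zero multiset) if there is a nonzero $f\in\mathcal F^2$ with $\mathcal Z(f)=\Lambda$. It is a uniqueness multiset if the only $f\in\mathcal F^2$ vanishing on $\Lambda$ with at least the prescribed multiplicities is $f=0$. A finite modification of $\Lambda$ is a multiset $\Lambda-\nu_-+\nu_+$ with $\nu_\pm$ finite multisets and $0\le\nu_-\le\Lambda$. A set $\Lambda$ is uniformly separated if $\inf_{\lambda\ne\lambda'\in\Lambda}|\lambda-\lambda'|>0$. A bounded matching of $\Lambda$ to $\mathcal L$ is a bijection $\beta:\Lambda\to\mathcal L$ with $\sup_{\lambda\in\Lambda}|\beta(\lambda)-\lambda|<\infty$. The radial counting function of $\Lambda$ is $n_\Lambda(r)=\#\{\lambda\in\Lambda:|\lambda|\le r\}$, counted with multiplicity. *)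

theory Defs
  imports "HOL-Complex_Analysis.Complex_Analysis"
begin

definition fock_sqnorm :: "(complex \<Rightarrow> complex) \<Rightarrow> ennreal" where
  "fock_sqnorm f =
     ennreal (1 / pi) * (\<integral>\<^sup>+ z. ennreal ((cmod (f z))\<^sup>2 * exp (- (cmod z)\<^sup>2)) \<partial>lborel)"

definition fock_space :: "(complex \<Rightarrow> complex) set" where
  "fock_space = {f. f holomorphic_on UNIV \<and> fock_sqnorm f < \<infinity>}"

text \<open>
  Locally finite multisets of complex numbers may be infinite, so they are represented by their
  multiplicity functions of type \<^typ>\<open>complex \<Rightarrow> nat\<close> rather than by the library type of
  multisets, which is used for the finite multisets only.  Local finiteness is not part of the type: it is
  automatic for zero multisets of nonzero entire functions, for uniformly discrete sets, and for their finite modifications.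
\<close>

definition simple :: "complex set \<Rightarrow> complex \<Rightarrow> nat" where
  "simple A = (\<lambda>z. if z \<in> A then 1 else 0)"

definition zero_mset :: "(complex \<Rightarrow> complex) \<Rightarrow> complex \<Rightarrow> nat" where
  "zero_mset f = (\<lambda>z. if f z = 0 then nat (zorder f z) else 0)"

text \<open>
  Stated with derivatives so that the zero function, for which \<^const>\<open>zorder\<close> is unspecified,
  vanishes on every multiset.
\<close>

definition vanishes_on :: "(complex \<Rightarrow> complex) \<Rightarrow> (complex \<Rightarrow> nat) \<Rightarrow> bool" where
  "vanishes_on f M \<longleftrightarrow> (\<forall>z. \<forall>k < M z. (deriv ^^ k) f z = 0)"

definition fock_zero_set :: "(complex \<Rightarrow> nat) \<Rightarrow> bool" where
  "fock_zero_set M \<longleftrightarrow> (\<exists>f \<in> fock_space. f \<noteq> (\<lambda>z. 0) \<and> zero_mset f = M)"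

definition fock_uniqueness :: "(complex \<Rightarrow> nat) \<Rightarrow> bool" where
  "fock_uniqueness M \<longleftrightarrow> (\<forall>f \<in> fock_space. vanishes_on f M \<longrightarrow> f = (\<lambda>z. 0))"

definition finite_modification :: "(complex \<Rightarrow> nat) \<Rightarrow> (complex \<Rightarrow> nat) \<Rightarrow> bool" where
  "finite_modification M M' \<longleftrightarrow>
     (\<exists>N P :: complex multiset. (\<forall>z. count N z \<le> M z) \<and>
        M' = (\<lambda>z. M z - count N z + count P z))"

definition sqrt_pi_lattice :: "complex set" where
  "sqrt_pi_lattice = {complex_of_real (sqrt pi) * (of_int m + \<i> * of_int n) | m n :: int. True}"

definition bounded_matching :: "(complex \<Rightarrow> complex) \<Rightarrow> complex set \<Rightarrow> complex set \<Rightarrow> bool" where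
  "bounded_matching \<beta> A B \<longleftrightarrow> bij_betw \<beta> A B \<and> (\<exists>C. \<forall>x\<in>A. cmod (\<beta> x - x) \<le> C)"

text \<open>
  The bound on the supremum is written out pointwise, because a supremum over the reals is
  meaningful only for bounded families.
\<close>

definition disc_discrepancy_linear :: "complex set \<Rightarrow> bool" where
  "disc_discrepancy_linear A \<longleftrightarrow>
     (\<exists>C. \<forall>\<^sub>F r :: real in at_top. \<forall>w. \<bar>real (card (A \<inter> ball w r)) - r\<^sup>2\<bar> \<le> C * r)"

definition radial_count :: "(complex \<Rightarrow> nat) \<Rightarrow> real \<Rightarrow> nat" where
  "radial_count M r = (\<Sum>z | 0 < M z \<and> cmod z \<le> r. M z)"

definition circle_moment :: "complex set \<Rightarrow> nat \<Rightarrow> real \<Rightarrow> complex" where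
  "circle_moment A j \<rho> = (\<Sum>z | z \<in> A \<and> cmod z = \<rho>. exp (\<i> * of_nat j * of_real (Arg z)))"

end

theory Submission
  imports Defs "HOL-Real_Asymp.Real_Asymp"
begin

text \<open>
  Both sets live on the same concentric circles, which carry 2J(k+1) points each, where J = L + 3.
  On a circle, the points of \<open>\<Lambda>\<^sub>+\<close> form a regular polygon, and those of \<open>\<Lambda>\<^sub>-\<close> are the vertices of
  that polygon, each turned by a tiny angle. Both sets are invariant under rotation by
  \<open>2\<pi>/J\<close>, and this symmetry alone annihilates the moments of orders 1 to L on every circle. An annulus
  around each circle splits into congruent sectors of area \<open>\<pi>\<close>, one for each point. A set
  whose points own disjoint cells of area \<open>\<pi>\<close> and bounded size that fill the plane has disc
  discrepancy O(r), and Hall's marriage theorem matches it boundedly to any other such set, in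
  particular to the lattice (\<open>tiled_disc_discrepancy\<close>, \<open>tiled_bounded_matching\<close>).

  The radii decide the radial growth. If the circle of radius \<open>r\<^sub>k\<close> carries \<open>N\<^sub>k\<close> points, the logarithm of the
  modulus of the canonical product is, up to its angular oscillation, the sum of
  \<open>N\<^sub>k log\<^sup>+ (r/r\<^sub>k)\<close>. This is a convex, piecewise linear function of log r with prescribed slopes, so the
  radii can be chosen to make its pieces lie on any prescribed lines. Here these are tangents of
  \<open>r\<^sup>2/2\<close> as a function of log r, lowered by a small multiple of \<open>log\<^sup>2 r\<close>. The product over the regular polygons is then
  smaller than \<open>exp(|z|\<^sup>2/2)\<close> by a factor \<open>exp(-\<beta> log\<^sup>2 |z|)\<close>, which beats every power of |z|. Hence it
  remains in the Fock space when finitely many zeros are removed or added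
  (\<open>unperturbed_zero_set\<close>).

  The angular perturbation changes neither the radii nor the moments of low order, but it turns the
  factor \<open>1 - \<zeta>\<^sup>N\<close> of a circle into \<open>1 - a \<zeta>\<^sup>J + a \<zeta>\<^sup>N\<^sup>-\<^sup>J - \<zeta>\<^sup>N\<close>, whose roots still lie on the unit circle.
  With a of size \<open>c log\<^sup>2 k / k\<close> on the k-th circle, the contributions \<open>-a Re \<zeta>\<^sup>\<plusminus>\<^sup>J\<close> add up to
  \<open>-W(r) cos(J\<theta>)\<close> with W(r) between two positive multiples of \<open>log\<^sup>2 r\<close>, and a large constant c makes
  W(r) dominate the radial loss \<open>\<beta> log\<^sup>2 r\<close> (\<open>swing_lower\<close>, \<open>swing_upper\<close>, \<open>ring_product_lower\<close>). A function in the Fock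
  space that vanishes on a finite modification of \<open>\<Lambda>\<^sub>-\<close> becomes, after multiplication by a polynomial,
  the product of this entire function with some entire h. So on a sequence of circles log |h| is
  at most \<open>\<beta> log\<^sup>2 r + W(r) cos(J\<theta>) + O(log r)\<close>. This makes h extremely small in the sectors where cos is
  negative, whereas h has growth \<open>exp(O(log\<^sup>2 r))\<close>. By the two-constants theorem, a function of such slow
  growth that is so small in discs of radius proportional to |z| vanishes identically
  (\<open>entire_vanishes_by_sector_decay\<close>).
\<close>

section \<open>Matchings of sets that tile the plane with cells of equal area\<close>

text \<open>
  Rado's proof: among the subrelations that still satisfy Hall's condition there is a minimal one, by Zorn's lemma
  (the family \<open>\<A>\<close> consists of the removed sets of pairs, so a maximal element is sought; chains are harmless because
  only finitely many pairs matter for a finite I). If some x had two partners y and y' left, neither of them could be removed,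
  and the two violations of Hall's condition so obtained contradict each other by inclusion-exclusion.
\<close>

theorem infinite_hall:
  fixes N :: "'a \<Rightarrow> 'b set"
  assumes fin: "\<And>x. x \<in> A \<Longrightarrow> finite (N x)"
    and hall: "\<And>I. finite I \<Longrightarrow> I \<subseteq> A \<Longrightarrow> card I \<le> card (\<Union>x\<in>I. N x)"
  shows "\<exists>f. inj_on f A \<and> (\<forall>x\<in>A. f x \<in> N x)"
proof -
  define S where "S = Sigma A N"
  define \<A> where "\<A> = {X. \<forall>I. finite I \<longrightarrow> I \<subseteq> A \<longrightarrow> card I \<le> card ((S - X) `` I)}"
  have finS: "finite (S `` I)" and finSI: "finite (S \<inter> I \<times> UNIV)" if "finite I" "I \<subseteq> A" for I
  proof -
    have "S `` I = (\<Union>x\<in>I. N x)" "S \<inter> I \<times> UNIV = Sigma I N"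
      using that by (auto simp: S_def)
    then show "finite (S `` I)" "finite (S \<inter> I \<times> UNIV)"
      using that fin by (auto intro!: finite_SigmaI)
  qed
  have "\<Union>\<C> \<in> \<A>" if ch: "subset.chain \<A> \<C>" for \<C>
    unfolding \<A>_def
  proof (intro CollectI allI impI)
    fix I assume I: "finite I" "I \<subseteq> A"
    show "card I \<le> card ((S - \<Union>\<C>) `` I)"
    proof (cases "\<C> = {}")
      case True
      have "(S - \<Union>\<C>) `` I = (\<Union>x\<in>I. N x)" using I True by (auto simp: S_def)
      then show ?thesis using hall[OF I] by simp
    next
      case False
      have "finite (\<Union>\<C> \<inter> (S \<inter> I \<times> UNIV))" using finSI[OF I] by blast
      then obtain X where X: "X \<in> \<C>" "\<Union>\<C> \<inter> (S \<inter> I \<times> UNIV) \<subseteq> X"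
        using finite_subset_Union_chain[OF _ _ False ch] by (metis inf_le1)
      then have "(S - \<Union>\<C>) `` I = (S - X) `` I" by blast
      moreover have "X \<in> \<A>" using ch X(1) by (auto simp: subset.chain_def)
      ultimately show ?thesis using I by (auto simp: \<A>_def)
    qed
  qed
  then have "\<exists>X\<in>\<A>. \<forall>Y\<in>\<A>. X \<subseteq> Y \<longrightarrow> Y = X" by (rule subset_Zorn')
  then obtain X where X: "X \<in> \<A>" and max: "\<forall>Y\<in>\<A>. X \<subseteq> Y \<longrightarrow> Y = X" by (elim bexE)
  define R where "R = S - X"
  have finR: "finite (R `` I)" if "finite I" "I \<subseteq> A" for I
    by (rule finite_subset[OF _ finS[OF that]]) (auto simp: R_def)
  have R: "card I \<le> card (R `` I)" if "finite I" "I \<subseteq> A" for I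
    using X that by (auto simp: \<A>_def R_def)
  have single: "y = y'" if xy: "(x, y) \<in> R" "(x, y') \<in> R" for x y y'
  proof (rule ccontr)
    assume neq: "y \<noteq> y'"
    have xA: "x \<in> A" using xy by (auto simp: R_def S_def)
    have violated: "\<exists>I. finite I \<and> I \<subseteq> A \<and> x \<notin> I \<and> card (R `` I \<union> (R `` {x} - {v})) \<le> card I"
      if v: "(x, v) \<in> R" for v
    proof -
      have "insert (x, v) X \<notin> \<A>"
        using max v unfolding R_def by blast
      moreover have "S - insert (x, v) X = R - {(x, v)}" by (auto simp: R_def)
      ultimately obtain K where K: "finite K" "K \<subseteq> A" "card ((R - {(x, v)}) `` K) < card K"
        by (auto simp: \<A>_def not_le)
      have xK: "x \<in> K"
      proof (rule ccontr)
        assume "x \<notin> K"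
        then have "(R - {(x, v)}) `` K = R `` K" by blast
        then show False using R[OF K(1,2)] K(3) by simp
      qed
      have "R `` (K - {x}) \<union> (R `` {x} - {v}) = (R - {(x, v)}) `` K" using xK by blast
      moreover have "card K = Suc (card (K - {x}))" using K(1) xK by (metis card_Suc_Diff1)
      ultimately show ?thesis using K by (intro exI[of _ "K - {x}"]) auto
    qed
    obtain I where I: "finite I" "I \<subseteq> A" "x \<notin> I" "card (R `` I \<union> (R `` {x} - {y})) \<le> card I"
      using violated[OF xy(1)] by blast
    obtain K where K: "finite K" "K \<subseteq> A" "x \<notin> K" "card (R `` K \<union> (R `` {x} - {y'})) \<le> card K"
      using violated[OF xy(2)] by blast
    let ?U = "R `` I \<union> (R `` {x} - {y})" and ?V = "R `` K \<union> (R `` {x} - {y'})"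
    have fx: "finite (R `` {x})" using finR[of "{x}"] xA by simp
    have f: "finite ?U" "finite ?V" using finR[OF I(1,2)] finR[OF K(1,2)] fx by auto
    have "?U \<union> ?V = R `` (insert x (I \<union> K))" using neq xy by blast
    moreover have "card (insert x (I \<union> K)) \<le> card (R `` (insert x (I \<union> K)))"
      using I K xA by (intro R) auto
    ultimately have 1: "Suc (card (I \<union> K)) \<le> card (?U \<union> ?V)"
      using I K by simp
    have "card (I \<inter> K) \<le> card (R `` (I \<inter> K))" using I K by (intro R) auto
    also have "\<dots> \<le> card (?U \<inter> ?V)" using f by (intro card_mono) auto
    finally have 2: "card (I \<inter> K) \<le> card (?U \<inter> ?V)" .
    show False
      using 1 2 I(4) K(4) card_Un_Int[OF f] card_Un_Int[OF I(1) K(1)] by linarith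
  qed
  have ex: "\<exists>y. (x, y) \<in> R" if "x \<in> A" for x
    using R[of "{x}"] that by (cases "R `` {x} = {}") auto
  define f where "f x = (SOME y. (x, y) \<in> R)" for x
  have fR: "(x, f x) \<in> R" if "x \<in> A" for x
    unfolding f_def using someI_ex[OF ex[OF that]] .
  have "inj_on f A"
  proof (rule inj_onI, rule ccontr)
    fix x x' assume h: "x \<in> A" "x' \<in> A" "f x = f x'" "x \<noteq> x'"
    have "R `` {x, x'} = {f x}" using fR[OF h(1)] fR[OF h(2)] single h(3) by auto
    then show False using R[of "{x, x'}"] h by simp
  qed
  moreover have "f x \<in> N x" if "x \<in> A" for x using fR[OF that] by (auto simp: R_def S_def)
  ultimately show ?thesis by blast
qed

text \<open>
  The usual bijection agrees everywhere with f or with the inverse of g, hence stays inside any relation that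
  contains the graphs of both. Applied to the relation of being at bounded distance.
\<close>

lemma cantor_bernstein_relation:
  assumes f: "inj_on f A" "f ` A \<subseteq> B" and g: "inj_on g B" "g ` B \<subseteq> A"
    and Ef: "\<And>x. x \<in> A \<Longrightarrow> E x (f x)" and Eg: "\<And>y. y \<in> B \<Longrightarrow> E (g y) y"
  shows "\<exists>h. bij_betw h A B \<and> (\<forall>x\<in>A. E x (h x))"
proof -
  define X where "X = lfp (\<lambda>X. A - g ` (B - f ` X))"
  have X: "X = A - g ` (B - f ` X)"
    unfolding X_def by (rule lfp_unfold) (intro monoI Diff_mono image_mono order_refl)
  define h where "h x = (if x \<in> X then f x else inv_into B g x)" for x
  have XA: "X \<subseteq> A" using X by blast
  have AX: "A - X = g ` (B - f ` X)" using X g(2) by blast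
  have b1: "bij_betw h X (f ` X)"
    using inj_on_subset[OF f(1) XA] by (auto simp: bij_betw_def h_def inj_on_def)
  have "bij_betw g (B - f ` X) (A - X)"
    using AX inj_on_subset[OF g(1)] by (auto simp: bij_betw_def)
  then have "bij_betw (inv_into (B - f ` X) g) (A - X) (B - f ` X)"
    by (rule bij_betw_inv_into)
  moreover have hX: "h x = inv_into (B - f ` X) g x" if "x \<in> A - X" for x
  proof -
    have "x \<in> g ` (B - f ` X)" using that by (simp only: AX)
    then obtain y where y: "x = g y" "y \<in> B - f ` X" by (rule imageE)
    have "x \<notin> X" using that by simp
    moreover have "inv_into B g (g y) = y" using g(1) y(2) by (intro inv_into_f_f) auto
    moreover have "inv_into (B - f ` X) g (g y) = y"
      using inj_on_subset[OF g(1)] y(2) by (intro inv_into_f_f) auto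
    ultimately show ?thesis using y(1) by (simp only: h_def if_False)
  qed
  ultimately have b2: "bij_betw h (A - X) (B - f ` X)"
    by (subst bij_betw_cong[OF hX]) assumption+
  have "bij_betw h (X \<union> (A - X)) (f ` X \<union> (B - f ` X))"
    by (rule bij_betw_combine[OF b1 b2]) auto
  moreover have "X \<union> (A - X) = A" "f ` X \<union> (B - f ` X) = B" using XA f(2) by auto
  moreover have "E x (h x)" if "x \<in> A" for x
  proof (cases "x \<in> X")
    case True then show ?thesis using Ef that by (simp add: h_def)
  next
    case False
    then have "x \<in> g ` (B - f ` X)" using that AX by blast
    then obtain y where y: "x = g y" "y \<in> B" by (elim imageE DiffE)
    then have "h x = y" using False g(1) by (simp only: h_def if_False inv_into_f_f)
    then show ?thesis using Eg[OF y(2)] y(1) by (simp only:)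
  qed
  ultimately show ?thesis by auto
qed

text \<open>
  The cells may miss the origin because the sectors used below are described by their polar angle.
\<close>

definition tiled_by :: "complex set \<Rightarrow> (complex \<Rightarrow> complex set) \<Rightarrow> real \<Rightarrow> bool" where
  "tiled_by A c D \<longleftrightarrow>
     (\<forall>x\<in>A. c x \<in> sets borel \<and> c x \<subseteq> cball x D \<and> emeasure lborel (c x) = ennreal pi) \<and>
     disjoint_family_on c A \<and> - (\<Union>x\<in>A. c x) \<subseteq> {0}"

lemma tiled_byD:
  assumes "tiled_by A c D"
  shows "\<And>x. x \<in> A \<Longrightarrow> c x \<in> sets borel"
    and "\<And>x z. x \<in> A \<Longrightarrow> z \<in> c x \<Longrightarrow> dist x z \<le> D"
    and "\<And>z. z \<noteq> 0 \<Longrightarrow> \<exists>x\<in>A. z \<in> c x"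
proof -
  fix x z assume "x \<in> A"
  then have *: "c x \<in> sets borel" "c x \<subseteq> cball x D" using assms by (auto simp: tiled_by_def)
  show "c x \<in> sets borel" by fact
  show "z \<in> c x \<Longrightarrow> dist x z \<le> D" using *(2) by auto
next
  fix z :: complex assume "z \<noteq> 0"
  moreover have "- (\<Union>x\<in>A. c x) \<subseteq> {0}" using assms by (simp add: tiled_by_def)
  ultimately show "\<exists>x\<in>A. z \<in> c x" by blast
qed

lemma sets_finite_tiles:
  assumes "tiled_by A c D" "finite F" "F \<subseteq> A"
  shows "(\<Union>x\<in>F. c x) \<in> sets lborel" "(\<Union>x\<in>F. c x) \<union> {0} \<in> sets lborel"
proof -
  show 1: "(\<Union>x\<in>F. c x) \<in> sets lborel"
    using assms tiled_byD(1)[OF assms(1)] by (auto intro!: sets.finite_UN)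
  show "(\<Union>x\<in>F. c x) \<union> {0} \<in> sets lborel" using 1 by (rule sets.Un) auto
qed

lemma emeasure_finite_tiles:
  assumes "tiled_by A c D" "finite F" "F \<subseteq> A"
  shows "emeasure lborel (\<Union>x\<in>F. c x) = ennreal (pi * card F)"
proof -
  have "emeasure lborel (\<Union>x\<in>F. c x) = (\<Sum>x\<in>F. emeasure lborel (c x))"
    by (rule sum_emeasure[symmetric])
       (use assms in \<open>auto simp: tiled_by_def intro: disjoint_family_on_mono\<close>)
  also have "\<dots> = (\<Sum>x\<in>F. ennreal pi)"
    by (rule sum.cong) (use assms in \<open>auto simp: tiled_by_def\<close>)
  also have "\<dots> = ennreal (pi * card F)"
    by (simp add: ennreal_of_nat_eq_real_of_nat ennreal_mult' mult.commute)
  finally show ?thesis .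
qed

lemma emeasure_ball_complex: "r \<ge> 0 \<Longrightarrow> emeasure lborel (ball (w::complex) r) = ennreal (pi * r\<^sup>2)"
  by (simp add: emeasure_ball unit_ball_vol_2 power2_eq_square)

text \<open>
  Disjoint cells of area \<open>\<pi>\<close> inside a disc of radius \<open>\<rho>\<close> number at most \<open>\<rho>\<^sup>2\<close>. Finiteness is part of the claim, since
  the cardinality of an infinite set is 0.
\<close>

lemma card_tiles_in_disc_le:
  assumes "tiled_by A c D" "\<rho> \<ge> 0" "F \<subseteq> A" "\<And>x. x \<in> F \<Longrightarrow> c x \<subseteq> ball w \<rho>"
  shows "finite F" "real (card F) \<le> \<rho>\<^sup>2"
proof -
  have *: "real (card G) \<le> \<rho>\<^sup>2" if G: "finite G" "G \<subseteq> F" for G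
  proof -
    have "ennreal (pi * card G) = emeasure lborel (\<Union>x\<in>G. c x)"
      using emeasure_finite_tiles[OF assms(1) G(1)] G assms by auto
    also have "\<dots> \<le> emeasure lborel (ball w \<rho>)"
      using G assms(4) by (intro emeasure_mono) auto
    also have "\<dots> = ennreal (pi * \<rho>\<^sup>2)" by (rule emeasure_ball_complex[OF assms(2)])
    finally show ?thesis by (simp add: ennreal_le_iff)
  qed
  show fin: "finite F"
  proof (rule ccontr)
    assume "infinite F"
    then obtain G where G: "G \<subseteq> F" "finite G" "card G = nat \<lceil>\<rho>\<^sup>2\<rceil> + 1"
      using infinite_arbitrarily_large by blast
    then have "real (nat \<lceil>\<rho>\<^sup>2\<rceil> + 1) \<le> \<rho>\<^sup>2" using *[OF G(2,1)] by simp
    then show False by linarith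
  qed
  show "real (card F) \<le> \<rho>\<^sup>2" using *[OF fin] by simp
qed

text \<open>
  The cells of the points in a disc cover the disc shrunk by the cell size, and they fit into the disc enlarged by it.
\<close>

lemma tiled_disc_discrepancy:
  assumes t: "tiled_by A c D"
  shows "disc_discrepancy_linear A"
proof -
  define D' where "D' = max 1 (D + 1)"
  have D': "D' \<ge> 1" "D' > D" by (auto simp: D'_def)
  have cell: "c x \<subseteq> cball x D" if "x \<in> A" for x using t that by (auto simp: tiled_by_def)
  have "\<bar>real (card (A \<inter> ball w r)) - r\<^sup>2\<bar> \<le> 3 * D' * r" if r: "r \<ge> D'" for w r
  proof -
    let ?F = "A \<inter> ball w r"
    have 1: "c x \<subseteq> ball w (r + D')" if "x \<in> ?F" for x
    proof
      fix y assume "y \<in> c x"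
      then have "dist x y \<le> D" "dist w x < r" using cell[of x] that by auto
      then show "y \<in> ball w (r + D')" using D' dist_triangle[of w y x] by simp
    qed
    have fin: "finite ?F" and up: "real (card ?F) \<le> (r + D')\<^sup>2"
      using card_tiles_in_disc_le[OF t, of "r + D'" ?F w] 1 r D' by auto
    have cov: "ball w (r - D') \<subseteq> (\<Union>x\<in>?F. c x) \<union> {0}"
    proof
      fix y assume y: "y \<in> ball w (r - D')"
      show "y \<in> (\<Union>x\<in>?F. c x) \<union> {0}"
      proof (cases "y = 0")
        case False
        then obtain x where x: "x \<in> A" "y \<in> c x" using tiled_byD(3)[OF t] by blast
        then have "dist x y \<le> D" by (rule tiled_byD(2)[OF t])
        then have "x \<in> ball w r" using y D' dist_triangle[of w x y] by (simp add: dist_commute)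
        then show ?thesis using x by auto
      qed auto
    qed
    have "ennreal (pi * (r - D')\<^sup>2) = emeasure lborel (ball w (r - D'))"
      using r by (simp add: emeasure_ball_complex)
    also have "\<dots> \<le> emeasure lborel ((\<Union>x\<in>?F. c x) \<union> {0})"
      using cov sets_finite_tiles(2)[OF t fin] by (intro emeasure_mono) auto
    also have "\<dots> \<le> emeasure lborel (\<Union>x\<in>?F. c x) + emeasure lborel {0::complex}"
      using sets_finite_tiles(1)[OF t fin] by (intro emeasure_subadditive) auto
    also have "\<dots> = ennreal (pi * card ?F)"
      using emeasure_finite_tiles[OF t fin] by simp
    finally have low: "(r - D')\<^sup>2 \<le> real (card ?F)" by (simp add: ennreal_le_iff)
    have p: "D'\<^sup>2 \<le> D' * r" "0 \<le> D' * r" using r D' by (simp_all add: power2_eq_square)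
    have "real (card ?F) \<le> r\<^sup>2 + 2 * (D' * r) + D'\<^sup>2" "r\<^sup>2 - 2 * (D' * r) + D'\<^sup>2 \<le> real (card ?F)"
      using up low by (simp_all add: power2_sum power2_diff mult_ac)
    with p have "\<bar>real (card ?F) - r\<^sup>2\<bar> \<le> 3 * (D' * r)" unfolding abs_le_iff
      using zero_le_power2[of D'] by (intro conjI; linarith)
    then show ?thesis by (simp add: mult_ac)
  qed
  then show ?thesis unfolding disc_discrepancy_linear_def
    by (intro exI[of _ "3 * D'"]) (auto simp: eventually_at_top_linorder)
qed

text \<open>
  Join two points if their cells meet. The cells of finitely many points of A are covered by the cells of their
  neighbours in B, and all cells have equal area; this is Hall's condition.
\<close>

lemma tiled_injection:
  assumes A: "tiled_by A c D" and B: "tiled_by B d D'"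
  shows "\<exists>f. inj_on f A \<and> (\<forall>x\<in>A. f x \<in> B \<and> cmod (f x - x) \<le> D + D')"
proof -
  define N where "N x = {y \<in> B. c x \<inter> d y \<noteq> {}}" for x
  have near: "cmod (y - x) \<le> D + D'" if "x \<in> A" "y \<in> N x" for x y
  proof -
    have yB: "y \<in> B" and "c x \<inter> d y \<noteq> {}" using that by (auto simp: N_def)
    then obtain z where z: "z \<in> c x" "z \<in> d y" by blast
    have "dist x z \<le> D" "dist y z \<le> D'"
      using tiled_byD(2)[OF A that(1) z(1)] tiled_byD(2)[OF B yB z(2)] .
    then show ?thesis using dist_triangle[of y x z] by (simp add: dist_norm norm_minus_commute)
  qed
  have fin: "finite (N x)" if x: "x \<in> A" for x
  proof (rule card_tiles_in_disc_le(1)[OF B])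
    show "N x \<subseteq> B" by (auto simp: N_def)
    show "0 \<le> max 0 (D + D' + D' + 1)" by simp
    fix y assume y: "y \<in> N x"
    show "d y \<subseteq> ball x (max 0 (D + D' + D' + 1))"
    proof
      fix z assume "z \<in> d y"
      then have "dist y z \<le> D'" using tiled_byD(2)[OF B] y by (auto simp: N_def)
      moreover have "dist x y \<le> D + D'" using near[OF x y] by (simp add: dist_norm norm_minus_commute)
      ultimately show "z \<in> ball x (max 0 (D + D' + D' + 1))" using dist_triangle[of x z y] by simp
    qed
  qed
  have hall: "card I \<le> card (\<Union>x\<in>I. N x)" if I: "finite I" "I \<subseteq> A" for I
  proof -
    let ?J = "\<Union>x\<in>I. N x"
    have J: "finite ?J" "?J \<subseteq> B" using I fin by (auto simp: N_def)
    have "(\<Union>x\<in>I. c x) \<subseteq> (\<Union>y\<in>?J. d y) \<union> {0}"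
    proof
      fix z assume z: "z \<in> (\<Union>x\<in>I. c x)"
      show "z \<in> (\<Union>y\<in>?J. d y) \<union> {0}"
      proof (cases "z = 0")
        case False
        then obtain y where "y \<in> B" "z \<in> d y" using tiled_byD(3)[OF B] by blast
        then show ?thesis using z by (auto simp: N_def)
      qed auto
    qed
    then have "emeasure lborel (\<Union>x\<in>I. c x) \<le> emeasure lborel ((\<Union>y\<in>?J. d y) \<union> {0})"
      using sets_finite_tiles(2)[OF B J] by (intro emeasure_mono)
    also have "\<dots> \<le> emeasure lborel (\<Union>y\<in>?J. d y) + emeasure lborel {0::complex}"
      using sets_finite_tiles(1)[OF B J] by (intro emeasure_subadditive) auto
    finally have "ennreal (pi * card I) \<le> ennreal (pi * card ?J)"
      using emeasure_finite_tiles[OF A I] emeasure_finite_tiles[OF B J] by simp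
    then show ?thesis by (simp add: ennreal_le_iff)
  qed
  obtain f where "inj_on f A" "\<forall>x\<in>A. f x \<in> N x" using infinite_hall[of A N] fin hall by blast
  then show ?thesis using near by (intro exI[of _ f]) (auto simp: N_def)
qed

theorem tiled_bounded_matching:
  assumes A: "tiled_by A c D" and B: "tiled_by B d D'"
  shows "\<exists>\<beta>. bounded_matching \<beta> A B"
proof -
  obtain f where f: "inj_on f A" "\<forall>x\<in>A. f x \<in> B \<and> cmod (f x - x) \<le> D + D'"
    using tiled_injection[OF A B] by blast
  obtain g where g: "inj_on g B" "\<forall>x\<in>B. g x \<in> A \<and> cmod (g x - x) \<le> D' + D"
    using tiled_injection[OF B A] by blast
  have "\<exists>h. bij_betw h A B \<and> (\<forall>x\<in>A. cmod (h x - x) \<le> D + D')"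
    using f g by (intro cantor_bernstein_relation[of f A B g])
      (auto simp: norm_minus_commute add.commute)
  then show ?thesis unfolding bounded_matching_def by blast
qed

section \<open>Rotation invariance and growth in the Fock space\<close>

lemma summable_inverse_squares: "summable (\<lambda>k. c / (real k + 1)\<^sup>2)"
proof -
  have "summable (\<lambda>n. 1 / (real n)\<^sup>2)"
    using inverse_power_summable[of 2, where ?'a = real] by (simp add: inverse_eq_divide)
  then have "summable (\<lambda>n. 1 / (real (Suc n))\<^sup>2)" by (subst summable_Suc_iff)
  then have "summable (\<lambda>n. c * (1 / (real (Suc n))\<^sup>2))" by (rule summable_mult)
  then show ?thesis by (simp add: add.commute)
qed

text \<open>
  Orthogonal maps of \<open>\<real>\<^sup>2\<close> are known to preserve Lebesgue measure; this transfers the fact to \<open>\<complex>\<close>.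
\<close>

lemma lborel_complex_eq_distr_vec2:
  "(lborel :: complex measure) = distr lborel borel (\<lambda>v::real^2. Complex (v $ 1) (v $ 2))"
proof (rule lborel_eqI)
  let ?\<phi> = "\<lambda>v::real^2. Complex (v $ 1) (v $ 2)"
  have [measurable]: "?\<phi> \<in> borel \<rightarrow>\<^sub>M borel"
    by (intro borel_measurable_continuous_onI) (simp add: Complex_eq continuous_intros)
  fix l u :: complex
  assume le: "\<And>b. b \<in> Basis \<Longrightarrow> l \<bullet> b \<le> u \<bullet> b"
  let ?l = "vector [Re l, Im l] :: real^2" and ?u = "vector [Re u, Im u] :: real^2"
  have le': "Re l \<le> Re u" "Im l \<le> Im u"
    using le[of 1] le[of \<i>] by (auto simp: Basis_complex_def)
  have "?\<phi> -` box l u = box ?l ?u"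
    by (auto simp: in_box_complex_iff mem_box_cart forall_2)
  then have "emeasure (distr lborel borel ?\<phi>) (box l u) = emeasure lborel (box ?l ?u)"
    by (simp add: emeasure_distr)
  also have "\<dots> = ennreal (measure lborel (cbox ?l ?u))"
  proof -
    have "?l \<bullet> b \<le> ?u \<bullet> b" if "b \<in> Basis" for b
      using that le' by (auto simp: Basis_vec_def inner_axis) (metis (full_types) exhaust_2 vector_2)
    then show ?thesis by (simp add: emeasure_lborel_box measure_def emeasure_lborel_cbox prod_nonneg inner_diff_left)
  qed
  also have "measure lborel (cbox ?l ?u) = (Re u - Re l) * (Im u - Im l)"
  proof -
    have "cbox ?l ?u \<noteq> {}" using le' by (auto simp: interval_ne_empty_cart forall_2)
    then show ?thesis by (simp add: content_cbox_cart UNIV_2)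
  qed
  also have "\<dots> = (\<Prod>b\<in>Basis. (u - l) \<bullet> b)" by (simp add: Basis_complex_def)
  finally show "emeasure (distr lborel borel ?\<phi>) (box l u) = ennreal (\<Prod>b\<in>Basis. (u - l) \<bullet> b)" .
qed simp

theorem lborel_distr_rotation:
  fixes c :: complex assumes c: "cmod c = 1"
  shows "distr lborel borel (\<lambda>z. c * z) = lborel"
proof (rule lborel_eqI[symmetric])
  let ?\<phi> = "\<lambda>v::real^2. Complex (v $ 1) (v $ 2)"
  let ?\<psi> = "\<lambda>z. vector [Re z, Im z] :: real^2"
  define R where "R v = ?\<psi> (cnj c * ?\<phi> v)" for v
  have \<phi>\<psi>: "?\<phi> (?\<psi> z) = z" "?\<psi> (?\<phi> v) = v" for z v
    by (auto simp: complex_eq_iff vec_eq_iff forall_2)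
  have [measurable]: "?\<phi> \<in> borel \<rightarrow>\<^sub>M borel"
    by (intro borel_measurable_continuous_onI) (simp add: Complex_eq continuous_intros)
  have normv: "norm v = cmod (?\<phi> v)" for v :: "real^2"
    by (simp add: norm_vec_def L2_set_def sum_2 cmod_def)
  have "linear R"
    unfolding R_def by (intro linearI) (auto simp: vec_eq_iff forall_2 algebra_simps)
  then have orth: "orthogonal_transformation R"
    unfolding orthogonal_transformation
    by (simp only: normv R_def \<phi>\<psi> norm_mult) (simp add: c)
  have cc: "cnj c * c = 1" "c * cnj c = 1"
    using complex_norm_square[of c] c by (simp_all add: mult.commute)
  fix l u :: complex
  assume le: "\<And>b. b \<in> Basis \<Longrightarrow> l \<bullet> b \<le> u \<bullet> b"
  let ?S = "?\<phi> -` box l u"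
  have S: "?S = box (?\<psi> l) (?\<psi> u)"
    by (auto simp: in_box_complex_iff mem_box_cart forall_2)
  then have Sm: "?S \<in> lmeasurable" by simp
  have RS: "?\<phi> -` ((\<lambda>z. c * z) -` box l u) = R ` ?S"
  proof (intro equalityI subsetI)
    fix v assume "v \<in> ?\<phi> -` ((\<lambda>z. c * z) -` box l u)"
    then have "?\<psi> (c * ?\<phi> v) \<in> ?S" by (simp only: vimage_eq \<phi>\<psi>)
    moreover have "R (?\<psi> (c * ?\<phi> v)) = v"
      unfolding R_def \<phi>\<psi> by (simp only: mult.assoc[symmetric] cc mult_1 \<phi>\<psi>)
    ultimately show "v \<in> R ` ?S" by (intro rev_image_eqI[where x = "?\<psi> (c * ?\<phi> v)"]) (simp_all only:)
  next
    fix v assume "v \<in> R ` ?S"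
    then obtain w where w: "v = R w" "?\<phi> w \<in> box l u" by blast
    then show "v \<in> ?\<phi> -` ((\<lambda>z. c * z) -` box l u)"
      unfolding R_def vimage_eq w \<phi>\<psi> by (simp only: mult.assoc[symmetric] cc mult_1 R_def \<phi>\<psi>)
  qed
  have mS: "?S \<in> sets borel" unfolding S by simp
  have mB: "(\<lambda>z. c * z) -` box l u \<in> sets borel"
    by (intro borel_open open_vimage continuous_intros open_box)
  have mRS: "R ` ?S \<in> sets borel"
    unfolding RS[symmetric] by (rule measurable_sets_borel[of _ borel]) (use mB in auto)
  have "emeasure (distr lborel borel (\<lambda>z. c * z)) (box l u) = emeasure lborel ((\<lambda>z. c * z) -` box l u)"
    using mB by (simp add: emeasure_distr)
  also have "\<dots> = emeasure lborel (?\<phi> -` ((\<lambda>z. c * z) -` box l u))"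
    using mB by (subst lborel_complex_eq_distr_vec2, subst emeasure_distr) auto
  also have "\<dots> = emeasure lebesgue (R ` ?S)"
    using mRS unfolding RS by simp
  also have "\<dots> = ennreal (measure lebesgue (R ` ?S))"
    using measurable_orthogonal_image[OF orth Sm] by (simp add: emeasure_eq_measure2 fmeasurableD2)
  also have "measure lebesgue (R ` ?S) = measure lebesgue ?S"
    by (rule measure_orthogonal_image[OF orth Sm])
  also have "ennreal \<dots> = emeasure lebesgue ?S"
    using Sm by (simp add: emeasure_eq_measure2 fmeasurableD2)
  also have "\<dots> = emeasure lborel ?S" using mS by simp
  also have "\<dots> = emeasure lborel (box l u)"
    by (subst lborel_complex_eq_distr_vec2, subst emeasure_distr) auto
  also have "\<dots> = ennreal (\<Prod>b\<in>Basis. (u - l) \<bullet> b)"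
    using le by (rule emeasure_lborel_box)
  finally show "emeasure (distr lborel borel (\<lambda>z. c * z)) (box l u) = ennreal (\<Prod>b\<in>Basis. (u - l) \<bullet> b)" .
qed simp

lemma nn_integral_rotation:
  fixes c :: complex
  assumes c: "cmod c = 1" and [measurable]: "f \<in> borel_measurable borel"
  shows "(\<integral>\<^sup>+z. f (c * z) \<partial>lborel) = (\<integral>\<^sup>+z. f z \<partial>lborel)"
  by (subst (2) lborel_distr_rotation[OF c, symmetric], subst nn_integral_distr) auto

lemma emeasure_rotation_image:
  fixes c :: complex
  assumes c: "cmod c = 1" and S: "S \<in> sets borel"
  shows "(\<lambda>z. c * z) ` S \<in> sets borel" "emeasure lborel ((\<lambda>z. c * z) ` S) = emeasure lborel S"
proof -
  have c0: "c \<noteq> 0" using c by auto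
  have c': "cmod (inverse c) = 1" using c by (simp add: norm_inverse)
  have *: "(\<lambda>z. c * z) ` S = (\<lambda>z. inverse c * z) -` S"
  proof (intro equalityI subsetI)
    fix z assume "z \<in> (\<lambda>z. inverse c * z) -` S"
    moreover have "z = c * (inverse c * z)" using c0 by simp
    ultimately show "z \<in> (\<lambda>z. c * z) ` S" by blast
  qed (use c0 in \<open>auto simp: mult.assoc[symmetric]\<close>)
  have m: "(\<lambda>z. inverse c * z) \<in> borel \<rightarrow>\<^sub>M borel" by measurable
  show "(\<lambda>z. c * z) ` S \<in> sets borel" unfolding * using measurable_sets[OF m S] by simp
  have "emeasure lborel S = emeasure (distr lborel borel (\<lambda>z. inverse c * z)) S"
    by (simp only: lborel_distr_rotation[OF c'])
  also have "\<dots> = emeasure lborel ((\<lambda>z. inverse c * z) -` S)"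
    using S by (simp add: emeasure_distr)
  finally show "emeasure lborel ((\<lambda>z. c * z) ` S) = emeasure lborel S" unfolding * ..
qed

lemma norm_le_circle_mean:
  assumes g: "g holomorphic_on UNIV"
  shows "ennreal (cmod (g z)) \<le>
    (\<integral>\<^sup>+t. indicator {0..1} t * ennreal (cmod (g (z + exp (2 * of_real pi * \<i> * of_real t) * u))) \<partial>lborel)"
proof -
  define G where "G w = g (z + w * u)" for w
  have "g \<circ> (\<lambda>w. z + w * u) holomorphic_on UNIV"
    by (rule holomorphic_on_compose_gen[OF _ g]) (auto intro!: holomorphic_intros)
  then have G: "G holomorphic_on UNIV" by (simp add: o_def G_def[abs_def])
  have "((\<lambda>w. G w / (w - 0)) has_contour_integral 2 * of_real pi * \<i> * G 0) (circlepath 0 1)"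
    by (rule Cauchy_integral_circlepath_simple) (auto intro: holomorphic_on_subset[OF G])
  then have 1: "((\<lambda>t. (G (circlepath 0 1 t) / circlepath 0 1 t) * vector_derivative (circlepath 0 1) (at t within {0..1}))
      has_integral 2 * of_real pi * \<i> * G 0) {0..1}"
    by (simp add: has_contour_integral_def)
  have "((\<lambda>t. 2 * of_real pi * \<i> * G (exp (2 * of_real pi * \<i> * of_real t))) has_integral 2 * of_real pi * \<i> * G 0) {0..1}"
    by (rule has_integral_eq[OF _ 1]) (subst vector_derivative_circlepath01, auto simp: circlepath)
  moreover have "inverse (2 * of_real pi * \<i>) * (2 * of_real pi * \<i> * x) = x" for x :: complex
    by (simp add: field_simps)
  ultimately have 2: "((\<lambda>t. G (exp (2 * of_real pi * \<i> * of_real t))) has_integral G 0) {0..1::real}"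
    using has_integral_mult_right[of _ "2 * of_real pi * \<i> * G 0" "{0..1}" "inverse (2 * of_real pi * \<i>)"]
    by fastforce
  have cont: "continuous_on {0..1::real} (\<lambda>t. G (exp (2 * of_real pi * \<i> * of_real t)))"
    by (intro continuous_on_compose2[OF holomorphic_on_imp_continuous_on[OF G]] continuous_intros) auto
  have int: "(\<lambda>t. cmod (G (exp (2 * of_real pi * \<i> * of_real t)))) integrable_on {0..1::real}"
    by (intro integrable_continuous_interval continuous_intros cont)
  have "cmod (G 0) \<le> integral {0..1} (\<lambda>t. cmod (G (exp (2 * of_real pi * \<i> * of_real t))))"
    using integral_norm_bound_integral[OF has_integral_integrable[OF 2] int] integral_unique[OF 2] by auto
  then have "ennreal (cmod (G 0)) \<le> ennreal (integral {0..1} (\<lambda>t. cmod (G (exp (2 * of_real pi * \<i> * of_real t)))))"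
    by (rule ennreal_leI)
  also have "\<dots> = (\<integral>\<^sup>+t. indicator {0..1} t * cmod (G (exp (2 * of_real pi * \<i> * of_real t))) \<partial>lborel)"
    using nn_integral_has_integral_lebesgue[OF _ integrable_integral[OF int]] by simp
  also have "\<dots> = (\<integral>\<^sup>+t. indicator {0..1} t * ennreal (cmod (g (z + exp (2 * of_real pi * \<i> * of_real t) * u))) \<partial>lborel)"
    by (intro nn_integral_cong) (auto simp: G_def indicator_def)
  finally show ?thesis by (simp add: G_def)
qed

text \<open>
  Polar coordinates are avoided: by rotation invariance the integral over the disc equals the same integral with u replaced by
  \<open>e\<^sup>i\<^sup>tu\<close>, for every t. Averaging over t first, the circle mean of \<open>|g|\<close> is at least its value at the centre.
\<close>

theorem area_mean_value:
  assumes g: "g holomorphic_on UNIV"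
  shows "ennreal (cmod (g z)) * emeasure lborel (ball (0::complex) \<delta>) \<le>
    (\<integral>\<^sup>+u. indicator (ball 0 \<delta>) u * ennreal (cmod (g (z + u))) \<partial>lborel)"
proof -
  have [measurable]: "g \<in> borel_measurable borel"
    by (intro borel_measurable_continuous_onI holomorphic_on_imp_continuous_on g)
  define e :: "real \<Rightarrow> complex" where "e t = exp (2 * of_real pi * \<i> * of_real t)" for t
  have [measurable]: "ball (0::complex) \<delta> \<in> sets borel" by simp
  let ?h = "\<lambda>u. indicator (ball 0 \<delta>) u * ennreal (cmod (g (z + u)))"
  have [measurable]: "e \<in> borel_measurable borel"
    unfolding e_def by (intro borel_measurable_continuous_onI continuous_intros)
  have ne: "cmod (e t) = 1" for t by (simp add: e_def)
  have he: "?h (e t * u) = indicator (ball 0 \<delta>) u * ennreal (cmod (g (z + e t * u)))" for t u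
    by (auto simp: indicator_def norm_mult ne)
  have "ennreal (cmod (g z)) * emeasure lborel (ball (0::complex) \<delta>)
      = (\<integral>\<^sup>+u. indicator (ball 0 \<delta>) (u::complex) * ennreal (cmod (g z)) \<partial>lborel)"
    unfolding mult.commute[of "indicator _ _"] by (subst nn_integral_cmult_indicator) auto
  also have "\<dots> \<le> (\<integral>\<^sup>+u. indicator (ball 0 \<delta>) u * (\<integral>\<^sup>+t. indicator {0..1} t * ennreal (cmod (g (z + e t * u))) \<partial>lborel) \<partial>lborel)"
    by (intro nn_integral_mono mult_left_mono norm_le_circle_mean[OF g, folded e_def]) simp
  also have "\<dots> = (\<integral>\<^sup>+u. (\<integral>\<^sup>+t. indicator {0..1} t * ?h (e t * u) \<partial>lborel) \<partial>lborel)"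
    unfolding he by (subst nn_integral_cmult[symmetric]) (auto simp: mult_ac)
  also have "\<dots> = (\<integral>\<^sup>+t. (\<integral>\<^sup>+u. indicator {0..1} t * ?h (e t * u) \<partial>lborel) \<partial>lborel)"
  proof -
    have "(\<lambda>(t, u). indicator {0..1} t * ?h (e t * u)) \<in> borel_measurable (lborel \<Otimes>\<^sub>M lborel)"
      by measurable
    from lborel_pair.Fubini[OF this] show ?thesis by simp
  qed
  also have "\<dots> = (\<integral>\<^sup>+t. indicator {0..1::real} t * (\<integral>\<^sup>+u. ?h (e t * u) \<partial>lborel) \<partial>lborel)"
    by (intro nn_integral_cong nn_integral_cmult) measurable
  also have "\<dots> = (\<integral>\<^sup>+t. indicator {0..1::real} t * (\<integral>\<^sup>+u. ?h u \<partial>lborel) \<partial>lborel)"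
    by (intro nn_integral_cong arg_cong2[of _ _ _ _ "(*)"] refl nn_integral_rotation ne) measurable
  also have "\<dots> = (\<integral>\<^sup>+u. ?h u \<partial>lborel)"
    by (simp add: nn_integral_multc)
  finally show ?thesis .
qed

text \<open>
  The mean value is taken over a disc of radius \<open>\<delta> = 1/(1 + |z|)\<close>, on which the Gaussian weight is constant up to a factor \<open>e\<^sup>3\<close>. The
  resulting power of \<open>1 + |z|\<close> is not optimal, but powers are harmless here.
\<close>

theorem fock_space_growth:
  assumes f: "f \<in> fock_space"
  shows "\<exists>C>0. \<forall>z. (cmod (f z))\<^sup>2 \<le> C * (1 + cmod z)\<^sup>2 * exp ((cmod z)\<^sup>2)"
proof -
  have hol: "f holomorphic_on UNIV" and fin: "fock_sqnorm f < \<infinity>"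
    using f by (auto simp: fock_space_def)
  have [measurable]: "f \<in> borel_measurable borel"
    by (intro borel_measurable_continuous_onI holomorphic_on_imp_continuous_on hol)
  define I where "I = (\<integral>\<^sup>+ z. ennreal ((cmod (f z))\<^sup>2 * exp (- (cmod z)\<^sup>2)) \<partial>lborel)"
  have "I < \<infinity>"
    using fin unfolding fock_sqnorm_def I_def[symmetric]
    by (auto simp: ennreal_mult_less_top)
  then obtain K where K: "I = ennreal K" "K \<ge> 0" by (cases I) auto
  have "(cmod (f z))\<^sup>2 \<le> exp 3 * (K + 1) * (1 + cmod z)\<^sup>2 * exp ((cmod z)\<^sup>2)" for z
  proof -
    \<comment> \<open>small enough for the weight to be essentially constant, large enough to lose only a power\<close>
    define \<delta> where "\<delta> = 1 / (1 + cmod z)"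
    have "0 < 1 + cmod z" by (simp add: add_pos_nonneg)
    then have \<delta>: "\<delta> > 0" "\<delta> \<le> 1" "\<delta> * cmod z \<le> 1"
      by (auto simp: \<delta>_def divide_simps)
    let ?E = "exp ((cmod z)\<^sup>2 + 3)"
    have bd: "(cmod (f (z + u)))\<^sup>2 \<le> ?E * ((cmod (f (z + u)))\<^sup>2 * exp (- (cmod (z + u))\<^sup>2))"
      if "u \<in> ball 0 \<delta>" for u
    proof -
      have "cmod (z + u) \<le> cmod z + \<delta>" using that norm_triangle_ineq[of z u] by auto
      then have "(cmod (z + u))\<^sup>2 \<le> (cmod z + \<delta>)\<^sup>2" by (intro power_mono) auto
      also have "\<dots> = (cmod z)\<^sup>2 + 2 * (\<delta> * cmod z) + \<delta>\<^sup>2" by (simp add: power2_eq_square algebra_simps)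
      also have "\<dots> \<le> (cmod z)\<^sup>2 + 3" using \<delta> power_le_one[of \<delta> 2] by auto
      finally have "1 \<le> ?E * exp (- (cmod (z + u))\<^sup>2)" by (simp add: exp_add[symmetric])
      then have "(cmod (f (z + u)))\<^sup>2 * 1 \<le> (cmod (f (z + u)))\<^sup>2 * (?E * exp (- (cmod (z + u))\<^sup>2))"
        by (rule mult_left_mono) simp
      then show ?thesis by (simp add: mult_ac)
    qed
    have "(\<lambda>z. (f z)\<^sup>2) holomorphic_on UNIV" using hol by (intro holomorphic_intros)
    from area_mean_value[OF this, of z \<delta>]
    have "ennreal ((cmod (f z))\<^sup>2) * ennreal (pi * \<delta>\<^sup>2)
      \<le> (\<integral>\<^sup>+u. indicator (ball 0 \<delta>) u * ennreal ((cmod (f (z + u)))\<^sup>2) \<partial>lborel)"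
      using \<delta> by (simp add: norm_power emeasure_ball unit_ball_vol_2)
    also have "\<dots> \<le> (\<integral>\<^sup>+u. ennreal ?E * ennreal ((cmod (f (z + u)))\<^sup>2 * exp (- (cmod (z + u))\<^sup>2)) \<partial>lborel)"
      using bd by (intro nn_integral_mono) (auto simp: indicator_def ennreal_mult[symmetric] intro!: ennreal_leI)
    also have "\<dots> = ennreal ?E * (\<integral>\<^sup>+u. ennreal ((cmod (f (z + u)))\<^sup>2 * exp (- (cmod (z + u))\<^sup>2)) \<partial>lborel)"
      by (intro nn_integral_cmult) measurable
    also have "(\<integral>\<^sup>+u. ennreal ((cmod (f (z + u)))\<^sup>2 * exp (- (cmod (z + u))\<^sup>2)) \<partial>lborel) = I"
      unfolding I_def by (subst lborel_distr_plus[symmetric, of z], subst nn_integral_distr) auto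
    finally have "(cmod (f z))\<^sup>2 * (pi * \<delta>\<^sup>2) \<le> ?E * K"
      using K by (simp add: ennreal_mult[symmetric] ennreal_le_iff)
    moreover have "(cmod (f z))\<^sup>2 * (1 * \<delta>\<^sup>2) \<le> (cmod (f z))\<^sup>2 * (pi * \<delta>\<^sup>2)"
      using pi_gt3 by (intro mult_left_mono mult_right_mono) auto
    ultimately have "(cmod (f z))\<^sup>2 * \<delta>\<^sup>2 \<le> ?E * (K + 1)" by (simp add: distrib_left add_increasing2)
    then have "(cmod (f z))\<^sup>2 \<le> ?E * (K + 1) / \<delta>\<^sup>2"
      using \<delta> by (simp add: pos_le_divide_eq)
    also have "\<dots> = exp 3 * (K + 1) * (1 + cmod z)\<^sup>2 * exp ((cmod z)\<^sup>2)"
      by (simp add: \<delta>_def exp_add power_divide)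
    finally show ?thesis .
  qed
  then show ?thesis using K by (intro exI[of _ "exp 3 * (K + 1)"]) auto
qed

text \<open>
  The integrand is dominated by the sum over n of \<open>K/(1+n)\<^sup>4\<close> times the indicator of the disc of radius n + 1, whose
  integrals \<open>\<pi>K/(n+1)\<^sup>2\<close> are summable.
\<close>

theorem fock_spaceI_decay:
  assumes hol: "f holomorphic_on UNIV"
    and le: "\<And>z. (cmod (f z))\<^sup>2 * exp (- (cmod z)\<^sup>2) \<le> K / (1 + cmod z) ^ 4"
  shows "f \<in> fock_space"
proof -
  have K: "K \<ge> 0" using le[of 0] order_trans[of 0 "(cmod (f 0))\<^sup>2"] by simp
  let ?S = "\<lambda>z::complex. \<Sum>n. ennreal (K / (1 + real n) ^ 4) * indicator (ball 0 (real n + 1)) z"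
  have "ennreal ((cmod (f z))\<^sup>2 * exp (- (cmod z)\<^sup>2)) \<le> ?S z" for z
  proof -
    define n where "n = nat \<lfloor>cmod z\<rfloor>"
    have n: "real n \<le> cmod z" "cmod z < real n + 1"
      unfolding n_def by (auto simp: of_nat_nat)
    have "(cmod (f z))\<^sup>2 * exp (- (cmod z)\<^sup>2) \<le> K / (1 + real n) ^ 4"
      using n K by (intro order_trans[OF le] divide_left_mono power_mono mult_pos_pos zero_less_power) auto
    then have "ennreal ((cmod (f z))\<^sup>2 * exp (- (cmod z)\<^sup>2))
       \<le> ennreal (K / (1 + real n) ^ 4) * indicator (ball 0 (real n + 1)) z"
      using n by (auto intro!: ennreal_leI)
    also have "\<dots> \<le> ?S z"
    proof -
      have "T n \<le> suminf T" for T :: "nat \<Rightarrow> ennreal" using sum_le_suminf[of T "{n}"] by simp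
      then show ?thesis .
    qed
    finally show ?thesis .
  qed
  then have "(\<integral>\<^sup>+z. ennreal ((cmod (f z))\<^sup>2 * exp (- (cmod z)\<^sup>2)) \<partial>lborel) \<le> (\<integral>\<^sup>+z. ?S z \<partial>lborel)"
    by (rule nn_integral_mono)
  also have "\<dots> = (\<Sum>n. \<integral>\<^sup>+z. ennreal (K / (1 + real n) ^ 4) * indicator (ball 0 (real n + 1)) (z::complex) \<partial>lborel)"
    by (intro nn_integral_suminf borel_measurable_times_ennreal borel_measurable_const
        borel_measurable_indicator) simp
  also have "\<dots> = (\<Sum>n. ennreal (K * pi * (1 / (real (Suc n))\<^sup>2)))"
  proof (intro suminf_cong)
    fix n
    have "(\<integral>\<^sup>+z. ennreal (K / (1 + real n) ^ 4) * indicator (ball 0 (real n + 1)) (z::complex) \<partial>lborel)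
        = ennreal (K / (1 + real n) ^ 4) * ennreal (pi * (real n + 1)\<^sup>2)"
      by (subst nn_integral_cmult_indicator) (simp_all add: emeasure_ball unit_ball_vol_2)
    also have "\<dots> = ennreal (K / (1 + real n) ^ 4 * (pi * (real n + 1)\<^sup>2))"
      using K by (simp add: ennreal_mult[symmetric])
    also have "K / (1 + real n) ^ 4 * (pi * (real n + 1)\<^sup>2) = K * pi * (1 / (real (Suc n))\<^sup>2)"
      by (simp add: divide_simps add.commute)
    finally show "(\<integral>\<^sup>+z. ennreal (K / (1 + real n) ^ 4) * indicator (ball 0 (real n + 1)) (z::complex) \<partial>lborel)
       = ennreal (K * pi * (1 / (real (Suc n))\<^sup>2))" .
  qed
  also have "\<dots> < \<infinity>"
  proof -
    have "summable (\<lambda>n. K * pi * (1 / (real (Suc n))\<^sup>2))"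
      using summable_inverse_squares[of "K * pi"] by (simp add: add.commute)
    then show ?thesis using K by (subst suminf_ennreal2) auto
  qed
  finally have "fock_sqnorm f < \<infinity>"
    unfolding fock_sqnorm_def by (simp add: ennreal_mult_less_top)
  then show ?thesis using hol by (simp add: fock_space_def)
qed

section \<open>The lattice and annular sectors as tilings\<close>

lemma sqrt_pi_lattice_tiled: "\<exists>c D. tiled_by sqrt_pi_lattice c D"
proof -
  define s where "s = sqrt pi"
  have s: "s > 0" "s * s = pi" by (auto simp: s_def)
  define c :: "complex \<Rightarrow> complex set" where
    "c x = {z. Re x \<le> Re z \<and> Re z < Re x + s \<and> Im x \<le> Im z \<and> Im z < Im x + s}" for x
  have meas: "c x \<in> sets borel" for x unfolding c_def by measurable
  have em: "emeasure lborel (c x) = ennreal pi" for x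
  proof (rule antisym)
    let ?u = "x + Complex s s"
    have le: "x \<bullet> b \<le> ?u \<bullet> b" if "b \<in> Basis" for b
      using that s by (auto simp: Basis_complex_def)
    have pr: "(\<Prod>b\<in>Basis. (?u - x) \<bullet> b) = pi"
      using s by (simp add: Basis_complex_def)
    have "emeasure lborel (c x) \<le> emeasure lborel (cbox x ?u)"
      by (intro emeasure_mono) (auto simp: c_def in_cbox_complex_iff)
    also have "\<dots> = ennreal pi" using emeasure_lborel_cbox[OF le] pr by simp
    finally show "emeasure lborel (c x) \<le> ennreal pi" .
    have "ennreal pi = emeasure lborel (box x ?u)" using emeasure_lborel_box[OF le] pr by simp
    also have "\<dots> \<le> emeasure lborel (c x)"
      using meas[of x] by (intro emeasure_mono) (auto simp: c_def in_box_complex_iff)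
    finally show "ennreal pi \<le> emeasure lborel (c x)" .
  qed
  have sub: "c x \<subseteq> cball x (2 * s)" for x
  proof
    fix z assume "z \<in> c x"
    then have "\<bar>Re (z - x)\<bar> + \<bar>Im (z - x)\<bar> \<le> 2 * s" by (auto simp: c_def)
    then show "z \<in> cball x (2 * s)"
      using cmod_le[of "z - x"] by (simp add: dist_norm norm_minus_commute)
  qed
  have key: "m = \<lfloor>Re z / s\<rfloor> \<and> n = \<lfloor>Im z / s\<rfloor>"
    if "z \<in> c (of_real s * (of_int m + \<i> * of_int n))" for z m n
  proof -
    have "of_int m \<le> Re z / s" "Re z / s < of_int m + 1" "of_int n \<le> Im z / s" "Im z / s < of_int n + 1"
      using that s by (auto simp: c_def field_simps)
    then show ?thesis by (auto intro!: floor_unique[symmetric])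
  qed
  have "disjoint_family_on c sqrt_pi_lattice"
    unfolding disjoint_family_on_def
  proof (intro ballI impI, rule ccontr)
    fix x y assume xy: "x \<in> sqrt_pi_lattice" "y \<in> sqrt_pi_lattice" "x \<noteq> y" "c x \<inter> c y \<noteq> {}"
    then obtain z where z: "z \<in> c x" "z \<in> c y" by blast
    obtain m n where x: "x = of_real s * (of_int m + \<i> * of_int n)"
      using xy by (auto simp: sqrt_pi_lattice_def s_def)
    obtain m' n' where y: "y = of_real s * (of_int m' + \<i> * of_int n')"
      using xy by (auto simp: sqrt_pi_lattice_def s_def)
    show False using key[of z m n] key[of z m' n'] z xy(3) unfolding x y by simp
  qed
  moreover have "z \<in> (\<Union>x\<in>sqrt_pi_lattice. c x)" for z
  proof -
    let ?x = "of_real s * (of_int \<lfloor>Re z / s\<rfloor> + \<i> * of_int \<lfloor>Im z / s\<rfloor>) :: complex"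
    have f: "s * of_int \<lfloor>t / s\<rfloor> \<le> t \<and> t < s * of_int \<lfloor>t / s\<rfloor> + s" for t
      using floor_divide_lower[OF s(1), of t] floor_divide_upper[OF s(1), of t]
      by (simp add: algebra_simps)
    have "?x \<in> sqrt_pi_lattice" by (auto simp: sqrt_pi_lattice_def s_def)
    moreover have "z \<in> c ?x" using f by (simp add: c_def)
    ultimately show ?thesis by blast
  qed
  then have "- (\<Union>x\<in>sqrt_pi_lattice. c x) \<subseteq> {0}" by blast
  ultimately have "tiled_by sqrt_pi_lattice c (2 * s)"
    using meas em sub by (simp add: tiled_by_def)
  then show ?thesis by blast
qed

text \<open>
  The m-th of N congruent pieces of the annulus \<open>r \<le> |z| < r'\<close>.
\<close>

definition sector :: "real \<Rightarrow> real \<Rightarrow> nat \<Rightarrow> nat \<Rightarrow> complex set" where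
  "sector r r' N m = {z. z \<noteq> 0 \<and> r \<le> cmod z \<and> cmod z < r' \<and>
     2 * pi * real m / real N \<le> Arg2pi z \<and> Arg2pi z < 2 * pi * (real m + 1) / real N}"

lemma sector_borel: "sector r r' N m \<in> sets borel"
proof -
  have "Arg2pi \<in> borel_measurable borel"
    unfolding borel_measurable_iff_greater using open_Arg2pi2pi_gt by auto
  then show ?thesis unfolding sector_def by measurable
qed

lemma sector_disjoint: "N > 0 \<Longrightarrow> m \<noteq> m' \<Longrightarrow> sector r r' N m \<inter> sector s s' N m' = {}"
proof (rule ccontr)
  assume N: "N > 0" and m: "m \<noteq> m'" and "sector r r' N m \<inter> sector s s' N m' \<noteq> {}"
  then obtain z where "z \<in> sector r r' N m" "z \<in> sector s s' N m'" by blast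
  then have "2 * pi * real m / real N < 2 * pi * (real m' + 1) / real N"
      "2 * pi * real m' / real N < 2 * pi * (real m + 1) / real N"
    unfolding sector_def mem_Collect_eq by linarith+
  then have "real m < real m' + 1" "real m' < real m + 1"
    using N by (simp_all add: divide_less_cancel)
  then show False using m by linarith
qed

lemma sector_cover:
  assumes "N > 0" "z \<noteq> 0" "r \<le> cmod z" "cmod z < r'"
  shows "\<exists>m<N. z \<in> sector r r' N m"
proof -
  define t where "t = Arg2pi z * real N / (2 * pi)"
  have t: "0 \<le> t" "t < real N"
    using Arg2pi[of z] assms(1) by (auto simp: t_def divide_simps)
  define m where "m = nat \<lfloor>t\<rfloor>"
  have mt: "real m \<le> t" "t < real m + 1" using t by (auto simp: m_def)
  have A: "Arg2pi z = 2 * pi * t / real N" using assms(1) by (simp add: t_def)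
  have "2 * pi * real m / real N \<le> Arg2pi z" "Arg2pi z < 2 * pi * (real m + 1) / real N"
    unfolding A using mt assms(1) by (auto intro!: divide_right_mono divide_strict_right_mono)
  moreover have "m < N" using mt t by linarith
  ultimately show ?thesis using assms by (auto simp: sector_def)
qed

lemma sector_rotate:
  assumes N: "N > 0" and m: "m < N"
  shows "sector r r' N m = (\<lambda>z. cis (2 * pi * real m / real N) * z) ` sector r r' N 0"
proof -
  let ?\<alpha> = "2 * pi * real m / real N"
  have top: "2 * pi * (real m + 1) / real N \<le> 2 * pi"
    using m N by (simp add: divide_le_eq)
  have polar: "z = of_real (cmod z) * exp (\<i> * of_real (Arg2pi z))" for z
    using Arg2pi_eq[of z] .
  show ?thesis
  proof (intro equalityI subsetI)
    fix z assume z: "z \<in> sector r r' N m"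
    define w where "w = cis (- ?\<alpha>) * z"
    have zw: "z = cis ?\<alpha> * w" by (simp add: w_def mult.assoc[symmetric] cis_mult)
    have nw: "cmod w = cmod z" by (simp add: w_def norm_mult)
    have "Arg2pi w = Arg2pi z - ?\<alpha>"
    proof (rule Arg2pi_unique)
      show "of_real (cmod z) * exp (\<i> * of_real (Arg2pi z - ?\<alpha>)) = w"
        unfolding w_def by (subst (2) polar) (simp add: cis_conv_exp exp_add[symmetric] algebra_simps)
      have "0 \<le> ?\<alpha>" by simp
      then show "Arg2pi z - ?\<alpha> < 2 * pi" using Arg2pi[of z] by linarith
    qed (use z in \<open>auto simp: sector_def\<close>)
    moreover have "2 * pi * (real m + 1) / real N = ?\<alpha> + 2 * pi / real N"
      by (simp add: add_divide_distrib distrib_left)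
    ultimately have "w \<in> sector r r' N 0" using z nw by (auto simp: sector_def w_def)
    then show "z \<in> (\<lambda>z. cis ?\<alpha> * z) ` sector r r' N 0" using zw by blast
  next
    fix z assume "z \<in> (\<lambda>z. cis ?\<alpha> * z) ` sector r r' N 0"
    then obtain w where w: "w \<in> sector r r' N 0" "z = cis ?\<alpha> * w" by blast
    have e: "2 * pi * (real m + 1) / real N = ?\<alpha> + 2 * pi / real N"
      by (simp add: add_divide_distrib distrib_left)
    have "Arg2pi z = ?\<alpha> + Arg2pi w"
    proof (rule Arg2pi_unique)
      show "of_real (cmod w) * exp (\<i> * of_real (?\<alpha> + Arg2pi w)) = z"
        unfolding w(2) by (subst (3) polar) (simp add: cis_conv_exp exp_add[symmetric] algebra_simps)
      show "?\<alpha> + Arg2pi w < 2 * pi" using w(1) top e by (simp add: sector_def)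
    qed (use w(1) in \<open>auto simp: sector_def\<close>)
    then show "z \<in> sector r r' N m" using w e by (auto simp: sector_def norm_mult)
  qed
qed

text \<open>
  The N pieces are rotations of each other, so each has one N-th of the area of the annulus.
\<close>

lemma emeasure_sector:
  assumes N: "N > 0" and m: "m < N" and r: "0 \<le> r" "r \<le> r'"
  shows "emeasure lborel (sector r r' N m) = ennreal (pi * (r'\<^sup>2 - r\<^sup>2) / real N)"
proof -
  let ?e = "emeasure lborel (sector r r' N 0)"
  have eq: "emeasure lborel (sector r r' N k) = ?e" if "k < N" for k
    unfolding sector_rotate[OF N that, of r r']
    by (rule emeasure_rotation_image) (auto simp: sector_borel)
  have U: "(\<Union>k<N. sector r r' N k) = (ball 0 r' - ball 0 r) - {0}"
  proof (intro equalityI subsetI)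
    fix z :: complex assume "z \<in> ball 0 r' - ball 0 r - {0}"
    then show "z \<in> (\<Union>k<N. sector r r' N k)" using sector_cover[OF N, of z r r'] by auto
  qed (auto simp: sector_def)
  have "of_nat N * ?e = (\<Sum>k<N. emeasure lborel (sector r r' N k))"
  proof -
    have "(\<Sum>k<N. emeasure lborel (sector r r' N k)) = (\<Sum>k<N. ?e)"
      by (rule sum.cong[OF refl], rule eq) simp
    then show ?thesis by simp
  qed
  also have "\<dots> = emeasure lborel (\<Union>k<N. sector r r' N k)"
    by (rule sum_emeasure) (auto simp: sector_borel disjoint_family_on_def sector_disjoint[OF N])
  also have "\<dots> = emeasure lborel (ball (0::complex) r' - ball 0 r)"
    unfolding U by (rule emeasure_Diff_null_set) auto
  also have "\<dots> = ennreal (pi * r'\<^sup>2) - ennreal (pi * r\<^sup>2)"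
  proof -
    have "ball (0::complex) r \<subseteq> ball 0 r'" using r by (simp add: subset_ball)
    moreover have "emeasure lborel (ball (0::complex) r) \<noteq> \<infinity>" using r by (simp add: emeasure_ball_complex)
    ultimately show ?thesis using r by (subst emeasure_Diff) (simp_all add: emeasure_ball_complex)
  qed
  also have "\<dots> = ennreal (pi * (r'\<^sup>2 - r\<^sup>2))"
    by (subst ennreal_minus) (auto simp: right_diff_distrib)
  finally have *: "of_nat N * ?e = ennreal (pi * (r'\<^sup>2 - r\<^sup>2))" .
  have "?e \<le> emeasure lborel (ball (0::complex) r')"
    by (intro emeasure_mono) (auto simp: sector_def)
  then have "?e < \<infinity>" using r by (simp add: emeasure_ball_complex le_less_trans)
  then obtain x where x: "?e = ennreal x" "x \<ge> 0" using less_top_ennreal by auto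
  have "real N * x = pi * (r'\<^sup>2 - r\<^sup>2)"
  proof -
    have "ennreal (real N * x) = ennreal (pi * (r'\<^sup>2 - r\<^sup>2))"
      using * x by (simp add: ennreal_mult ennreal_of_nat_eq_real_of_nat)
    then show ?thesis using x r by (subst (asm) ennreal_inj) (auto intro: power_mono)
  qed
  then have "x = pi * (r'\<^sup>2 - r\<^sup>2) / real N" using N by (simp add: field_simps)
  then show ?thesis using eq[OF m] x by simp
qed

text \<open>
  The condition on the radii R says that the k-th annulus has area \<open>\<pi> N\<^sub>k\<close>, so that each of its sectors has area \<open>\<pi>\<close>.
\<close>

lemma tiled_by_sectors:
  fixes p :: "nat \<times> nat \<Rightarrow> complex" and R :: "nat \<Rightarrow> real" and N :: "nat \<Rightarrow> nat"
  defines "I \<equiv> (SIGMA k:UNIV. {..<N k})"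
  assumes N: "\<And>k. N k > 0" and R0: "R 0 = 0" and R: "mono R" and Rinf: "filterlim R at_top sequentially"
    and area: "\<And>k. (R (Suc k))\<^sup>2 - (R k)\<^sup>2 = real (N k)"
    and inj: "inj_on p I"
    and near: "\<And>k m z. m < N k \<Longrightarrow> z \<in> sector (R k) (R (Suc k)) (N k) m \<Longrightarrow> cmod (p (k, m) - z) \<le> D"
  shows "tiled_by (p ` I) (\<lambda>x. case inv_into I p x of (k, m) \<Rightarrow> sector (R k) (R (Suc k)) (N k) m) D"
    (is "tiled_by _ ?c _")
proof -
  let ?S = "\<lambda>(k, m). sector (R k) (R (Suc k)) (N k) m"
  have c: "?c (p i) = ?S i" if "i \<in> I" for i using inv_into_f_f[OF inj that] by simp
  have Rpos: "0 \<le> R k" for k using monoD[OF R, of 0 k] R0 by simp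
  have cell: "?S i \<in> sets borel \<and> ?S i \<subseteq> cball (p i) D \<and> emeasure lborel (?S i) = ennreal pi" if iI: "i \<in> I" for i
  proof -
    obtain k m where i: "i = (k, m)" "m < N k" using iI by (cases i) (auto simp: I_def)
    have "emeasure lborel (?S i) = ennreal (pi * real (N k) / real (N k))"
      unfolding i prod.case using emeasure_sector[OF N i(2) Rpos[of k] monoD[OF R, of k "Suc k"]] by (simp only: area)
    then have "emeasure lborel (?S i) = ennreal pi" using N[of k] by simp
    moreover have "?S i \<subseteq> cball (p i) D" using near[OF i(2)] by (auto simp: i dist_norm)
    ultimately show ?thesis by (simp add: i sector_borel)
  qed
  have disj: "?S i \<inter> ?S j = {}" if "i \<in> I" "j \<in> I" "i \<noteq> j" for i j
  proof -
    obtain k m k' m' where ij: "i = (k, m)" "j = (k', m')" by fastforce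
    show ?thesis
    proof (cases "k = k'")
      case True
      then show ?thesis using sector_disjoint[OF N, of m m'] that ij by simp
    next
      case False
      then consider "Suc k \<le> k'" | "Suc k' \<le> k" by linarith
      then have "R (Suc k) \<le> R k' \<or> R (Suc k') \<le> R k" by cases (auto intro: monoD[OF R])
      then show ?thesis by (auto simp: ij sector_def)
    qed
  qed
  have cover: "\<exists>i\<in>I. z \<in> ?S i" if z: "z \<noteq> 0" for z
  proof -
    obtain K where K: "R K > cmod z" using Rinf by (auto simp: filterlim_at_top_dense eventually_sequentially)
    define j where "j = (LEAST j. R j > cmod z)"
    have j: "R j > cmod z" "\<And>i. i < j \<Longrightarrow> R i \<le> cmod z"
      unfolding j_def using LeastI[of "\<lambda>j. R j > cmod z", OF K] not_less_Least not_le_imp_less by blast+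
    have "j \<noteq> 0" using j(1) R0 by (metis not_less norm_ge_zero)
    then obtain k where k: "j = Suc k" by (cases j) auto
    then obtain m where "m < N k" "z \<in> sector (R k) (R (Suc k)) (N k) m"
      using sector_cover[OF N z, of "R k" "R (Suc k)" k] j by auto
    then show ?thesis by (intro bexI[of _ "(k, m)"]) (auto simp: I_def)
  qed
  have "?c x \<inter> ?c y = {}" if xy: "x \<in> p ` I" "y \<in> p ` I" "x \<noteq> y" for x y
  proof -
    obtain i j where ij: "i \<in> I" "j \<in> I" "x = p i" "y = p j" using xy(1,2) by blast
    then have "i \<noteq> j" using xy(3) by blast
    then show ?thesis using disj[OF ij(1,2)] c[OF ij(1)] c[OF ij(2)] ij(3,4) by simp
  qed
  moreover have "- (\<Union>x\<in>p ` I. ?c x) \<subseteq> {0}"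
  proof
    fix z assume z: "z \<in> - (\<Union>x\<in>p ` I. ?c x)"
    show "z \<in> {0}"
    proof (rule ccontr)
      assume "z \<notin> {0}"
      then obtain i where i: "i \<in> I" "z \<in> ?S i" using cover by blast
      have "z \<in> ?c (p i)" unfolding c[OF i(1)] by (rule i(2))
      then show False using z i(1) by (simp only: Compl_iff) (rule notE, assumption, rule UN_I, rule imageI)
    qed
  qed
  moreover have "?c x \<in> sets borel \<and> ?c x \<subseteq> cball x D \<and> emeasure lborel (?c x) = ennreal pi"
    if xI: "x \<in> p ` I" for x
  proof -
    obtain i where i: "i \<in> I" "x = p i" using xI by blast
    show ?thesis unfolding i(2) c[OF i(1)] by (rule cell[OF i(1)])
  qed
  ultimately show ?thesis unfolding tiled_by_def disjoint_family_on_def by simp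
qed

section \<open>Radii whose counting integral is tangent to a prescribed growth\<close>

text \<open>
  The line \<open>n(n+1) t - intercept n\<close> is the tangent of slope \<open>n(n+1)\<close> to \<open>t \<mapsto> e\<^sup>2\<^sup>t/2\<close>, lowered by
  \<open>ln\<^sup>2 (n+1) / 10\<close>. The number 1/10 only has to be small: it keeps the radii \<open>\<kappa>\<close> separated.
\<close>

definition intercept :: "nat \<Rightarrow> real" where
  "intercept n = (real n * (real n + 1) * ln (real n * (real n + 1)) - real n * (real n + 1)) / 2 + (ln (real n + 1))\<^sup>2 / 10"

text \<open>
  The exponential of the abscissa where the lines number k and k + 1 cross. It is the radius of the k-th circle, up to the factor \<open>\<surd>J\<close>.
\<close>

definition \<kappa> :: "nat \<Rightarrow> real" where
  "\<kappa> k = exp ((intercept (Suc k) - intercept k) / (2 * (real k + 1)))"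

text \<open>
  The normalised radius at which the n-th line, before it is lowered, touches \<open>x\<^sup>2/2\<close>.
\<close>

definition contact :: "nat \<Rightarrow> real" where
  "contact n = sqrt (real n * (real n + 1))"

lemma \<kappa>_pos [simp]: "\<kappa> k > 0" by (simp add: \<kappa>_def)

lemma sum_ln_\<kappa>:
  "(\<Sum>k<n. 2 * (real k + 1) * (ln x - ln (\<kappa> k))) = real n * (real n + 1) * ln x - intercept n"
proof (induction n)
  case 0 show ?case by (simp add: intercept_def)
next
  case (Suc n)
  have "2 * (real n + 1) * ln (\<kappa> n) = intercept (Suc n) - intercept n" by (simp add: \<kappa>_def)
  then show ?case using Suc by (simp add: algebra_simps)
qed

text \<open>
  A tangent lies below the convex function; in multiplicative form this is \<open>ln y \<le> y - 1\<close> with \<open>y = x\<^sup>2/(n(n+1))\<close>.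
\<close>

lemma tangent_line_le:
  assumes x: "x > 0"
  shows "real n * (real n + 1) * ln x - intercept n \<le> x\<^sup>2 / 2 - (ln (real n + 1))\<^sup>2 / 10"
proof (cases "n = 0")
  case False
  define m where "m = real n * (real n + 1)"
  have m: "m > 0" using False by (simp add: m_def)
  have "ln (x\<^sup>2 / m) \<le> x\<^sup>2 / m - 1" using x m by (intro ln_le_minus_one) simp
  moreover have "ln (x\<^sup>2 / m) = 2 * ln x - ln m"
    using x m by (simp add: ln_div ln_realpow)
  ultimately have "m * (2 * ln x - ln m) \<le> m * (x\<^sup>2 / m - 1)" using m by (intro mult_left_mono) auto
  also have "\<dots> = x\<^sup>2 - m" using m by (simp add: right_diff_distrib)
  finally have "m * (2 * ln x) - m * ln m \<le> x\<^sup>2 - m" by (simp add: right_diff_distrib)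
  then show ?thesis unfolding intercept_def m_def[symmetric] by (simp add: field_simps)
qed (simp add: intercept_def)

lemma tangent_line_at_contact:
  "real n * (real n + 1) * ln (contact n) - intercept n = (contact n)\<^sup>2 / 2 - (ln (real n + 1))\<^sup>2 / 10"
proof (cases "n = 0")
  case False
  define m where "m = real n * (real n + 1)"
  have m: "m > 0" using False by (simp add: m_def)
  have "ln (contact n) = ln m / 2" "(contact n)\<^sup>2 = m"
    using m by (simp_all add: contact_def m_def[symmetric] ln_sqrt)
  then show ?thesis unfolding intercept_def m_def[symmetric] by (simp add: field_simps)
qed (simp add: intercept_def contact_def)

text \<open>
  With u = 1/K, this expression measures how far \<open>\<kappa>\<close> is from K = k + 1 when the logarithmic correction is left out;
  the mean value theorem gives a two-sided bound at once, because the derivative of the expression in u is \<open>ln (1 - u\<^sup>2)\<close>.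
\<close>

lemma symmetric_entropy_mvt:
  fixes u :: real
  assumes u: "0 < u" "u < 1"
  shows "\<exists>v. 0 < v \<and> v < u \<and> (1 + u) * ln (1 + u) - (1 - u) * ln (1 - u) - 2 * u = u * ln (1 - v\<^sup>2)"
proof -
  define h :: "real \<Rightarrow> real" where "h t = (1 + t) * ln (1 + t) - (1 - t) * ln (1 - t) - 2 * t" for t
  have d: "(h has_real_derivative ln (1 - t\<^sup>2)) (at t)" if "0 \<le> t" "t \<le> u" for t
  proof -
    have t: "1 + t > 0" "1 - t > 0" using that u by auto
    have "(h has_real_derivative ln (1 + t) + 1 + (ln (1 - t) + 1) - 2) (at t)"
      unfolding h_def using t by (auto intro!: derivative_eq_intros)
    moreover have "ln (1 + t) + ln (1 - t) = ln (1 - t\<^sup>2)"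
      using t by (subst ln_mult_pos[symmetric]) (auto simp: power2_eq_square algebra_simps)
    ultimately show ?thesis by simp
  qed
  obtain v where "0 < v" "v < u" "h u - h 0 = (u - 0) * ln (1 - v\<^sup>2)"
    using MVT2[of 0 u h "\<lambda>t. ln (1 - t\<^sup>2)"] u d by auto
  then show ?thesis by (auto simp: h_def)
qed

text \<open>
  Here \<open>\<theta>\<close> is the deviation caused by the convexity of \<open>m ln m\<close>, and g the one caused by the correction
  \<open>ln\<^sup>2 (n+1) / 10\<close>. The bound \<open>-1/2 \<le> \<theta>\<close> serves the innermost circle, K = 1, for which
  \<open>1 - 1/K\<^sup>2\<close> says nothing.
\<close>

lemma ln_\<kappa>:
  fixes k defines "K \<equiv> real k + 1"
  shows "\<exists>\<theta> g. ln (\<kappa> k) = ln K + \<theta> + g \<and> \<theta> \<le> 0 \<and> -1/2 \<le> \<theta> \<and> (K \<ge> 2 \<longrightarrow> 1 - 1 / K\<^sup>2 \<le> exp (2 * \<theta>)) \<and>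
     0 \<le> g \<and> g \<le> 1 / (10 * K)"
proof -
  have K: "K \<ge> 1" by (simp add: K_def)
  define \<phi> :: "real \<Rightarrow> real" where "\<phi> m = m * ln m - m" for m
  define g where "g = ((ln (K + 1))\<^sup>2 - (ln K)\<^sup>2) / 10 / (2 * K)"
  define \<theta> where "\<theta> = (\<phi> (K * (K + 1)) - \<phi> ((K - 1) * K)) / (4 * K) - ln K"
  have "intercept (Suc k) = \<phi> (K * (K + 1)) / 2 + (ln (K + 1))\<^sup>2 / 10"
    by (simp add: intercept_def \<phi>_def K_def add.commute)
  moreover have "intercept k = \<phi> ((K - 1) * K) / 2 + (ln K)\<^sup>2 / 10"
    by (simp add: intercept_def \<phi>_def K_def add.commute)
  ultimately have calculation_E: "intercept (Suc k) = \<phi> (K * (K + 1)) / 2 + (ln (K + 1))\<^sup>2 / 10"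
    "intercept k = \<phi> ((K - 1) * K) / 2 + (ln K)\<^sup>2 / 10" by blast+
  have eq: "ln (\<kappa> k) = ln K + \<theta> + g"
  proof -
    have "ln (\<kappa> k) = (intercept (Suc k) - intercept k) / (2 * K)" by (simp add: \<kappa>_def K_def)
    also have "intercept (Suc k) - intercept k = (\<phi> (K * (K + 1)) - \<phi> ((K - 1) * K)) / 2 + ((ln (K + 1))\<^sup>2 - (ln K)\<^sup>2) / 10"
      using calculation_E by argo
    finally show ?thesis by (simp add: \<theta>_def g_def add_divide_distrib)
  qed
  have g0: "0 \<le> g"
  proof -
    have "(ln K)\<^sup>2 \<le> (ln (K + 1))\<^sup>2" using K by (intro power_mono) auto
    then show ?thesis unfolding g_def using K by simp
  qed
  have g1: "g \<le> 1 / (10 * K)"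
  proof -
    have "1 + 1 / K = (K + 1) / K" using K by (simp add: field_simps)
    then have "ln (K + 1) - ln K = ln (1 + 1 / K)" using K by (simp add: ln_div)
    also have "\<dots> \<le> 1 / K" using K ln_add_one_self_le_self[of "1 / K"] by simp
    finally have a: "ln (K + 1) - ln K \<le> 1 / K" .
    have "ln (K + 1) \<le> K" using K ln_add_one_self_le_self[of K] by (simp add: add.commute)
    moreover have "ln K \<le> K" using K ln_le_minus_one[of K] by simp
    ultimately have b: "ln (K + 1) + ln K \<le> 2 * K" by simp
    have "(ln (K + 1))\<^sup>2 - (ln K)\<^sup>2 = (ln (K + 1) - ln K) * (ln (K + 1) + ln K)"
      by (simp add: power2_eq_square algebra_simps)
    also have "\<dots> \<le> 1 / K * (2 * K)" using a b K by (intro mult_mono) auto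
    finally have "(ln (K + 1))\<^sup>2 - (ln K)\<^sup>2 \<le> 2" using K by simp
    then have "g \<le> 2 / 10 / (2 * K)" unfolding g_def using K by (intro divide_right_mono) auto
    then show ?thesis by simp
  qed
  show ?thesis
  proof (cases "K \<ge> 2")
    case True
    define u where "u = 1 / K"
    have u: "0 < u" "u < 1" "K * u = 1" "u \<le> 1 / 2" using True by (auto simp: u_def field_simps)
    obtain v where v: "0 < v" "v < u"
      "(1 + u) * ln (1 + u) - (1 - u) * ln (1 - u) - 2 * u = u * ln (1 - v\<^sup>2)"
      using symmetric_entropy_mvt[OF u(1,2)] by blast
    have l1: "ln (K * (K + 1)) = 2 * ln K + ln (1 + u)"
    proof -
      have "K * (K + 1) = K * K * (1 + u)" using u(3) by (simp add: algebra_simps)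
      then show ?thesis using K u by (simp add: ln_mult_pos)
    qed
    have l2: "ln ((K - 1) * K) = 2 * ln K + ln (1 - u)"
    proof -
      have "(K - 1) * K = K * K * (1 - u)" using u(3) by (simp add: algebra_simps)
      then show ?thesis using K u by (simp add: ln_mult_pos)
    qed
    have "\<phi> (K * (K + 1)) - \<phi> ((K - 1) * K)
      = 4 * K * ln K + K * K * ((1 + u) * ln (1 + u) - (1 - u) * ln (1 - u)) - 2 * K"
    proof -
      have split: "M * (a + b) - M = M * a + c - M" if "M * b = c" for M a b c :: real
        using that by (simp add: distrib_left)
      have e: "K * (K + 1) = K * K * (1 + u)" "(K - 1) * K = K * K * (1 - u)"
        using u(3) by (simp_all add: algebra_simps)
      have "\<phi> (K * (K + 1)) = K * (K + 1) * (2 * ln K) + K * K * ((1 + u) * ln (1 + u)) - K * (K + 1)"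
        unfolding \<phi>_def l1 by (rule split) (simp only: e mult.assoc)
      moreover have "\<phi> ((K - 1) * K) = (K - 1) * K * (2 * ln K) + K * K * ((1 - u) * ln (1 - u)) - (K - 1) * K"
        unfolding \<phi>_def l2 by (rule split) (simp only: e mult.assoc)
      ultimately show ?thesis by (simp add: algebra_simps)
    qed
    also have "\<dots> = 4 * K * ln K + K * K * (u * ln (1 - v\<^sup>2) + 2 * u) - 2 * K"
      using v(3) by (simp add: algebra_simps)
    also have "\<dots> = 4 * K * ln K + K * ln (1 - v\<^sup>2)"
      using u(3) by (simp add: distrib_left mult.assoc[symmetric]) (simp add: mult.assoc)
    finally have \<theta>: "\<theta> = ln (1 - v\<^sup>2) / 4"
      using K unfolding \<theta>_def by (simp add: field_simps)
    have v2: "v\<^sup>2 \<le> u\<^sup>2" "v\<^sup>2 > 0" "u\<^sup>2 \<le> (1/2)\<^sup>2" using u v by (auto intro!: power_mono)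
    have v3: "3/4 \<le> 1 - v\<^sup>2" using v2 by (simp add: power2_eq_square)
    have "exp (2 * \<theta>) = sqrt (1 - v\<^sup>2)"
    proof -
      have "2 * \<theta> = ln (sqrt (1 - v\<^sup>2))" using v3 by (simp add: \<theta> ln_sqrt)
      then show ?thesis using v3 by simp
    qed
    moreover have "1 - v\<^sup>2 \<le> sqrt (1 - v\<^sup>2)"
      using v2 v3 by (intro real_le_rsqrt) (simp add: power2_eq_square mult_left_le)
    moreover have "1 - 1 / K\<^sup>2 \<le> 1 - v\<^sup>2" using v2 by (simp add: u_def power_divide)
    ultimately have 1: "1 - 1 / K\<^sup>2 \<le> exp (2 * \<theta>)" by linarith
    have 2: "\<theta> \<le> 0" using v2 v3 by (simp add: \<theta>)
    have 3: "-1/2 \<le> \<theta>"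
    proof -
      have "1 + -1 \<le> exp (-1::real)" by (rule exp_ge_add_one_self)
      have "exp (-2 :: real) \<le> 1 / 2"
        using exp_ge_add_one_self[of "2::real"] by (simp add: exp_minus field_simps)
      then have "exp (-2) \<le> 1 - v\<^sup>2" using v3 by linarith
      then have "-2 \<le> ln (1 - v\<^sup>2)" using v3 by (subst ln_ge_iff) auto
      then show ?thesis by (simp add: \<theta>)
    qed
    show ?thesis using eq g0 g1 1 2 3 by (intro exI[of _ \<theta>] exI[of _ g] conjI impI)
  next
    case False
    then have K1: "K = 1" by (auto simp: K_def)
    have "ln (2::real) \<le> 1" using ln_le_minus_one[of "2::real"] by simp
    moreover have "\<theta> = (ln 2 - 1) / 2" by (simp add: \<theta>_def \<phi>_def K1)
    moreover have "0 \<le> ln (2::real)" by simp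
    ultimately have "\<theta> \<le> 0" "-1/2 \<le> \<theta>" by argo+
    then show ?thesis using eq g0 g1 False by (intro exI[of _ \<theta>] exI[of _ g] conjI impI) auto
  qed
qed

lemma \<kappa>_upper: "\<kappa> k \<le> real k + 1 + 1/8"
proof -
  define K where "K = real k + 1"
  have K: "K \<ge> 1" by (simp add: K_def)
  obtain \<theta> g where h: "ln (\<kappa> k) = ln K + \<theta> + g" "\<theta> \<le> 0" "0 \<le> g" "g \<le> 1 / (10 * K)"
    using ln_\<kappa>[of k] K_def by auto
  have "\<kappa> k = exp (ln (\<kappa> k))" by simp
  also have "\<dots> \<le> exp (ln K + 1 / (10 * K))" using h by simp
  also have "\<dots> = K * exp (1 / (10 * K))" using K by (simp add: exp_add)
  also have "\<dots> \<le> K * (1 + 1 / (10 * K) + (1 / (10 * K))\<^sup>2)"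
    using K by (intro mult_left_mono exp_bound) (auto simp: field_simps)
  also have "\<dots> = K + 1/10 + 1 / (100 * K)" using K by (simp add: field_simps power2_eq_square)
  also have "\<dots> \<le> K + 1/10 + 1/100" using K by (simp add: field_simps)
  finally show ?thesis by (simp add: K_def)
qed

lemma \<kappa>_lower: "(real k + 1)\<^sup>2 - 1 \<le> (\<kappa> k)\<^sup>2"
proof (cases "k = 0")
  case False
  define K where "K = real k + 1"
  have K: "K \<ge> 2" using False by (simp add: K_def)
  obtain \<theta> g where h: "ln (\<kappa> k) = ln K + \<theta> + g" "1 - 1 / K\<^sup>2 \<le> exp (2 * \<theta>)" "0 \<le> g"
    using ln_\<kappa>[of k] K K_def by auto
  have "K\<^sup>2 - 1 = K\<^sup>2 * (1 - 1 / K\<^sup>2)" using K by (simp add: field_simps)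
  also have "\<dots> \<le> K\<^sup>2 * exp (2 * \<theta>)" using h by (intro mult_left_mono) auto
  also have "\<dots> = exp (ln K + \<theta>) ^ 2"
    using K by (simp add: exp_add power_mult_distrib exp_of_nat_mult[symmetric])
  also have "\<dots> \<le> exp (ln (\<kappa> k)) ^ 2" using h by (intro power_mono) auto
  finally show ?thesis by (simp add: K_def)
qed simp

lemma \<kappa>_0: "\<kappa> 0 \<ge> 1/2"
proof -
  obtain \<theta> g where h: "ln (\<kappa> 0) = ln 1 + \<theta> + g" "-1/2 \<le> \<theta>" "0 \<le> g"
    using ln_\<kappa>[of 0] by auto
  have "1 + (-1/2) \<le> exp (-1/2::real)" by (rule exp_ge_add_one_self)
  also have "\<dots> \<le> exp (ln (\<kappa> 0))" using h by simp
  finally show ?thesis by simp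
qed

lemma \<kappa>_lower': "real k + 1 - 1 / (real k + 1) \<le> \<kappa> k"
proof -
  define K where "K = real k + 1"
  have K: "K \<ge> 1" by (simp add: K_def)
  have "(K - 1 / K)\<^sup>2 = K\<^sup>2 - 2 + (1 / K)\<^sup>2" using K by (simp add: power2_diff)
  also have "(1 / K)\<^sup>2 \<le> 1" using K by (intro power_le_one) auto
  finally have "(K - 1 / K)\<^sup>2 \<le> (\<kappa> k)\<^sup>2" using \<kappa>_lower[of k] by (simp add: K_def)
  then show ?thesis unfolding K_def by (rule power2_le_imp_le) (simp add: less_imp_le)
qed

lemma \<kappa>_half: "(real k + 1) / 2 \<le> \<kappa> k"
proof (cases "k = 0")
  case False
  then have "real k \<ge> 1" by simp
  moreover from this have "1 / (real k + 1) \<le> 1 / 2" by (simp add: field_simps)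
  ultimately show ?thesis using \<kappa>_lower'[of k] by argo
qed (use \<kappa>_0 in simp)

lemma \<kappa>_le: "\<kappa> k \<le> 9/8 * (real k + 1)"
  using \<kappa>_upper[of k] by simp

lemma \<kappa>_gap: "\<kappa> k + 3/8 \<le> \<kappa> (Suc k)"
proof -
  have "1 / (real (Suc k) + 1) \<le> 1/2" by (simp add: field_simps)
  then show ?thesis using \<kappa>_lower'[of "Suc k"] \<kappa>_upper[of k] unfolding of_nat_Suc by argo
qed

lemma \<kappa>_gaps: "k \<le> l \<Longrightarrow> \<kappa> k + 3/8 * (real l - real k) \<le> \<kappa> l"
proof (induction l)
  case (Suc l)
  show ?case
  proof (cases "k = Suc l")
    case False
    then have "\<kappa> k + 3/8 * (real l - real k) \<le> \<kappa> l" using Suc by simp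
    then show ?thesis using \<kappa>_gap[of l] unfolding of_nat_Suc by argo
  qed simp
qed simp

lemma \<kappa>_mono: "k \<le> l \<Longrightarrow> \<kappa> k \<le> \<kappa> l"
  using \<kappa>_gaps[of k l] by (simp add: order_trans[rotated])

lemma contact_bounds: "real n \<le> contact n" "contact n \<le> real n + 1/2"
  unfolding contact_def by (auto intro!: real_le_rsqrt real_le_lsqrt simp: power2_eq_square algebra_simps)

lemma \<kappa>_above_contact: "contact k + 1/4 \<le> \<kappa> k"
proof (cases "k = 0")
  case False
  then have k: "real k \<ge> 1" by simp
  have "(contact k + 1/4)\<^sup>2 = (contact k)\<^sup>2 + contact k / 2 + 1/16" by (simp add: power2_sum power_divide)
  also have "(contact k)\<^sup>2 = real k * (real k + 1)" by (simp add: contact_def)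
  also have "real k * (real k + 1) + contact k / 2 + 1/16 \<le> (real k + 1)\<^sup>2 - 1"
    using contact_bounds(2)[of k] k by (simp add: power2_eq_square algebra_simps)
  also have "\<dots> \<le> (\<kappa> k)\<^sup>2" by (rule \<kappa>_lower)
  finally show ?thesis by (rule power2_le_imp_le) (simp add: less_imp_le)
qed (use \<kappa>_0 in \<open>simp add: contact_def\<close>)

lemma \<kappa>_below_contact: "\<kappa> k + 1/4 \<le> contact (Suc k)"
proof -
  have "real k + 1 + 3/8 \<le> contact (Suc k)"
    unfolding contact_def by (rule real_le_rsqrt) (simp add: power2_eq_square algebra_simps)
  then show ?thesis using \<kappa>_upper[of k] by linarith
qed

lemma \<kappa>_contact_dist: "1/4 \<le> \<bar>contact n - \<kappa> k\<bar>"
proof (cases "n \<le> k")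
  case True
  then show ?thesis using \<kappa>_above_contact[of n] \<kappa>_mono[of n k] by linarith
next
  case False
  then obtain j where j: "n = Suc j" "k \<le> j" by (cases n) auto
  then show ?thesis unfolding j(1) using \<kappa>_below_contact[of j] \<kappa>_mono[of k j] by linarith
qed

text \<open>
  The modulus of the point \<open>\<xi>\<close> inside the unit disc at which the k-th factor is evaluated below.
\<close>

definition prox :: "real \<Rightarrow> nat \<Rightarrow> real" where
  "prox x k = min (\<kappa> k / x) (x / \<kappa> k)"

lemma prox_bounds: assumes "x > 0" shows "0 < prox x k" "prox x k \<le> 1"
proof -
  show "0 < prox x k" using assms by (simp add: prox_def)
  show "prox x k \<le> 1" using assms by (cases "\<kappa> k \<le> x") (auto simp: prox_def min_le_iff_disj)
qed

text \<open>
  As \<open>\<kappa> k\<close> is about k + 1, the power with exponent k + 1 decays exponentially in the distance of \<open>\<kappa> k\<close> from x,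
  except for \<open>\<kappa> k \<le> x/2\<close>, where the exponent may be too small for that; there the decay is in \<open>\<kappa> k\<close> itself.
\<close>

lemma prox_power_le:
  assumes x: "x > 0"
  shows "prox x k ^ Suc k \<le> exp (- \<kappa> k / 4) \<or> prox x k ^ Suc k \<le> exp (- \<bar>x - \<kappa> k\<bar> / 4)"
proof -
  define K where "K = real k + 1"
  have K: "K \<ge> \<kappa> k / 2" "K > 0" using \<kappa>_le[of k] by (auto simp: K_def)
  have pw: "prox x k ^ Suc k \<le> exp (K * (y - 1))" if "prox x k \<le> y" "y > 0" for y
  proof -
    have "prox x k ^ Suc k \<le> exp (y - 1) ^ Suc k"
      using that exp_ge_add_one_self[of "y - 1"] prox_bounds(1)[OF x, of k] by (intro power_mono) auto
    also have "\<dots> = exp (K * (y - 1))" by (simp add: K_def exp_of_nat_mult[symmetric] add.commute del: power_Suc)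
    finally show ?thesis .
  qed
  show ?thesis
  proof (cases "\<kappa> k \<le> x")
    case True
    have "prox x k ^ Suc k \<le> exp (K * (\<kappa> k / x - 1))"
      by (rule pw) (use x in \<open>auto simp: prox_def\<close>)
    also have "K * (\<kappa> k / x - 1) \<le> \<kappa> k / 2 * (\<kappa> k / x - 1)"
      using K True x by (intro mult_right_mono_neg) auto
    finally have *: "prox x k ^ Suc k \<le> exp (\<kappa> k / 2 * (\<kappa> k / x - 1))" by simp
    show ?thesis
    proof (cases "\<kappa> k \<le> x / 2")
      case True
      then have "\<kappa> k / x - 1 \<le> - 1/2" using x by (simp add: field_simps)
      then have "\<kappa> k / 2 * (\<kappa> k / x - 1) \<le> \<kappa> k / 2 * (- 1/2)" by (intro mult_left_mono) (auto simp: less_imp_le)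
      then have "\<kappa> k / 2 * (\<kappa> k / x - 1) \<le> - \<kappa> k / 4" by simp
      then show ?thesis using * by (meson exp_le_cancel_iff order_trans)
    next
      case False
      have "\<kappa> k / 2 * (\<kappa> k / x - 1) \<le> x / 4 * (\<kappa> k / x - 1)"
        using False \<open>\<kappa> k \<le> x\<close> x by (intro mult_right_mono_neg) auto
      also have "\<dots> = - \<bar>x - \<kappa> k\<bar> / 4" using x \<open>\<kappa> k \<le> x\<close> by (simp add: field_simps)
      finally show ?thesis using * by (meson exp_le_cancel_iff order_trans)
    qed
  next
    case False
    have "prox x k ^ Suc k \<le> exp (K * (x / \<kappa> k - 1))"
      by (rule pw) (use x in \<open>auto simp: prox_def\<close>)
    also have "K * (x / \<kappa> k - 1) \<le> \<kappa> k / 2 * (x / \<kappa> k - 1)"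
      using K False x by (intro mult_right_mono_neg) (auto simp: field_simps)
    also have "\<dots> = (x - \<kappa> k) / 2" by (simp add: field_simps) (metis \<kappa>_pos less_irrefl)
    also have "\<dots> \<le> - \<bar>x - \<kappa> k\<bar> / 4" using False by simp
    finally show ?thesis by simp
  qed
qed

lemma prox_power_contact:
  assumes "n \<ge> 1"
  shows "prox (contact n) k ^ Suc k \<le> exp (-1/16)"
proof -
  have x: "contact n > 0" using contact_bounds(1)[of n] assms by linarith
  have "1/2 \<le> \<kappa> k" using \<kappa>_0 \<kappa>_mono[of 0 k] by simp
  then have "exp (- \<kappa> k / 4) \<le> exp (-1/16)" by simp
  moreover have "exp (- \<bar>contact n - \<kappa> k\<bar> / 4) \<le> exp (-1/16)" using \<kappa>_contact_dist[of n k] by simp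
  ultimately show ?thesis using prox_power_le[OF x, of k] by linarith
qed

lemma sum_geometric_le:
  fixes r :: real assumes "0 \<le> r" "r < 1" shows "(\<Sum>i<n. r ^ i) \<le> 1 / (1 - r)"
  using assms sum_le_suminf[OF summable_geometric[of r], of "{..<n}"] suminf_geometric[of r] by simp

lemma sum_prox_power_bounded: "\<exists>C>0. \<forall>x>0. \<forall>n. (\<Sum>k<n. prox x k ^ Suc k) \<le> C"
proof -
  define r :: real where "r = exp (-3/32)"
  have r: "0 \<le> r" "r < 1" by (auto simp: r_def)
  have rp: "exp (- t / 4) \<le> r ^ j" if "t \<ge> 3/8 * real j" for t j
  proof -
    have "exp (- t / 4) \<le> exp (real j * (-3/32))" using that by simp
    then show ?thesis by (simp only: r_def exp_of_nat_mult)
  qed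
  have "(\<Sum>k<n. prox x k ^ Suc k) \<le> 3 / (1 - r)" if x: "x > 0" for x n
  proof -
    obtain m where m: "\<And>k. k < m \<Longrightarrow> \<kappa> k \<le> x" "\<And>k. k \<ge> m \<Longrightarrow> x < \<kappa> k"
    proof -
      define m where "m = (LEAST k. x < \<kappa> k)"
      obtain k0 :: nat where k0: "2 * x < real k0" using reals_Archimedean2 by blast
      have "x < \<kappa> k0" using \<kappa>_half[of k0] k0 by argo
      then have "x < \<kappa> m" unfolding m_def by (rule LeastI)
      then have "\<And>k. k \<ge> m \<Longrightarrow> x < \<kappa> k" using \<kappa>_mono by (meson less_le_trans)
      moreover have "\<kappa> k \<le> x" if "k < m" for k using not_less_Least[of k "\<lambda>k. x < \<kappa> k"] that by (simp add: m_def)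
      ultimately show thesis using that by blast
    qed
    have A: "(\<Sum>k<n. exp (- \<kappa> k / 4)) \<le> 1 / (1 - r)"
    proof -
      have "3/8 * real k \<le> \<kappa> k" for k using \<kappa>_gaps[of 0 k] \<kappa>_0 by simp
      then have "(\<Sum>k<n. exp (- \<kappa> k / 4)) \<le> (\<Sum>k<n. r ^ k)" by (intro sum_mono rp)
      then show ?thesis using sum_geometric_le[OF r, of n] by linarith
    qed
    have B: "(\<Sum>k<m. exp (- \<bar>x - \<kappa> k\<bar> / 4)) \<le> 1 / (1 - r)"
    proof -
      have "(\<Sum>k<m. exp (- \<bar>x - \<kappa> k\<bar> / 4)) \<le> (\<Sum>k<m. r ^ (m - Suc k))"
      proof (intro sum_mono rp)
        fix k assume k: "k \<in> {..<m}"
        then have e: "real (m - 1) - real k = real (m - Suc k)" by (simp add: of_nat_diff)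
        have "\<kappa> k + 3/8 * real (m - Suc k) \<le> \<kappa> (m - 1)"
          using \<kappa>_gaps[of k "m - 1"] k unfolding e by auto
        moreover have "\<kappa> (m - 1) \<le> x" by (rule m(1)) (use k in auto)
        ultimately show "3/8 * real (m - Suc k) \<le> \<bar>x - \<kappa> k\<bar>" by linarith
      qed
      also have "\<dots> = (\<Sum>k<m. r ^ k)" by (rule sum.nat_diff_reindex)
      finally show ?thesis using sum_geometric_le[OF r, of m] by linarith
    qed
    have C: "(\<Sum>k\<in>{m..<n}. exp (- \<bar>x - \<kappa> k\<bar> / 4)) \<le> 1 / (1 - r)"
    proof -
      have "(\<Sum>k\<in>{m..<n}. exp (- \<bar>x - \<kappa> k\<bar> / 4)) \<le> (\<Sum>k\<in>{m..<n}. r ^ (k - m))"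
      proof (intro sum_mono rp)
        fix k assume k: "k \<in> {m..<n}"
        then have e: "real k - real m = real (k - m)" by (simp add: of_nat_diff)
        have "\<kappa> m + 3/8 * real (k - m) \<le> \<kappa> k"
          using \<kappa>_gaps[of m k] k unfolding e by auto
        moreover have "x < \<kappa> m" by (rule m(2)) simp
        ultimately show "3/8 * real (k - m) \<le> \<bar>x - \<kappa> k\<bar>" by linarith
      qed
      also have "\<dots> = (\<Sum>k<n - m. r ^ k)"
        by (rule sum.reindex_bij_witness[of _ "\<lambda>k. k + m" "\<lambda>k. k - m"]) auto
      finally show ?thesis using sum_geometric_le[OF r, of "n - m"] by linarith
    qed
    have "(\<Sum>k<n. prox x k ^ Suc k) \<le> (\<Sum>k<n. exp (- \<kappa> k / 4) + exp (- \<bar>x - \<kappa> k\<bar> / 4))"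
      using prox_power_le[OF x] by (intro sum_mono) (smt (verit) exp_ge_zero)
    also have "\<dots> = (\<Sum>k<n. exp (- \<kappa> k / 4)) + (\<Sum>k<n. exp (- \<bar>x - \<kappa> k\<bar> / 4))" by (rule sum.distrib)
    also have "(\<Sum>k<n. exp (- \<bar>x - \<kappa> k\<bar> / 4)) \<le> (\<Sum>k\<in>{..<m} \<union> {m..<n}. exp (- \<bar>x - \<kappa> k\<bar> / 4))"
      by (intro sum_mono2) auto
    also have "\<dots> = (\<Sum>k<m. exp (- \<bar>x - \<kappa> k\<bar> / 4)) + (\<Sum>k\<in>{m..<n}. exp (- \<bar>x - \<kappa> k\<bar> / 4))"
      by (intro sum.union_disjoint) auto
    finally show ?thesis using A B C by simp
  qed
  then show ?thesis using r by (intro exI[of _ "3 / (1 - r)"]) auto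
qed

section \<open>Self-inversive perturbations of regular polygons\<close>

text \<open>
  With \<open>w = z\<^sup>J\<close> and \<open>N = nJ\<close> this is \<open>(1 - a w)(1 - w\<^sup>n\<^sup>-\<^sup>1 (w - a)/(1 - a w))\<close>. The second factor vanishes where
  \<open>w\<^sup>n\<^sup>-\<^sup>1\<close> times a Blaschke factor equals 1, so all roots have modulus 1.
\<close>

definition perturbed :: "nat \<Rightarrow> nat \<Rightarrow> real \<Rightarrow> complex \<Rightarrow> complex" where
  "perturbed J N a z = 1 - of_real a * z ^ J + of_real a * z ^ (N - J) - z ^ N"

text \<open>
  The polynomial is self-inversive, so its size outside the unit disc is known from its size inside.
\<close>

lemma perturbed_inverse:
  assumes "z \<noteq> 0" "J \<le> N"
  shows "perturbed J N a z = - (z ^ N) * perturbed J N a (inverse z)"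
proof -
  have pw: "z ^ N * inverse z ^ j = z ^ (N - j)" if "j \<le> N" for j
    using assms(1) that by (simp add: power_diff power_inverse divide_inverse)
  have gen: "W * (1 - c * A + c * B - C) = W - c * (W * A) + c * (W * B) - W * C" for W c A B C :: complex
    by (simp add: algebra_simps)
  have "z ^ N * perturbed J N a (inverse z) = z ^ N - of_real a * z ^ (N - J) + of_real a * z ^ J - 1"
    unfolding perturbed_def gen pw[OF assms(2)] pw[OF diff_le_self] pw[OF order_refl]
    using assms(2) by simp
  then have "- (z ^ N) * perturbed J N a (inverse z) = 1 - of_real a * z ^ J + of_real a * z ^ (N - J) - z ^ N"
    by (simp only: mult_minus_left) simp
  then show ?thesis unfolding perturbed_def[of J N a z] by (rule sym)
qed

lemma moebius_bound:
  fixes w :: complex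
  assumes "cmod w \<le> 1" "0 \<le> a" "a \<le> 1"
  shows "cmod (of_real a - w) \<le> cmod (1 - of_real a * w)"
proof -
  have "(cmod (1 - of_real a * w))\<^sup>2 - (cmod (of_real a - w))\<^sup>2 = (1 - a\<^sup>2) * (1 - (cmod w)\<^sup>2)"
    unfolding cmod_power2 by (simp add: power2_eq_square algebra_simps)
  moreover have "a\<^sup>2 \<le> 1" "(cmod w)\<^sup>2 \<le> 1" using assms by (simp_all add: power_le_one)
  then have "(1 - a\<^sup>2) * (1 - (cmod w)\<^sup>2) \<ge> 0" by simp
  ultimately have "(cmod (of_real a - w))\<^sup>2 \<le> (cmod (1 - of_real a * w))\<^sup>2" by linarith
  then show ?thesis by (rule power2_le_imp_le) simp
qed

text \<open>
  Apart from the factor \<open>1 - a z\<^sup>J\<close>, which causes the angular oscillation, the polynomial is at least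
  \<open>1 - |z|\<^sup>N\<^sup>-\<^sup>J\<close> in modulus, because the Moebius quotient \<open>(a - w)/(1 - a w)\<close> has modulus at most 1.
\<close>

lemma perturbed_lower:
  assumes z: "cmod z \<le> 1" and a: "0 \<le> a" "a \<le> 1" and JN: "J \<le> N"
  shows "cmod (1 - of_real a * z ^ J) * (1 - cmod z ^ (N - J)) \<le> cmod (perturbed J N a z)"
proof -
  have zJ: "cmod (z ^ J) \<le> 1" using z by (simp add: norm_power power_le_one)
  have "z ^ N = z ^ (N - J) * z ^ J" using JN by (simp add: power_add[symmetric])
  then have eq: "perturbed J N a z = (1 - of_real a * z ^ J) + z ^ (N - J) * (of_real a - z ^ J)"
    by (simp add: perturbed_def algebra_simps)
  have "cmod (z ^ (N - J) * (of_real a - z ^ J)) \<le> cmod z ^ (N - J) * cmod (1 - of_real a * z ^ J)"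
    using moebius_bound[OF zJ a] by (simp add: norm_mult norm_power mult_left_mono)
  moreover have "cmod (1 - of_real a * z ^ J) - cmod (z ^ (N - J) * (of_real a - z ^ J)) \<le> cmod (perturbed J N a z)"
    unfolding eq by (rule norm_diff_ineq)
  moreover have "cmod (1 - of_real a * z ^ J) * (1 - cmod z ^ (N - J))
    = cmod (1 - of_real a * z ^ J) - cmod z ^ (N - J) * cmod (1 - of_real a * z ^ J)"
    by (simp only: right_diff_distrib mult_1_right) (simp only: mult.commute)
  ultimately show ?thesis by linarith
qed

lemma perturbed_minus_1:
  assumes z: "cmod z \<le> 1" and a: "0 \<le> a" "a \<le> 1" and JN: "2 * J \<le> N"
  shows "cmod (perturbed J N a z - 1) \<le> 3 * cmod z ^ J"
proof -
  have "perturbed J N a z - 1 = of_real a * z ^ (N - J) - of_real a * z ^ J - z ^ N"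
    by (simp add: perturbed_def)
  also have "cmod \<dots> \<le> cmod (of_real a * z ^ (N - J)) + cmod (of_real a * z ^ J) + cmod (z ^ N)"
  proof -
    have "cmod (A - B - C) \<le> cmod A + cmod B + cmod C" for A B C
      using norm_triangle_ineq4[of "A - B" C] norm_triangle_ineq4[of A B] by linarith
    then show ?thesis .
  qed
  also have "\<dots> = a * cmod z ^ (N - J) + a * cmod z ^ J + cmod z ^ N"
    using a by (simp add: norm_mult norm_power)
  also have "\<dots> \<le> 1 * cmod z ^ J + 1 * cmod z ^ J + cmod z ^ J"
    using z a JN by (intro add_mono mult_mono power_decreasing) auto
  finally show ?thesis by simp
qed

lemma norm_1_minus_ge_exp:
  fixes w :: complex
  assumes w: "cmod w \<le> 1" and a: "0 \<le> a" "a \<le> 1/2"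
  shows "exp (- a * Re w - 2 * a\<^sup>2) \<le> cmod (1 - of_real a * w)"
proof -
  let ?z = "- of_real a * w"
  have nz: "cmod ?z \<le> a" using w a by (simp add: norm_mult mult_left_le)
  then have nz2: "cmod ?z < 1" "cmod ?z \<le> 1/2" using a by linarith+
  have ne: "1 + ?z \<noteq> 0"
  proof
    assume "1 + ?z = 0"
    then have "?z = -1" by (simp add: add_eq_0_iff)
    then have "cmod ?z = 1" by (metis norm_minus_cancel norm_one)
    then show False using nz2 by simp
  qed
  have "cmod (Ln (1 + ?z) - ?z) \<le> (cmod ?z)\<^sup>2 / (1 - cmod ?z)" by (rule Ln_approx_linear[OF nz2(1)])
  also have "\<dots> \<le> (cmod ?z)\<^sup>2 / (1/2)" using nz2 by (intro divide_left_mono) auto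
  also have "\<dots> \<le> 2 * a\<^sup>2" using nz power_mono[OF nz, of 2] by simp
  finally have "\<bar>Re (Ln (1 + ?z) - ?z)\<bar> \<le> 2 * a\<^sup>2"
    using abs_Re_le_cmod order_trans by blast
  then have "- a * Re w - 2 * a\<^sup>2 \<le> Re (Ln (1 + ?z))" by simp
  also have "Re (Ln (1 + ?z)) = ln (cmod (1 + ?z))" using ne by (rule Re_Ln)
  finally have "exp (- a * Re w - 2 * a\<^sup>2) \<le> exp (ln (cmod (1 + ?z)))" by simp
  also have "\<dots> = cmod (1 - of_real a * w)" using ne by (simp add: exp_ln)
  finally show ?thesis .
qed

lemma cis_2_arctan: "cis (2 * arctan t) * (1 - \<i> * of_real t) = 1 + \<i> * of_real t"
proof -
  have p: "0 < 1 + t\<^sup>2" by (simp add: add_pos_nonneg)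
  have "cis (2 * arctan t) = cis (arctan t) ^ 2" by (simp add: cis_mult power2_eq_square)
  also have "cis (arctan t) = (1 + \<i> * of_real t) / of_real (sqrt (1 + t\<^sup>2))"
    by (simp add: complex_eq_iff cos_arctan sin_arctan Re_divide_of_real Im_divide_of_real)
  also have "\<dots> ^ 2 = (1 + \<i> * of_real t)\<^sup>2 / of_real (1 + t\<^sup>2)"
  proof -
    have "(complex_of_real (sqrt (1 + t\<^sup>2)))\<^sup>2 = of_real (1 + t\<^sup>2)"
      using p by (simp only: of_real_power[symmetric] real_sqrt_pow2[OF less_imp_le])
    then show ?thesis by (simp only: power_divide)
  qed
  also have "\<dots> * (1 - \<i> * of_real t) = (1 + \<i> * of_real t) * ((1 + \<i> * of_real t) * (1 - \<i> * of_real t) / of_real (1 + t\<^sup>2))"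
    by (simp add: power2_eq_square)
  also have "(1 + \<i> * of_real t) * (1 - \<i> * of_real t) = of_real (1 + t\<^sup>2)"
    by (simp add: complex_eq_iff power2_eq_square)
  also have "(1 + \<i> * of_real t) * (of_real (1 + t\<^sup>2) / of_real (1 + t\<^sup>2)) = 1 + \<i> * of_real t"
  proof -
    have nz: "complex_of_real (1 + t\<^sup>2) \<noteq> 0" using p by (simp only: of_real_eq_0_iff)
    show ?thesis by (simp only: divide_self[OF nz] mult_1_right)
  qed
  finally show ?thesis .
qed

text \<open>
  On the unit circle the equation says that the continuous phase \<open>N\<phi> + 2 arctan t(\<phi>)\<close> is a multiple of
  \<open>2\<pi>\<close>. The second summand is at most 4a in modulus, so the intermediate value theorem finds a solution within 4a/N of \<open>2\<pi>m/N\<close>.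
\<close>

lemma perturbed_root_exists:
  assumes a: "0 \<le> a" "a \<le> 1/2" and JN: "J \<le> N" and N: "N > 0"
  shows "\<exists>\<phi>. \<bar>\<phi> - 2 * pi * real m / real N\<bar> \<le> 4 * a / real N \<and> perturbed J N a (cis \<phi>) = 0"
proof -
  define t where "t \<phi> = a * sin (real J * \<phi>) / (1 - a * cos (real J * \<phi>))" for \<phi>
  have den: "1 - a * cos (real J * \<phi>) \<ge> 1/2" for \<phi>
    using a mult_mono[of a "1/2" "cos (real J * \<phi>)" 1] mult_left_mono[OF cos_le_one, of a "real J * \<phi>"] by simp
  have t: "\<bar>t \<phi>\<bar> \<le> 2 * a" for \<phi>
  proof -
    have "\<bar>t \<phi>\<bar> = a * \<bar>sin (real J * \<phi>)\<bar> / (1 - a * cos (real J * \<phi>))"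
      using den[of \<phi>] a by (simp add: t_def abs_mult abs_divide)
    also have "\<dots> \<le> a * 1 / (1/2)" using den[of \<phi>] a by (intro frac_le mult_mono) auto
    finally show ?thesis by simp
  qed
  define F where "F \<phi> = real N * \<phi> + 2 * arctan (t \<phi>)" for \<phi>
  have at: "\<bar>2 * arctan (t \<phi>)\<bar> \<le> 4 * a" for \<phi>
    using t[of \<phi>] abs_arctan_le[of "t \<phi>"] by simp
  have "continuous_on UNIV t"
  proof -
    have "1 - a * cos (real J * \<phi>) \<noteq> 0" for \<phi> using den[of \<phi>] by auto
    then show ?thesis unfolding t_def by (intro continuous_intros) blast
  qed
  then have ct: "continuous_on S t" for S by (rule continuous_on_subset) simp
  have cont: "continuous_on S F" for S
    unfolding F_def by (intro continuous_on_add continuous_on_mult continuous_on_const continuous_on_id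
        continuous_on_arctan ct)
  let ?c = "2 * pi * real m / real N" and ?d = "4 * a / real N"
  have "F (?c - ?d) \<le> 2 * pi * real m"
    using at[of "?c - ?d"] N unfolding F_def by (simp add: right_diff_distrib abs_le_iff)
  moreover have "2 * pi * real m \<le> F (?c + ?d)"
    using at[of "?c + ?d"] N unfolding F_def by (simp add: distrib_left abs_le_iff)
  moreover have "?c - ?d \<le> ?c + ?d" using a by simp
  ultimately obtain \<phi> where \<phi>: "?c - ?d \<le> \<phi>" "\<phi> \<le> ?c + ?d" "F \<phi> = 2 * pi * real m"
    using IVT'[of F "?c - ?d" "2 * pi * real m" "?c + ?d"] cont by blast
  have "cis (real N * \<phi>) * (1 + \<i> * of_real (t \<phi>)) = 1 - \<i> * of_real (t \<phi>)"
  proof -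
    have "real N * \<phi> = 2 * pi * real m - 2 * arctan (t \<phi>)" using \<phi>(3) by (simp add: F_def)
    then have "cis (real N * \<phi>) = cis (2 * pi * real m + 2 * arctan (- t \<phi>))"
      by (simp add: arctan_minus)
    also have "\<dots> = cis (2 * pi * real m) * cis (2 * arctan (- t \<phi>))" by (rule cis_mult[symmetric])
    also have "cis (2 * pi * real m) = 1" using cis_multiple_2pi[of "real m"] by simp
    finally show ?thesis using cis_2_arctan[of "- t \<phi>"] by simp
  qed
  then have "cis (real N * \<phi>) * (1 + \<i> * of_real (t \<phi>)) * of_real (1 - a * cos (real J * \<phi>)) =
     (1 - \<i> * of_real (t \<phi>)) * of_real (1 - a * cos (real J * \<phi>))" by simp
  moreover have "(1 + \<i> * of_real (t \<phi>)) * of_real (1 - a * cos (real J * \<phi>)) = 1 - of_real a * cis (- (real J * \<phi>))"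
    using den[of \<phi>] by (simp add: complex_eq_iff t_def)
  moreover have "(1 - \<i> * of_real (t \<phi>)) * of_real (1 - a * cos (real J * \<phi>)) = 1 - of_real a * cis (real J * \<phi>)"
    using den[of \<phi>] by (simp add: complex_eq_iff t_def)
  ultimately have "cis (real N * \<phi>) * (1 - of_real a * cis (- (real J * \<phi>))) = 1 - of_real a * cis (real J * \<phi>)"
    by (simp only: mult.assoc)
  moreover have "c * (1 - b * A) = c - b * (c * A)" for c b A :: complex by (simp add: algebra_simps)
  moreover have "cis (real N * \<phi>) * cis (- (real J * \<phi>)) = cis (real (N - J) * \<phi>)"
    using JN by (simp add: cis_mult of_nat_diff algebra_simps)
  ultimately have "cis (real N * \<phi>) - of_real a * cis (real (N - J) * \<phi>) = 1 - of_real a * cis (real J * \<phi>)"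
    by (simp only:)
  moreover have "C - b * D = 1 - b * B \<Longrightarrow> 1 - b * B + b * D - C = 0" for b B C D :: complex
    by (simp add: algebra_simps)
  ultimately have "perturbed J N a (cis \<phi>) = 0"
    unfolding perturbed_def Complex.DeMoivre by (simp only:)
  moreover have "\<bar>\<phi> - ?c\<bar> \<le> ?d" using \<phi>(1,2) by linarith
  ultimately show ?thesis by (intro exI[of _ \<phi>] conjI)
qed

definition root_angle :: "nat \<Rightarrow> nat \<Rightarrow> real \<Rightarrow> nat \<Rightarrow> real" where
  "root_angle J N a m = (SOME \<phi>. \<bar>\<phi> - 2 * pi * real m / real N\<bar> \<le> 4 * a / real N \<and> perturbed J N a (cis \<phi>) = 0)"

lemma root_angle:
  assumes "0 \<le> a" "a \<le> 1/2" "J \<le> N" "N > 0"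
  shows "\<bar>root_angle J N a m - 2 * pi * real m / real N\<bar> \<le> 4 * a / real N"
    "perturbed J N a (cis (root_angle J N a m)) = 0"
proof -
  have *: "\<bar>root_angle J N a m - 2 * pi * real m / real N\<bar> \<le> 4 * a / real N \<and>
      perturbed J N a (cis (root_angle J N a m)) = 0"
    unfolding root_angle_def by (rule someI_ex[OF perturbed_root_exists[OF assms]])
  show "\<bar>root_angle J N a m - 2 * pi * real m / real N\<bar> \<le> 4 * a / real N"
    by (rule conjunct1[OF *])
  show "perturbed J N a (cis (root_angle J N a m)) = 0" by (rule conjunct2[OF *])
qed

lemma cmod_cis_diff_le: "cmod (cis x - cis y) \<le> \<bar>x - y\<bar>"
proof -
  have "cis x - cis y = cis y * (exp (\<i> * of_real (x - y)) - 1)"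
    by (simp add: cis_conv_exp exp_add[symmetric] algebra_simps)
  then have "cmod (cis x - cis y) = 2 * \<bar>sin ((x - y) / 2)\<bar>"
    by (simp only: norm_mult dist_exp_i_1) simp
  also have "\<dots> \<le> 2 * \<bar>(x - y) / 2\<bar>" by (intro mult_left_mono abs_sin_x_le_abs_x) auto
  finally show ?thesis by simp
qed

text \<open>
  If \<open>z \<noteq> 1\<close> is an N-th root of unity, its powers sum to 0, whereas each power \<open>z\<^sup>j\<close> differs from 1 by at most \<open>j |z - 1|\<close>.
\<close>

lemma unity_root_separation:
  fixes z :: complex
  assumes N: "N > 0" and z: "z ^ N = 1" "z \<noteq> 1"
  shows "2 / real N \<le> cmod (z - 1)"
proof -
  have nz: "cmod z = 1" 
  proof -
    have "cmod z ^ N = 1 ^ N" by (simp add: norm_power[symmetric] z)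
    then show ?thesis using N by (intro power_eq_imp_eq_base[of "cmod z" N 1]) auto
  qed
  have s: "(\<Sum>j<N. z ^ j) = 0" using z by (simp add: sum_gp_strict)
  have gauss: "2 * (\<Sum>j<N. real j) \<le> real N * real N"
    by (induction N) (auto simp: algebra_simps)
  have "real N = cmod (\<Sum>j<N. (1 - z ^ j))" by (simp add: sum_subtractf s)
  also have "\<dots> \<le> (\<Sum>j<N. cmod (1 ^ j - z ^ j))" by (rule order_trans[OF norm_sum]) simp
  also have "\<dots> \<le> (\<Sum>j<N. real j * cmod (1 - z))"
    using nz by (intro sum_mono norm_power_diff) auto
  also have "\<dots> = (\<Sum>j<N. real j) * cmod (z - 1)" by (simp add: sum_distrib_right norm_minus_commute)
  finally have "2 * real N \<le> 2 * (\<Sum>j<N. real j) * cmod (z - 1)" by simp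
  also have "\<dots> \<le> real N * real N * cmod (z - 1)" using gauss by (intro mult_right_mono) auto
  finally have "2 \<le> real N * cmod (z - 1)" using N by simp
  then show ?thesis using N by (simp add: field_simps)
qed

lemma unity_roots_separation:
  assumes m: "m < N" "m' < N" "m \<noteq> m'"
  shows "2 / real N \<le> cmod (cis (2 * pi * real m / real N) - cis (2 * pi * real m' / real N))"
proof -
  have N: "N > 0" using m by simp
  let ?z = "cis (2 * pi * real m / real N - 2 * pi * real m' / real N)"
  have eq: "cis (2 * pi * real m / real N) - cis (2 * pi * real m' / real N) = cis (2 * pi * real m' / real N) * (?z - 1)"
    by (simp add: algebra_simps cis_mult)
  have "?z \<noteq> 1"
  proof
    assume "?z = 1"
    then have "cis (2 * pi * real m / real N) = cis (2 * pi * real m' / real N)" using eq by simp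
    then show False using Complex.bij_betw_roots_unity[OF N] m by (auto simp: bij_betw_def inj_on_def)
  qed
  moreover have "?z ^ N = 1"
  proof -
    have "real N * (2 * pi * real m / real N - 2 * pi * real m' / real N) = 2 * pi * of_int (int m - int m')"
      using N by (simp add: right_diff_distrib)
    then show ?thesis unfolding Complex.DeMoivre by (simp add: cis_multiple_2pi)
  qed
  ultimately show ?thesis unfolding eq using unity_root_separation[OF N] by (simp add: norm_mult)
qed

lemma perturbed_roots_separation:
  assumes a: "0 \<le> a" "a \<le> 1/8" and JN: "J \<le> N" and m: "m < N" "m' < N" "m \<noteq> m'"
  shows "1 / real N \<le> cmod (cis (root_angle J N a m) - cis (root_angle J N a m'))"
proof -
  have N: "N > 0" using m by simp
  have d: "cmod (cis (root_angle J N a i) - cis (2 * pi * real i / real N)) \<le> 1 / (2 * real N)" for i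
  proof -
    have "cmod (cis (root_angle J N a i) - cis (2 * pi * real i / real N)) \<le> 4 * a / real N"
      by (rule order_trans[OF cmod_cis_diff_le root_angle(1)]) (use a JN N in auto)
    also have "\<dots> \<le> (1/2) / real N" using a by (intro divide_right_mono) auto
    finally show ?thesis by simp
  qed
  let ?p = "cis (root_angle J N a m)" and ?p' = "cis (root_angle J N a m')"
  let ?u = "cis (2 * pi * real m / real N)" and ?u' = "cis (2 * pi * real m' / real N)"
  have "cmod (?u - ?u') \<le> cmod (?p - ?u) + cmod (?p - ?p') + cmod (?p' - ?u')"
    using norm_triangle_ineq[of "(?u - ?p) + (?p - ?p')" "?p' - ?u'"] norm_triangle_ineq[of "?u - ?p" "?p - ?p'"]
    by (simp add: norm_minus_commute)
  moreover have "2 / real N = 1 / real N + 1 / (2 * real N) + 1 / (2 * real N)" by simp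
  ultimately show ?thesis using d[of m] d[of m'] unity_roots_separation[OF m] by linarith
qed

text \<open>
  The N roots just found are distinct, so they are all the roots of this polynomial of degree N, and each is simple.
\<close>

lemma perturbed_zeros:
  assumes a: "0 \<le> a" "a \<le> 1/8" and J: "J > 0" and JN: "2 * J \<le> N"
  shows "{z. perturbed J N a z = 0} = (\<lambda>m. cis (root_angle J N a m)) ` {..<N}"
    and "perturbed J N a z = 0 \<Longrightarrow> deriv (perturbed J N a) z \<noteq> 0"
proof -
  define p :: "complex poly" where "p = 1 - monom (of_real a) J + monom (of_real a) (N - J) - monom 1 N"
  have N: "N > 0" "J < N" "N - J < N" using J JN by auto
  have pp: "poly p z = perturbed J N a z" for z
    by (simp add: p_def perturbed_def poly_monom)
  have cN: "coeff p N = -1" using N by (simp add: p_def)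
  then have p0: "p \<noteq> 0" by auto
  have deg: "degree p \<le> N"
  proof -
    have "degree (monom c j) \<le> N" if "j \<le> N" for c :: complex and j
      using degree_monom_le[of c j] that by (rule order_trans)
    then show ?thesis unfolding p_def using N by (intro degree_diff_le degree_add_le) simp_all
  qed
  let ?R = "(\<lambda>m. cis (root_angle J N a m)) ` {..<N}"
  have inj: "inj_on (\<lambda>m. cis (root_angle J N a m)) {..<N}"
  proof (rule inj_onI, rule ccontr)
    fix m m' assume "m \<in> {..<N}" "m' \<in> {..<N}" "cis (root_angle J N a m) = cis (root_angle J N a m')" "m \<noteq> m'"
    then show False using perturbed_roots_separation[OF a, of J N m m'] JN N by simp
  qed
  have sub: "?R \<subseteq> {z. poly p z = 0}" using root_angle(2)[of a J N] a JN N pp by auto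
  have fin: "finite {z. poly p z = 0}" using p0 by (rule poly_roots_finite)
  have sumle: "(\<Sum>z | poly p z = 0. order z p) \<le> N"
    using sum_order_le_degree[OF p0] deg by linarith
  have ord1: "order z p \<ge> 1" if "poly p z = 0" for z
    using that p0 by (metis One_nat_def Suc_leI neq0_conv order_root)
  have "card {z. poly p z = 0} \<le> (\<Sum>z | poly p z = 0. order z p)"
    using sum_mono[of "{z. poly p z = 0}" "\<lambda>_. 1::nat" "\<lambda>z. order z p"] ord1 by simp
  then have "card {z. poly p z = 0} \<le> card ?R" using sumle card_image[OF inj] by simp
  then have eq: "?R = {z. poly p z = 0}" using card_seteq[OF fin sub] by simp
  then show "{z. perturbed J N a z = 0} = ?R" by (simp add: pp)
  show "deriv (perturbed J N a) z \<noteq> 0" if z: "perturbed J N a z = 0"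
  proof -
    have "order z p = 1"
    proof (rule ccontr)
      assume ne: "order z p \<noteq> 1"
      have zr: "z \<in> {z. poly p z = 0}" using z pp by simp
      have "card {z. poly p z = 0} < (\<Sum>z | poly p z = 0. order z p)"
      proof -
        have "1 < order z p" using ord1[of z] zr ne by simp
        then have "(\<Sum>z | poly p z = 0. 1) < (\<Sum>z | poly p z = 0. order z p)"
          using fin ord1 zr by (intro sum_strict_mono_ex1) auto
        then show ?thesis by simp
      qed
      then show False using sumle card_image[OF inj] eq by simp
    qed
    moreover have "pderiv p \<noteq> 0"
    proof
      assume "pderiv p = 0"
      then have "coeff (pderiv p) (N - 1) = 0" by simp
      then show False using N cN by (simp add: coeff_pderiv)
    qed
    ultimately have "order z (pderiv p) = 0" using order_pderiv[of p z] p0 z pp by simp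
    then have "poly (pderiv p) z \<noteq> 0" using \<open>pderiv p \<noteq> 0\<close> by (simp add: order_root)
    moreover have "deriv (perturbed J N a) z = poly (pderiv p) z"
    proof (rule DERIV_imp_deriv)
      have "perturbed J N a = poly p" using pp by auto
      then show "(perturbed J N a has_field_derivative poly (pderiv p) z) (at z)"
        using poly_DERIV[of p z] by simp
    qed
    ultimately show ?thesis by simp
  qed
qed

lemma cmod_perturbed_zero:
  assumes "0 \<le> a" "a \<le> 1/8" "J > 0" "2 * J \<le> N" "perturbed J N a z = 0"
  shows "cmod z = 1"
proof -
  have "z \<in> {z. perturbed J N a z = 0}" using assms(5) by simp
  then show ?thesis unfolding perturbed_zeros(1)[OF assms(1-4)] by auto
qed

lemma perturbed_symmetric:
  assumes "z' ^ J = z ^ J" "J dvd N" "J \<le> N"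
  shows "perturbed J N a z' = perturbed J N a z"
proof -
  have *: "z' ^ j = z ^ j" if dj: "J dvd j" for j
  proof -
    obtain i where "j = J * i" using dj by (rule dvdE)
    then show ?thesis by (simp only: power_mult assms(1))
  qed
  have "J dvd N - J" using assms by (intro dvd_diff_nat) auto
  then show ?thesis unfolding perturbed_def *[OF assms(2)] *[OF dvd_refl] by (subst *) simp_all
qed

section \<open>Ring configurations: separation, tiling, symmetry\<close>

definition ring_size :: "nat \<Rightarrow> nat \<Rightarrow> nat" where "ring_size J k = 2 * J * Suc k"
definition ring_radius :: "nat \<Rightarrow> nat \<Rightarrow> real" where "ring_radius J k = sqrt (real J) * \<kappa> k"
definition ring_index :: "nat \<Rightarrow> (nat \<times> nat) set" where "ring_index J = (SIGMA k:UNIV. {..<ring_size J k})"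
definition ring_point :: "nat \<Rightarrow> (nat \<Rightarrow> real) \<Rightarrow> nat \<times> nat \<Rightarrow> complex" where
  "ring_point J a = (\<lambda>(k, m). of_real (ring_radius J k) * cis (root_angle J (ring_size J k) (a k) m))"
text \<open>
  The sequence a holds the perturbation parameters of the circles; the zero sequence gives the regular polygons.
\<close>

definition ring_set :: "nat \<Rightarrow> (nat \<Rightarrow> real) \<Rightarrow> complex set" where "ring_set J a = ring_point J a ` ring_index J"

locale ring_config =
  fixes J :: nat and a :: "nat \<Rightarrow> real"
  assumes J: "J \<ge> 2" and a0: "\<And>k. 0 \<le> a k" and a8: "\<And>k. a k \<le> 1/8"
begin

lemma sqrt_J: "sqrt (real J) \<ge> 1" "sqrt (real J) > 0"
  using J by (auto simp: real_sqrt_ge_one)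

lemma ring_size_facts: "J \<le> ring_size J k" "2 * J \<le> ring_size J k" "ring_size J k > 0" "J > 0" "J dvd ring_size J k"
  using J by (auto simp: ring_size_def)

lemma ring_radius_pos [simp]: "ring_radius J k > 0"
  using sqrt_J by (simp add: ring_radius_def)

lemma abs_ring_radius [simp]: "\<bar>ring_radius J k\<bar> = ring_radius J k"
  by (rule abs_of_pos) (rule ring_radius_pos)

lemma cmod_ring_point: "cmod (ring_point J a (k, m)) = ring_radius J k"
  using ring_radius_pos[of k] by (simp add: ring_point_def norm_mult)

lemma ring_radius_over_N: "ring_radius J k / real (ring_size J k) \<le> 9/16" "1 / (4 * sqrt (real J)) \<le> ring_radius J k / real (ring_size J k)"
proof -
  define s where "s = sqrt (real J)"
  have s: "s \<ge> 1" "real J = s * s" using sqrt_J by (auto simp: s_def)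
  have eq: "ring_radius J k / real (ring_size J k) = (\<kappa> k / (real k + 1)) / (2 * s)"
  proof -
    have "ring_radius J k = s * \<kappa> k" by (simp add: ring_radius_def s_def)
    moreover have "real (ring_size J k) = s * (2 * s * (real k + 1))"
      unfolding ring_size_def of_nat_mult s(2) by simp
    ultimately have "ring_radius J k / real (ring_size J k) = (s * \<kappa> k) / (s * (2 * s * (real k + 1)))"
      by simp
    also have "\<dots> = \<kappa> k / (2 * s * (real k + 1))" using s by (intro mult_divide_mult_cancel_left) auto
    finally show ?thesis by (simp add: mult_ac)
  qed
  have "\<kappa> k / (real k + 1) \<le> 9/8" using \<kappa>_le[of k] by (simp add: divide_le_eq)
  then have "(\<kappa> k / (real k + 1)) / (2 * s) \<le> (9/8) / (2 * 1)"
    by (rule frac_le[rotated]) (use s in auto)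
  then show "ring_radius J k / real (ring_size J k) \<le> 9/16" unfolding eq by simp
  have "1/2 \<le> \<kappa> k / (real k + 1)" using \<kappa>_half[of k] by (simp add: le_divide_eq)
  then have "(1/2) / (2 * s) \<le> (\<kappa> k / (real k + 1)) / (2 * s)" using s by (intro divide_right_mono) auto
  then show "1 / (4 * sqrt (real J)) \<le> ring_radius J k / real (ring_size J k)" unfolding eq s_def by simp
qed

lemma ring_radius_gap: "k < l \<Longrightarrow> ring_radius J k + 3/8 \<le> ring_radius J l"
proof -
  assume "k < l"
  then have "\<kappa> k + 3/8 \<le> \<kappa> l" using \<kappa>_gap[of k] \<kappa>_mono[of "Suc k" l] by linarith
  then have "sqrt (real J) * (\<kappa> k + 3/8) \<le> ring_radius J l"
    unfolding ring_radius_def using sqrt_J by (intro mult_left_mono) auto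
  moreover have "sqrt (real J) * (3/8) \<ge> 3/8" using sqrt_J by simp
  moreover have "sqrt (real J) * (\<kappa> k + 3/8) = ring_radius J k + sqrt (real J) * (3/8)"
    by (simp only: ring_radius_def distrib_left)
  ultimately show ?thesis by linarith
qed

lemma ring_point_separation:
  assumes "i \<in> ring_index J" "j \<in> ring_index J" "i \<noteq> j"
  shows "1 / (4 * sqrt (real J)) \<le> cmod (ring_point J a i - ring_point J a j)"
proof -
  obtain k m l n where ij: "i = (k, m)" "j = (l, n)" by fastforce
  have mn: "m < ring_size J k" "n < ring_size J l" using assms by (auto simp: ij ring_index_def)
  show ?thesis
  proof (cases "k = l")
    case True
    then have "m \<noteq> n" using assms(3) ij by auto
    then have "1 / real (ring_size J k) \<le> cmod (cis (root_angle J (ring_size J k) (a k) m) - cis (root_angle J (ring_size J k) (a k) n))"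
      using perturbed_roots_separation[OF a0 a8 ring_size_facts(1) mn(1), of n k] mn(2) True by simp
    then have "ring_radius J k * (1 / real (ring_size J k)) \<le> ring_radius J k * cmod (cis (root_angle J (ring_size J k) (a k) m) - cis (root_angle J (ring_size J k) (a k) n))"
      by (intro mult_left_mono) (auto simp: less_imp_le)
    also have "\<dots> = cmod (ring_point J a i - ring_point J a j)"
      using True ring_radius_pos[of k] by (simp add: ij ring_point_def right_diff_distrib[symmetric] norm_mult)
    finally show ?thesis using ring_radius_over_N(2)[of k] by simp
  next
    case False
    have "3/8 \<le> \<bar>ring_radius J k - ring_radius J l\<bar>"
    proof (cases "k < l")
      case True then show ?thesis using ring_radius_gap[of k l] by linarith
    next
      case f: False
      then have "l < k" using False by simp
      then show ?thesis using ring_radius_gap[of l k] by linarith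
    qed
    also have "\<dots> \<le> cmod (ring_point J a i - ring_point J a j)"
      using norm_triangle_ineq3[of "ring_point J a i" "ring_point J a j"] by (simp add: ij cmod_ring_point)
    finally have "3/8 \<le> cmod (ring_point J a i - ring_point J a j)" .
    moreover have "1 / (4 * sqrt (real J)) \<le> 1 / (4 * 1)" using sqrt_J by (intro divide_left_mono) auto
    ultimately show ?thesis by linarith
  qed
qed

lemma inj_ring_point: "inj_on (ring_point J a) (ring_index J)"
proof (rule inj_onI, rule ccontr)
  fix i j assume h: "i \<in> ring_index J" "j \<in> ring_index J" "ring_point J a i = ring_point J a j" "i \<noteq> j"
  have "0 < 1 / (4 * sqrt (real J))" using sqrt_J by simp
  then show False using ring_point_separation[OF h(1,2,4)] h(3) by simp
qed

lemma uniform_discrete_ring_set: "uniform_discrete (ring_set J a)"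
proof (rule uniformI2)
  show "0 < 1 / (4 * sqrt (real J))" using sqrt_J by simp
  fix x y assume "x \<in> ring_set J a" "y \<in> ring_set J a" "x \<noteq> y"
  then obtain i j where ij: "i \<in> ring_index J" "j \<in> ring_index J" "x = ring_point J a i" "y = ring_point J a j" "i \<noteq> j"
    by (auto simp: ring_set_def)
  then show "1 / (4 * sqrt (real J)) \<le> dist x y" using ring_point_separation[OF ij(1,2,5)] by (simp add: dist_norm)
qed

lemma ring_point_displacement:
  "cmod (ring_point J a (k, m) - of_real (ring_radius J k) * cis (2 * pi * real m / real (ring_size J k))) \<le> 4 * a k"
proof -
  have a2: "a k \<le> 1/2" using a8[of k] by simp
  have "cmod (ring_point J a (k, m) - of_real (ring_radius J k) * cis (2 * pi * real m / real (ring_size J k)))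
     = ring_radius J k * cmod (cis (root_angle J (ring_size J k) (a k) m) - cis (2 * pi * real m / real (ring_size J k)))"
    using ring_radius_pos[of k] by (simp add: ring_point_def right_diff_distrib[symmetric] norm_mult)
  also have "\<dots> \<le> ring_radius J k * (4 * a k / real (ring_size J k))"
    by (intro mult_left_mono order_trans[OF cmod_cis_diff_le root_angle(1)[OF a0 a2 ring_size_facts(1) ring_size_facts(3)]])
      (simp add: less_imp_le)
  also have "\<dots> = 4 * a k * (ring_radius J k / real (ring_size J k))" by simp
  also have "\<dots> \<le> 4 * a k * 1"
    using a0[of k] ring_radius_over_N(1)[of k] by (intro mult_left_mono) linarith+
  finally show ?thesis by simp
qed

lemma ring_radius_between: "sqrt (real J) * contact k \<le> ring_radius J k" "ring_radius J k \<le> sqrt (real J) * contact (Suc k)"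
  using \<kappa>_above_contact[of k] \<kappa>_below_contact[of k] sqrt_J unfolding ring_radius_def
  by (auto intro!: mult_left_mono)

lemma ring_point_near_sector:
  assumes z: "z \<in> sector (sqrt (real J) * contact k) (sqrt (real J) * contact (Suc k)) (ring_size J k) m"
  shows "cmod (ring_point J a (k, m) - z) \<le> 6 + 2 * sqrt (real J)"
proof -
  let ?\<theta> = "2 * pi * real m / real (ring_size J k)" and ?r = "ring_radius J k"
  let ?A = "Arg2pi z"
  have zA: "z = of_real (cmod z) * cis ?A" using Arg2pi_eq[of z] by (simp add: cis_conv_exp)
  have 1: "cmod (ring_point J a (k, m) - of_real ?r * cis ?\<theta>) \<le> 1/2"
    using ring_point_displacement[of k m] a8[of k] by linarith
  have "?A - ?\<theta> \<le> 2 * pi / real (ring_size J k)" "?\<theta> \<le> ?A"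
    using z by (auto simp: sector_def add_divide_distrib distrib_left)
  then have "cmod (cis ?\<theta> - cis ?A) \<le> 2 * pi / real (ring_size J k)"
    using cmod_cis_diff_le[of ?\<theta> ?A] by linarith
  then have "?r * cmod (cis ?\<theta> - cis ?A) \<le> ?r * (2 * pi / real (ring_size J k))"
    by (intro mult_left_mono) (auto simp: less_imp_le)
  also have "\<dots> = 2 * pi * (?r / real (ring_size J k))" by simp
  also have "\<dots> \<le> 2 * 4 * (9/16)"
    using ring_radius_over_N(1)[of k] pi_less_4 by (intro mult_mono) (auto simp: less_imp_le)
  finally have 2: "cmod (of_real ?r * cis ?\<theta> - of_real ?r * cis ?A) \<le> 5"
    using ring_radius_pos[of k] by (simp add: right_diff_distrib[symmetric] norm_mult)
  have "\<bar>?r - cmod z\<bar> \<le> sqrt (real J) * contact (Suc k) - sqrt (real J) * contact k"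
    using ring_radius_between[of k] z by (auto simp: sector_def abs_le_iff)
  also have "\<dots> = sqrt (real J) * (contact (Suc k) - contact k)" by (simp add: right_diff_distrib)
  also have "\<dots> \<le> sqrt (real J) * 2"
    using contact_bounds(1)[of k] contact_bounds(2)[of "Suc k"] sqrt_J by (intro mult_left_mono) auto
  finally have 3: "cmod (of_real ?r * cis ?A - z) \<le> 2 * sqrt (real J)"
    by (subst (2) zA) (simp add: left_diff_distrib[symmetric] norm_mult of_real_diff[symmetric] del: of_real_diff)
  have "ring_point J a (k, m) - z = (ring_point J a (k, m) - of_real ?r * cis ?\<theta>) +
      ((of_real ?r * cis ?\<theta> - of_real ?r * cis ?A) + (of_real ?r * cis ?A - z))" by simp
  also have "cmod \<dots> \<le> 1/2 + (5 + 2 * sqrt (real J))"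
    using 1 2 3 by (intro norm_triangle_mono)
  finally show ?thesis by simp
qed

lemma tiled_ring_set: "\<exists>c D. tiled_by (ring_set J a) c D"
proof -
  let ?R = "\<lambda>k. sqrt (real J) * contact k"
  have "tiled_by (ring_point J a ` (SIGMA k:UNIV. {..<ring_size J k}))
     (\<lambda>x. case inv_into (SIGMA k:UNIV. {..<ring_size J k}) (ring_point J a) x of (k, m) \<Rightarrow> sector (?R k) (?R (Suc k)) (ring_size J k) m) (6 + 2 * sqrt (real J))"
  proof (rule tiled_by_sectors)
    show "ring_size J k > 0" for k by (rule ring_size_facts)
    show "?R 0 = 0" by (simp add: contact_def)
    show "mono ?R"
    proof (rule monoI)
      fix k l :: nat assume "k \<le> l"
      then have "contact k \<le> contact l" unfolding contact_def by (intro real_sqrt_le_mono mult_mono) auto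
      then show "?R k \<le> ?R l" using sqrt_J by (intro mult_left_mono) auto
    qed
    have "filterlim contact at_top sequentially"
      by (rule filterlim_at_top_mono[OF filterlim_real_sequentially]) (simp add: contact_bounds)
    then show "filterlim ?R at_top sequentially"
      by (rule filterlim_tendsto_pos_mult_at_top[OF tendsto_const sqrt_J(2)])
    show "(?R (Suc k))\<^sup>2 - (?R k)\<^sup>2 = real (ring_size J k)" for k
      by (simp add: power_mult_distrib contact_def ring_size_def algebra_simps)
    show "inj_on (ring_point J a) (SIGMA k:UNIV. {..<ring_size J k})" using inj_ring_point by (simp add: ring_index_def)
    show "cmod (ring_point J a (k, m) - z) \<le> 6 + 2 * sqrt (real J)"
      if "z \<in> sector (?R k) (?R (Suc k)) (ring_size J k) m" for k m z
      using that by (rule ring_point_near_sector)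
  qed
  then show ?thesis unfolding ring_set_def ring_index_def by blast
qed

lemma ring_set_iff: "z \<in> ring_set J a \<longleftrightarrow> (\<exists>k. perturbed J (ring_size J k) (a k) (z / of_real (ring_radius J k)) = 0)"
proof -
  have zeros: "{w. perturbed J (ring_size J k) (a k) w = 0} = (\<lambda>m. cis (root_angle J (ring_size J k) (a k) m)) ` {..<ring_size J k}" for k
    by (rule perturbed_zeros(1)[OF a0 a8 ring_size_facts(4) ring_size_facts(2)])
  have div: "z / of_real (ring_radius J k) = w \<longleftrightarrow> z = of_real (ring_radius J k) * w" for k w
    using less_imp_neq[OF ring_radius_pos[of k]] by (auto simp: field_simps)
  have "z \<in> ring_set J a \<longleftrightarrow> (\<exists>k. \<exists>m<ring_size J k. z = of_real (ring_radius J k) * cis (root_angle J (ring_size J k) (a k) m))"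
    by (auto simp: ring_set_def ring_index_def ring_point_def)
  also have "\<dots> \<longleftrightarrow> (\<exists>k. z / of_real (ring_radius J k) \<in> (\<lambda>m. cis (root_angle J (ring_size J k) (a k) m)) ` {..<ring_size J k})"
    by (auto simp: div image_iff)
  also have "\<dots> \<longleftrightarrow> (\<exists>k. perturbed J (ring_size J k) (a k) (z / of_real (ring_radius J k)) = 0)"
    unfolding zeros[symmetric] by simp
  finally show ?thesis .
qed

lemma ring_set_rotation: assumes "z \<in> ring_set J a" "\<omega> ^ J = 1" shows "\<omega> * z \<in> ring_set J a"
proof -
  obtain k where k: "perturbed J (ring_size J k) (a k) (z / of_real (ring_radius J k)) = 0"
    using assms(1) by (auto simp: ring_set_iff)
  have "(\<omega> * z / of_real (ring_radius J k)) ^ J = (z / of_real (ring_radius J k)) ^ J"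
    using assms(2) by (simp add: power_mult_distrib power_divide)
  from perturbed_symmetric[OF this ring_size_facts(5) ring_size_facts(1), of k "a k"] k show ?thesis by (auto simp: ring_set_iff)
qed

text \<open>
  Rotation by \<open>\<omega> = e\<^sup>2\<^sup>\<pi>\<^sup>i\<^sup>/\<^sup>J\<close> permutes the points of a circle and multiplies the j-th moment by \<open>\<omega>\<^sup>j \<noteq> 1\<close>.
\<close>

lemma circle_moment_ring_set:
  assumes j: "1 \<le> j" "j < J" and \<rho>: "\<rho> > 0"
  shows "circle_moment (ring_set J a) j \<rho> = 0"
proof (cases "finite {z. z \<in> ring_set J a \<and> cmod z = \<rho>}")
  case True
  let ?S = "{z. z \<in> ring_set J a \<and> cmod z = \<rho>}"
  define \<omega> where "\<omega> = cis (2 * pi * real 1 / real J)"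
  have \<omega>J: "\<omega> ^ J = 1" using J by (simp add: \<omega>_def Complex.DeMoivre)
  have \<omega>1: "cmod \<omega> = 1" "\<omega> \<noteq> 0" by (auto simp: \<omega>_def)
  have \<omega>j: "\<omega> ^ j \<noteq> 1"
  proof
    assume "\<omega> ^ j = 1"
    then have "cis (2 * pi * real j / real J) = cis (2 * pi * real 0 / real J)"
      by (simp add: \<omega>_def Complex.DeMoivre mult_ac)
    then have "j = 0"
      using Complex.bij_betw_roots_unity[of J] j J by (auto simp: bij_betw_def inj_on_def)
    then show False using j by simp
  qed
  have exp: "exp (\<i> * of_nat j * of_real (Arg z)) = (z / of_real \<rho>) ^ j" if "z \<in> ?S" for z
  proof -
    have "z = of_real \<rho> * exp (\<i> * of_real (Arg z))" using that \<rho> Arg_eq[of z] by auto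
    then have "z / of_real \<rho> = exp (\<i> * of_real (Arg z))" using \<rho> by (simp add: field_simps)
    then show ?thesis by (simp add: exp_of_nat_mult[symmetric] mult_ac)
  qed
  have "(\<lambda>z. \<omega> * z) ` ?S \<subseteq> ?S" using ring_set_rotation[OF _ \<omega>J] \<omega>1 by (auto simp: norm_mult)
  moreover have inj: "inj_on (\<lambda>z. \<omega> * z) ?S" using \<omega>1 by (auto simp: inj_on_def)
  ultimately have img: "(\<lambda>z. \<omega> * z) ` ?S = ?S" using endo_inj_surj[OF True] by blast
  have "circle_moment (ring_set J a) j \<rho> = (\<Sum>z\<in>?S. (z / of_real \<rho>) ^ j)"
    unfolding circle_moment_def by (intro sum.cong exp) auto
  also have "\<dots> = (\<Sum>z\<in>(\<lambda>z. \<omega> * z) ` ?S. (z / of_real \<rho>) ^ j)" unfolding img ..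
  also have "\<dots> = (\<Sum>z\<in>?S. (\<omega> * z / of_real \<rho>) ^ j)" by (simp add: sum.reindex[OF inj])
  also have "\<dots> = \<omega> ^ j * (\<Sum>z\<in>?S. (z / of_real \<rho>) ^ j)"
    by (simp add: sum_distrib_left power_mult_distrib power_divide)
  also have "(\<Sum>z\<in>?S. (z / of_real \<rho>) ^ j) = circle_moment (ring_set J a) j \<rho>"
    unfolding circle_moment_def by (intro sum.cong exp[symmetric]) auto
  finally show ?thesis using \<omega>j by simp
qed (simp add: circle_moment_def)

end

lemma ring_point_regular: assumes "J \<ge> 2" shows "ring_point J (\<lambda>_. 0) (k, m) = of_real (ring_radius J k) * cis (2 * pi * real m / real (ring_size J k))"
proof -
  interpret ring_config J "\<lambda>_. 0" using assms by unfold_locales auto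
  show ?thesis using ring_point_displacement[of k m] by simp
qed

lemma radial_count_simple: "radial_count (simple A) r = card {z \<in> A. cmod z \<le> r}"
proof -
  have eq: "{z. 0 < simple A z \<and> cmod z \<le> r} = {z \<in> A. cmod z \<le> r}" by (auto simp: simple_def)
  show ?thesis unfolding radial_count_def eq by (simp add: simple_def)
qed

lemma radial_count_bij:
  assumes T: "bij_betw T A B" and c: "\<And>z. z \<in> A \<Longrightarrow> cmod (T z) = cmod z"
  shows "radial_count (simple A) r = radial_count (simple B) r"
proof -
  have "bij_betw T {z \<in> A. cmod z \<le> r} {z \<in> B. cmod z \<le> r}"
    by (rule bij_betw_subset[OF T]) (use T c in \<open>auto simp: bij_betw_def\<close>)
  then show ?thesis unfolding radial_count_simple by (rule bij_betw_same_card)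
qed

section \<open>The entire function with zeros on the rings\<close>

lemma entire_infinite_product:
  fixes f :: "nat \<Rightarrow> complex \<Rightarrow> complex"
  assumes hol: "\<And>n. f n holomorphic_on UNIV"
    and bd: "\<And>R. R > 0 \<Longrightarrow> \<exists>M. summable M \<and> (\<forall>\<^sub>F n in sequentially. \<forall>z\<in>cball 0 R. cmod (f n z - 1) \<le> M n)"
  shows "convergent_prod (\<lambda>n. f n z)" and "(\<lambda>z. \<Prod>n. f n z) holomorphic_on UNIV"
proof -
  show conv: "convergent_prod (\<lambda>n. f n z)" for z
  proof (rule abs_convergent_prod_imp_convergent_prod, rule summable_imp_abs_convergent_prod)
    obtain M where M: "summable M" "\<forall>\<^sub>F n in sequentially. \<forall>w\<in>cball 0 (cmod z + 1). cmod (f n w - 1) \<le> M n"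
      using bd[of "cmod z + 1"] by (auto simp: add_nonneg_pos)
    show "summable (\<lambda>n. cmod (f n z - 1))"
      by (rule summable_comparison_test_ev[OF _ M(1)], use M(2) in eventually_elim) auto
  qed
  have lim: "(\<lambda>N. \<Prod>n<N. f n z) \<longlonglongrightarrow> (\<Prod>n. f n z)" for z
    using convergent_prod_LIMSEQ[OF conv[of z]] unfolding lessThan_Suc_atMost[symmetric]
    by (subst (asm) filterlim_sequentially_Suc)
  show "(\<lambda>z. \<Prod>n. f n z) holomorphic_on UNIV"
  proof (rule holomorphic_uniform_sequence)
    show "(\<lambda>z. \<Prod>n<N. f n z) holomorphic_on UNIV" for N by (intro holomorphic_intros hol)
    fix z :: complex
    let ?K = "cball 0 (cmod z + 1)"
    obtain M where M: "summable M" "\<forall>\<^sub>F n in sequentially. \<forall>w\<in>?K. cmod (f n w - 1) \<le> M n"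
      using bd[of "cmod z + 1"] by (auto simp: add_nonneg_pos)
    have "uniformly_convergent_on ?K (\<lambda>N z. \<Sum>n<N. norm (f n z - 1))"
      by (rule Weierstrass_m_test'_ev[OF _ M(1)]) (use M(2) in simp)
    then have "uniformly_convergent_on ?K (\<lambda>N z. \<Prod>n<N. f n z)"
      by (intro uniformly_convergent_on_prod' holomorphic_on_imp_continuous_on holomorphic_on_subset[OF hol]) auto
    then obtain g where g: "uniform_limit ?K (\<lambda>N z. \<Prod>n<N. f n z) g sequentially"
      by (auto simp: uniformly_convergent_on_def)
    have "g w = (\<Prod>n. f n w)" if "w \<in> ?K" for w
      using tendsto_uniform_limitI[OF g that] lim[of w] LIMSEQ_unique by blast
    then have "uniform_limit ?K (\<lambda>N z. \<Prod>n<N. f n z) g sequentially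
      = uniform_limit ?K (\<lambda>N z. \<Prod>n<N. f n z) (\<lambda>z. \<Prod>n. f n z) sequentially"
      by (intro uniform_limit_cong') auto
    with g have "uniform_limit ?K (\<lambda>N z. \<Prod>n<N. f n z) (\<lambda>z. \<Prod>n. f n z) sequentially" by simp
    then have "uniform_limit (cball z 1) (\<lambda>N z. \<Prod>n<N. f n z) (\<lambda>z. \<Prod>n. f n z) sequentially"
      by (rule uniform_limit_on_subset) (simp add: cball_subset_cball_iff)
    then show "\<exists>d>0. cball z d \<subseteq> UNIV \<and> uniform_limit (cball z d) (\<lambda>N z. \<Prod>n<N. f n z) (\<lambda>z. \<Prod>n. f n z) sequentially"
      by (intro exI[of _ 1]) auto
  qed auto
qed

lemma infinite_product_limit:
  fixes f :: "nat \<Rightarrow> complex"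
  assumes "convergent_prod f" shows "(\<lambda>N. \<Prod>n<N. f n) \<longlonglongrightarrow> (\<Prod>n. f n)"
  using convergent_prod_LIMSEQ[OF assms] unfolding lessThan_Suc_atMost[symmetric]
  by (subst (asm) filterlim_sequentially_Suc)

lemma infinite_product_zero_iff:
  fixes f :: "nat \<Rightarrow> complex"
  assumes "convergent_prod f" shows "(\<Prod>n. f n) = 0 \<longleftrightarrow> (\<exists>n. f n = 0)"
  using has_prod_eq_0_iff[OF convergent_prod_has_prod[OF assms]] by (auto simp: image_iff)

text \<open>
  Split off the j-th factor. The product of the others is entire as well and does not vanish at z.
\<close>

lemma infinite_product_simple_zero:
  fixes f :: "nat \<Rightarrow> complex \<Rightarrow> complex"
  assumes hol: "\<And>n. f n holomorphic_on UNIV"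
    and bd: "\<And>R. R > 0 \<Longrightarrow> \<exists>M. summable M \<and> (\<forall>\<^sub>F n in sequentially. \<forall>z\<in>cball 0 R. cmod (f n z - 1) \<le> M n)"
    and j: "f j z = 0" "deriv (f j) z \<noteq> 0" "\<And>n. n \<noteq> j \<Longrightarrow> f n z \<noteq> 0"
  shows "deriv (\<lambda>z. \<Prod>n. f n z) z \<noteq> 0"
proof -
  define h where "h n w = (if n = j then 1 else f n w)" for n w
  have h_hol: "h n holomorphic_on UNIV" for n
    using hol[of n] by (cases "n = j") (simp_all add: h_def[abs_def])
  have h_bd: "\<exists>M. summable M \<and> (\<forall>\<^sub>F n in sequentially. \<forall>z\<in>cball 0 R. cmod (h n z - 1) \<le> M n)" if R: "R > 0" for R
  proof -
    obtain M where M: "summable M" "\<forall>\<^sub>F n in sequentially. \<forall>z\<in>cball 0 R. cmod (f n z - 1) \<le> M n"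
      using bd[OF R] by blast
    have "\<forall>\<^sub>F n in sequentially. \<forall>z\<in>cball 0 R. cmod (h n z - 1) \<le> M n"
      using M(2) eventually_gt_at_top[of j] by eventually_elim (auto simp: h_def)
    then show ?thesis using M(1) by blast
  qed
  note h_prod = entire_infinite_product[of h, OF h_hol h_bd]
  let ?H = "\<lambda>w. \<Prod>n. h n w"
  have split: "(\<Prod>n. f n w) = f j w * ?H w" for w
  proof -
    have g: "(\<lambda>n. if n = j then f n w else 1) has_prod f j w" by (rule has_prod_single)
    have "(\<Prod>n. if n = j then f n w else 1) * ?H w = (\<Prod>n. (if n = j then f n w else 1) * h n w)"
      using g h_prod(1)[of w] by (intro prodinf_mult) (auto simp: has_prod_iff)
    also have "(\<lambda>n. (if n = j then f n w else 1) * h n w) = (\<lambda>n. f n w)" by (auto simp: h_def)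
    finally show ?thesis using g by (simp add: has_prod_iff)
  qed
  have Hz: "?H z \<noteq> 0" using infinite_product_zero_iff[OF h_prod(1)[of z]] j(3) by (auto simp: h_def)
  have "((\<lambda>w. f j w * ?H w) has_field_derivative f j z * deriv ?H z + deriv (f j) z * ?H z) (at z)"
    by (intro DERIV_mult' holomorphic_derivI[OF hol] holomorphic_derivI[OF h_prod(2)]) auto
  then have "deriv (\<lambda>z. \<Prod>n. f n z) z = deriv (f j) z * ?H z"
    unfolding split by (intro DERIV_imp_deriv) (simp add: j(1))
  then show ?thesis using j(2) Hz by simp
qed

context ring_config begin

definition ring_factor :: "nat \<Rightarrow> complex \<Rightarrow> complex" where
  "ring_factor k z = perturbed J (ring_size J k) (a k) (z / of_real (ring_radius J k))"

definition ring_product :: "complex \<Rightarrow> complex" where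
  "ring_product z = (\<Prod>k. ring_factor k z)"

lemma a_upper: "a k \<le> 1" "a k \<le> 1/2" using a8[of k] by auto

lemma ring_factor_holomorphic: "ring_factor k holomorphic_on UNIV"
  using less_imp_neq[OF ring_radius_pos[of k]]
  unfolding ring_factor_def[abs_def] perturbed_def by (intro holomorphic_intros) auto

lemma ring_radius_ge: "(real k + 1) / 2 \<le> ring_radius J k"
proof -
  have "\<kappa> k * 1 \<le> \<kappa> k * sqrt (real J)" using sqrt_J by (intro mult_left_mono) (auto simp: less_imp_le)
  then have "\<kappa> k \<le> ring_radius J k" by (simp only: ring_radius_def mult_1_right mult.commute)
  then show ?thesis by (rule order_trans[OF \<kappa>_half])
qed

lemma ring_factor_minus_1:
  assumes "cmod z \<le> ring_radius J k"
  shows "cmod (ring_factor k z - 1) \<le> 12 * (cmod z)\<^sup>2 / (real k + 1)\<^sup>2"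
proof -
  let ?w = "z / of_real (ring_radius J k)"
  have w: "cmod ?w = cmod z / ring_radius J k" by (simp add: norm_divide)
  then have w1: "cmod ?w \<le> 1" using assms ring_radius_pos[of k] by (simp add: divide_le_eq)
  have "cmod (ring_factor k z - 1) \<le> 3 * cmod ?w ^ J"
    unfolding ring_factor_def by (rule perturbed_minus_1[OF w1 a0 a_upper(1) ring_size_facts(2)])
  also have "\<dots> \<le> 3 * cmod ?w ^ 2" using w1 J by (intro mult_left_mono power_decreasing) auto
  also have "\<dots> = 3 * (cmod z / ring_radius J k)\<^sup>2" by (simp only: w)
  also have "\<dots> \<le> 3 * (cmod z / ((real k + 1) / 2))\<^sup>2"
    using ring_radius_ge[of k] by (intro mult_left_mono power_mono divide_left_mono) (auto intro!: mult_pos_pos)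
  also have "\<dots> = 12 * (cmod z)\<^sup>2 / (real k + 1)\<^sup>2" by (simp add: power_divide power_mult_distrib)
  finally show ?thesis .
qed

lemma ring_factor_bound:
  assumes "R > 0"
  shows "\<exists>M. summable M \<and> (\<forall>\<^sub>F n in sequentially. \<forall>z\<in>cball 0 R. cmod (ring_factor n z - 1) \<le> M n)"
proof (intro exI conjI)
  show "summable (\<lambda>k. 12 * R\<^sup>2 / (real k + 1)\<^sup>2)" by (rule summable_inverse_squares)
  have "\<forall>\<^sub>F k in sequentially. 2 * R \<le> real k"
    using filterlim_real_sequentially by (simp add: filterlim_at_top)
  then show "\<forall>\<^sub>F k in sequentially. \<forall>z\<in>cball 0 R. cmod (ring_factor k z - 1) \<le> 12 * R\<^sup>2 / (real k + 1)\<^sup>2"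
  proof eventually_elim
    case (elim k)
    show ?case
    proof
      fix z :: complex assume z: "z \<in> cball 0 R"
      then have "cmod z \<le> ring_radius J k" using ring_radius_ge[of k] elim by auto
      from ring_factor_minus_1[OF this] have "cmod (ring_factor k z - 1) \<le> 12 * (cmod z)\<^sup>2 / (real k + 1)\<^sup>2" .
      also have "\<dots> \<le> 12 * R\<^sup>2 / (real k + 1)\<^sup>2"
        using z by (intro divide_right_mono mult_left_mono power_mono) auto
      finally show "cmod (ring_factor k z - 1) \<le> 12 * R\<^sup>2 / (real k + 1)\<^sup>2" .
    qed
  qed
qed

lemma convergent_ring_factor: "convergent_prod (\<lambda>k. ring_factor k z)"
  by (rule entire_infinite_product(1)[of ring_factor, OF ring_factor_holomorphic ring_factor_bound])

lemma ring_product_holomorphic: "ring_product holomorphic_on UNIV"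
  unfolding ring_product_def[abs_def] by (rule entire_infinite_product(2)[of ring_factor, OF ring_factor_holomorphic ring_factor_bound])

lemma ring_product_limit: "(\<lambda>N. \<Prod>k<N. ring_factor k z) \<longlonglongrightarrow> ring_product z"
  unfolding ring_product_def by (rule infinite_product_limit[OF convergent_ring_factor])

lemma ring_product_zero_iff: "ring_product z = 0 \<longleftrightarrow> z \<in> ring_set J a"
  using infinite_product_zero_iff[OF convergent_ring_factor, of z] by (simp add: ring_product_def ring_set_iff ring_factor_def)

lemma ring_factor_zero_modulus: "ring_factor k z = 0 \<Longrightarrow> cmod z = ring_radius J k"
proof -
  assume "ring_factor k z = 0"
  then have "cmod (z / of_real (ring_radius J k)) = 1"
    unfolding ring_factor_def by (rule cmod_perturbed_zero[OF a0 a8 ring_size_facts(4) ring_size_facts(2)])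
  then show ?thesis using less_imp_neq[OF ring_radius_pos[of k]] by (simp add: norm_divide field_simps)
qed

lemma ring_product_simple_zero: assumes "ring_product z = 0" shows "deriv ring_product z \<noteq> 0"
proof -
  obtain j where j: "ring_factor j z = 0"
    using assms unfolding ring_product_def infinite_product_zero_iff[OF convergent_ring_factor] by blast
  have other: "ring_factor n z \<noteq> 0" if "n \<noteq> j" for n
  proof
    assume "ring_factor n z = 0"
    then have "ring_radius J n = ring_radius J j" using ring_factor_zero_modulus[of n z] ring_factor_zero_modulus[OF j] by simp
    then show False using ring_radius_gap[of n j] ring_radius_gap[of j n] that by (cases "n < j") auto
  qed
  let ?P = "perturbed J (ring_size J j) (a j)" and ?w = "z / of_real (ring_radius J j)"
  have r0: "complex_of_real (ring_radius J j) \<noteq> 0" using less_imp_neq[OF ring_radius_pos[of j]] by auto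
  have "deriv ?P ?w \<noteq> 0"
    using j unfolding ring_factor_def by (rule perturbed_zeros(2)[OF a0 a8 ring_size_facts(4) ring_size_facts(2)])
  moreover have "deriv (ring_factor j) z = deriv ?P ?w * (1 / of_real (ring_radius J j))"
  proof (rule DERIV_imp_deriv)
    have "?P holomorphic_on UNIV" unfolding perturbed_def by (intro holomorphic_intros)
    then have "(?P has_field_derivative deriv ?P ?w) (at ?w)" by (rule holomorphic_derivI) auto
    moreover have "((\<lambda>z. z / of_real (ring_radius J j)) has_field_derivative 1 / of_real (ring_radius J j)) (at z)"
      using r0 by (auto intro!: derivative_eq_intros)
    ultimately show "(ring_factor j has_field_derivative deriv ?P ?w * (1 / of_real (ring_radius J j))) (at z)"
      unfolding ring_factor_def[abs_def] by (rule DERIV_chain2)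
  qed
  ultimately have "deriv (ring_factor j) z \<noteq> 0" using r0 by simp
  from infinite_product_simple_zero[of ring_factor, OF ring_factor_holomorphic ring_factor_bound j this other]
  show ?thesis unfolding ring_product_def[abs_def] by blast
qed

end

section \<open>Growth of the ring product\<close>

context ring_config begin

text \<open>
  The number of circles of normalised radius below x; it indexes the line that is active at x.
\<close>

definition slope :: "real \<Rightarrow> nat" where "slope x = (LEAST k. x \<le> \<kappa> k)"

lemma slope: "k < slope x \<Longrightarrow> \<kappa> k < x" "slope x \<le> k \<Longrightarrow> x \<le> \<kappa> k"
proof -
  obtain k0 :: nat where k0: "2 * x < real k0" using reals_Archimedean2 by blast
  have "x \<le> (real k0 + 1) / 2" using k0 by (simp add: field_simps)
  then have "x \<le> \<kappa> k0" using \<kappa>_half[of k0] by (rule order_trans)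
  then have "x \<le> \<kappa> (slope x)" unfolding slope_def by (rule LeastI)
  then show "slope x \<le> k \<Longrightarrow> x \<le> \<kappa> k" using \<kappa>_mono[of "slope x" k] by linarith
  show "k < slope x \<Longrightarrow> \<kappa> k < x" unfolding slope_def using not_less_Least by (metis not_le)
qed

lemma slope_contact: "slope (contact n) = n"
proof (rule antisym)
  show "slope (contact n) \<le> n"
  proof (rule ccontr)
    assume "\<not> slope (contact n) \<le> n"
    then have "\<kappa> n < contact n" using slope(1)[of n "contact n"] by simp
    then show False using \<kappa>_above_contact[of n] by linarith
  qed
  show "n \<le> slope (contact n)"
  proof (rule ccontr)
    assume h: "\<not> n \<le> slope (contact n)"
    then obtain m where m: "n = Suc m" by (cases n) auto
    have "contact n \<le> \<kappa> m" using slope(2)[of "contact n" m] h m by simp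
    then show False using \<kappa>_below_contact[of m] m by simp
  qed
qed

text \<open>
  The sum of \<open>2(k+1) log\<^sup>+ (x/\<kappa>\<^sub>k)\<close> over all circles, that is, the integral of n(t)/t in Jensen's formula, divided by J.
\<close>

definition height :: "real \<Rightarrow> real" where
  "height x = real (slope x) * (real (slope x) + 1) * ln x - intercept (slope x)"

lemma prod_max_eq:
  assumes x: "x > 0" and n: "n \<ge> slope x"
  shows "(\<Prod>k<n. max 1 (x / \<kappa> k) ^ ring_size J k) = exp (real J * height x)"
proof -
  have "(\<Prod>k<n. max 1 (x / \<kappa> k) ^ ring_size J k) = (\<Prod>k<slope x. max 1 (x / \<kappa> k) ^ ring_size J k)"
  proof (rule prod.mono_neutral_right)
    show "\<forall>k\<in>{..<n} - {..<slope x}. max 1 (x / \<kappa> k) ^ ring_size J k = 1"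
    proof
      fix k assume "k \<in> {..<n} - {..<slope x}"
      then have "x / \<kappa> k \<le> 1" using slope(2)[of x k] by (simp add: divide_le_eq)
      then show "max 1 (x / \<kappa> k) ^ ring_size J k = 1" by (simp add: max_absorb1)
    qed
  qed (use n in auto)
  also have "\<dots> = (\<Prod>k<slope x. exp (real J * (2 * (real k + 1) * (ln x - ln (\<kappa> k)))))"
  proof (rule prod.cong[OF refl])
    fix k assume "k \<in> {..<slope x}"
    then have "\<kappa> k < x" using slope(1) by simp
    then have "max 1 (x / \<kappa> k) = x / \<kappa> k" by (simp add: max_def le_divide_eq)
    also have "\<dots> = exp (ln x - ln (\<kappa> k))" using x by (simp add: exp_diff)
    finally have "max 1 (x / \<kappa> k) ^ ring_size J k = exp (real (ring_size J k) * (ln x - ln (\<kappa> k)))"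
      by (simp only: exp_of_nat_mult)
    also have "real (ring_size J k) * (ln x - ln (\<kappa> k)) = real J * (2 * (real k + 1) * (ln x - ln (\<kappa> k)))"
      by (simp add: ring_size_def algebra_simps)
    finally show "max 1 (x / \<kappa> k) ^ ring_size J k = exp (real J * (2 * (real k + 1) * (ln x - ln (\<kappa> k))))" .
  qed
  also have "\<dots> = exp (\<Sum>k<slope x. real J * (2 * (real k + 1) * (ln x - ln (\<kappa> k))))"
    by (rule exp_sum[symmetric]) simp
  also have "(\<Sum>k<slope x. real J * (2 * (real k + 1) * (ln x - ln (\<kappa> k)))) = real J * height x"
    unfolding height_def sum_ln_\<kappa>[symmetric] by (rule sum_distrib_left[symmetric])
  finally show ?thesis .
qed

definition \<xi> :: "nat \<Rightarrow> complex \<Rightarrow> complex" where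
  "\<xi> k z = (if cmod z \<le> ring_radius J k then z / of_real (ring_radius J k) else of_real (ring_radius J k) / z)"

text \<open>
  Outside its circle, a factor is evaluated at the reciprocal of \<open>z/r\<^sub>k\<close>. The power of x/\<open>\<kappa>\<^sub>k\<close> that this produces is the radial growth, and the
  reciprocal does not change the angular dependence of \<open>Re \<xi>\<^sup>J\<close>.
\<close>

lemma ring_factor_via_xi:
  assumes z: "z \<noteq> 0" and x: "x = cmod z / sqrt (real J)"
  shows "cmod (\<xi> k z) = prox x k" "cmod (ring_factor k z) = max 1 (x / \<kappa> k) ^ ring_size J k * cmod (perturbed J (ring_size J k) (a k) (\<xi> k z))"
    "Re (\<xi> k z ^ J) = prox x k ^ J * Re ((z / of_real (cmod z)) ^ J)"
proof -
  have xp: "x > 0" using z sqrt_J by (simp add: x)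
  have zr: "cmod z = sqrt (real J) * x" using sqrt_J by (simp add: x)
  have s0: "sqrt (real J) \<noteq> 0" using sqrt_J by simp
  have ratio: "cmod z / ring_radius J k = x / \<kappa> k" "ring_radius J k / cmod z = \<kappa> k / x"
    unfolding zr ring_radius_def using s0 by simp_all
  have iff: "cmod z \<le> ring_radius J k \<longleftrightarrow> x \<le> \<kappa> k"
    unfolding zr ring_radius_def using sqrt_J by (simp add: mult_le_cancel_left_pos)
  have r0: "complex_of_real (ring_radius J k) \<noteq> 0" using less_imp_neq[OF ring_radius_pos[of k]] by auto
  have le: "x / \<kappa> k \<le> \<kappa> k / x" if "x \<le> \<kappa> k"
  proof -
    have "x / \<kappa> k \<le> 1" "1 \<le> \<kappa> k / x" using that xp by (simp_all add: divide_le_eq le_divide_eq)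
    then show ?thesis by linarith
  qed
  have ge: "\<kappa> k / x \<le> x / \<kappa> k" if "\<not> x \<le> \<kappa> k"
  proof -
    have "1 \<le> x / \<kappa> k" "\<kappa> k / x \<le> 1" using that xp by (simp_all add: divide_le_eq le_divide_eq)
    then show ?thesis by linarith
  qed
  show "cmod (\<xi> k z) = prox x k"
  proof (cases "x \<le> \<kappa> k")
    case True
    then show ?thesis using le ratio by (simp add: \<xi>_def iff prox_def norm_divide)
  next
    case False
    then show ?thesis using ge ratio by (simp add: \<xi>_def iff prox_def norm_divide)
  qed
  show "cmod (ring_factor k z) = max 1 (x / \<kappa> k) ^ ring_size J k * cmod (perturbed J (ring_size J k) (a k) (\<xi> k z))"
  proof (cases "x \<le> \<kappa> k")
    case True
    then have "x / \<kappa> k \<le> 1" by (simp add: divide_le_eq)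
    then have "max 1 (x / \<kappa> k) = 1" by (rule max_absorb1)
    then show ?thesis using True by (simp add: ring_factor_def \<xi>_def iff)
  next
    case False
    then have m: "max 1 (x / \<kappa> k) = cmod (z / of_real (ring_radius J k))"
      using ratio by (simp add: max_def le_divide_eq norm_divide)
    have "z / of_real (ring_radius J k) \<noteq> 0" using z r0 by simp
    from perturbed_inverse[OF this ring_size_facts(1), of k "a k"] False show ?thesis
      unfolding m by (simp add: ring_factor_def \<xi>_def iff norm_mult norm_power inverse_divide)
  qed
  let ?u = "z / of_real (cmod z)"
  have u: "cmod ?u = 1" using z by (simp add: norm_divide)
  have Re: "Re ((of_real t * w) ^ J) = t ^ J * Re (w ^ J)" for t w
    by (simp add: power_mult_distrib of_real_power[symmetric] del: of_real_power)
  show "Re (\<xi> k z ^ J) = prox x k ^ J * Re (?u ^ J)"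
  proof (cases "x \<le> \<kappa> k")
    case True
    have "\<xi> k z = of_real (cmod z / ring_radius J k) * ?u"
      using True z r0 by (simp add: \<xi>_def iff)
    then have "\<xi> k z = of_real (prox x k) * ?u" using le[OF True] ratio by (simp add: prox_def)
    then show ?thesis by (simp only: Re)
  next
    case False
    have "inverse ?u = cnj ?u"
    proof (rule inverse_unique)
      show "?u * cnj ?u = 1" using complex_norm_square[of ?u] u by simp
    qed
    have "\<xi> k z = of_real (ring_radius J k / cmod z) * inverse ?u"
      using False z r0 by (simp add: \<xi>_def iff field_simps)
    also have "inverse ?u = cnj ?u" by fact
    finally have "\<xi> k z = of_real (prox x k) * cnj ?u" using ge[OF False] ratio by (simp add: prox_def)
    moreover have "Re (cnj ?u ^ J) = Re (?u ^ J)" by (simp only: complex_cnj_power[symmetric] cnj.simps(1))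
    ultimately show ?thesis by (simp only: Re)
  qed
qed

text \<open>
  Turns a lower bound for a product of factors 1 - t into an upper bound for the sum of the t.
\<close>

lemma one_minus_ge_exp:
  fixes t \<theta> :: real assumes "0 \<le> t" "t \<le> \<theta>" "\<theta> < 1" shows "exp (- t / (1 - \<theta>)) \<le> 1 - t"
proof -
  have p: "1 - t > 0" "1 - \<theta> > 0" using assms by auto
  have "1 / (1 - t) = 1 + t / (1 - t)" using p by (simp add: field_simps)
  also have "\<dots> \<le> 1 + t / (1 - \<theta>)" using assms p by (intro add_left_mono divide_left_mono) auto
  also have "\<dots> \<le> exp (t / (1 - \<theta>))" by (rule exp_ge_add_one_self)
  finally have "1 \<le> exp (t / (1 - \<theta>)) * (1 - t)" using p by (simp add: divide_le_eq)
  then show ?thesis by (simp add: exp_minus field_simps)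
qed

lemma prox_power_N: assumes "x > 0" shows "prox x k ^ (ring_size J k - J) \<le> prox x k ^ Suc k" "prox x k ^ ring_size J k \<le> prox x k ^ Suc k"
proof -
  have "J * Suc k \<ge> 1 * Suc k" using J by (intro mult_le_mono1) simp
  moreover have "J * Suc k \<ge> J * 1" by (intro mult_le_mono2) simp
  ultimately have "Suc k \<le> ring_size J k - J" "Suc k \<le> ring_size J k" by (auto simp: ring_size_def)
  then show "prox x k ^ (ring_size J k - J) \<le> prox x k ^ Suc k" "prox x k ^ ring_size J k \<le> prox x k ^ Suc k"
    using prox_bounds[OF assms] by (auto intro!: power_decreasing simp: less_imp_le simp del: power_Suc)
qed

text \<open>
  Each factor contributes at most \<open>1 + |\<xi>|\<^sup>N\<close> beyond the radial growth, and \<open>sum_prox_power_bounded\<close> bounds the product of these.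
\<close>

theorem ring_product_upper_unperturbed:
  assumes a: "\<And>k. a k = 0"
  shows "\<exists>C. \<forall>z. z \<noteq> 0 \<longrightarrow> cmod (ring_product z) \<le> exp (real J * height (cmod z / sqrt (real J)) + C)"
proof -
  obtain C where C: "\<And>x n. x > 0 \<Longrightarrow> (\<Sum>k<n. prox x k ^ Suc k) \<le> C"
    using sum_prox_power_bounded by blast
  have "cmod (ring_product z) \<le> exp (real J * height (cmod z / sqrt (real J)) + C)" if z: "z \<noteq> 0" for z
  proof -
    define x where "x = cmod z / sqrt (real J)"
    have xp: "x > 0" using z sqrt_J by (simp add: x_def)
    note xi = ring_factor_via_xi[OF z x_def]
    have "cmod (\<Prod>k<n. ring_factor k z) \<le> exp (real J * height x + C)" if n: "n \<ge> slope x" for n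
    proof -
      have per: "cmod (perturbed J (ring_size J k) (a k) (\<xi> k z)) \<le> exp (prox x k ^ Suc k)" for k
      proof -
        have "cmod (perturbed J (ring_size J k) (a k) (\<xi> k z)) \<le> 1 + cmod (\<xi> k z) ^ ring_size J k"
          unfolding perturbed_def a using norm_triangle_ineq4[of 1 "\<xi> k z ^ ring_size J k"]
          by (simp add: norm_power)
        also have "\<dots> \<le> 1 + prox x k ^ Suc k" unfolding xi using prox_power_N(2)[OF xp, of k] by simp
        also have "\<dots> \<le> exp (prox x k ^ Suc k)" by (rule exp_ge_add_one_self)
        finally show ?thesis .
      qed
      have "cmod (\<Prod>k<n. ring_factor k z) = (\<Prod>k<n. max 1 (x / \<kappa> k) ^ ring_size J k) * (\<Prod>k<n. cmod (perturbed J (ring_size J k) (a k) (\<xi> k z)))"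
        unfolding prod_norm[symmetric] xi by (rule prod.distrib)
      also have "\<dots> \<le> exp (real J * height x) * (\<Prod>k<n. exp (prox x k ^ Suc k))"
        unfolding prod_max_eq[OF xp n] using per by (intro mult_left_mono prod_mono) auto
      also have "(\<Prod>k<n. exp (prox x k ^ Suc k)) = exp (\<Sum>k<n. prox x k ^ Suc k)" by (rule exp_sum[symmetric]) simp
      also have "exp (real J * height x) * exp (\<Sum>k<n. prox x k ^ Suc k) \<le> exp (real J * height x + C)"
        unfolding exp_add[symmetric] using C[OF xp, of n] by simp
      finally show ?thesis .
    qed
    then have "\<forall>\<^sub>F n in sequentially. cmod (\<Prod>k<n. ring_factor k z) \<le> exp (real J * height x + C)"
      by (rule eventually_mono[OF eventually_ge_at_top[of "slope x"]])
    from tendsto_upperbound[OF tendsto_norm[OF ring_product_limit] this] show ?thesis by (simp add: x_def)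
  qed
  then show ?thesis by blast
qed

text \<open>
  The amplitude of the angular oscillation of the logarithm of the modulus on the circle of normalised radius x.
\<close>

definition swing :: "real \<Rightarrow> real" where "swing x = (\<Sum>k. a k * prox x k ^ J)"

lemma summable_swing: assumes x: "x > 0" shows "summable (\<lambda>k. a k * prox x k ^ J)"
proof (rule summable_comparison_test[OF _ summable_inverse_squares[of "4 * x\<^sup>2"]], intro exI allI impI)
  fix k :: nat
  have "prox x k ^ J \<le> prox x k ^ 2" using prox_bounds[OF x, of k] J by (intro power_decreasing) auto
  also have "\<dots> \<le> (x / \<kappa> k)\<^sup>2" using prox_bounds[OF x, of k] by (intro power_mono) (auto simp: prox_def)
  also have "\<dots> \<le> (x / ((real k + 1) / 2))\<^sup>2"
    using \<kappa>_half[of k] x by (intro power_mono divide_left_mono) auto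
  also have "\<dots> = 4 * x\<^sup>2 / (real k + 1)\<^sup>2" by (simp add: power_divide power_mult_distrib)
  finally have "prox x k ^ J \<le> 4 * x\<^sup>2 / (real k + 1)\<^sup>2" .
  moreover have "a k * prox x k ^ J \<le> 1 * prox x k ^ J"
    using a_upper[of k] prox_bounds[OF x, of k] by (intro mult_right_mono) auto
  ultimately show "norm (a k * prox x k ^ J) \<le> 4 * x\<^sup>2 / (real k + 1)\<^sup>2"
    using a0[of k] prox_bounds[OF x, of k] by (simp only: real_norm_def abs_of_nonneg mult_nonneg_nonneg zero_le_power less_imp_le)
qed

text \<open>
  On the contact circles the factors \<open>1 - |\<xi>|\<^sup>N\<^sup>-\<^sup>J\<close> are bounded away from 0, so their product is harmless. The factors
  \<open>|1 - a \<xi>\<^sup>J|\<close> contribute \<open>-a Re \<xi>\<^sup>J\<close> up to \<open>2a\<^sup>2\<close>, and the squares are summable.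
\<close>

theorem ring_product_lower:
  assumes a2: "summable (\<lambda>k. (a k)\<^sup>2)"
  shows "\<exists>C. \<forall>n\<ge>1. \<forall>z. cmod z = sqrt (real J) * contact n \<longrightarrow>
     exp (real J * height (contact n) - Re ((z / of_real (cmod z)) ^ J) * swing (contact n) - C) \<le> cmod (ring_product z)"
proof -
  obtain C where C: "\<And>x n. x > 0 \<Longrightarrow> (\<Sum>k<n. prox x k ^ Suc k) \<le> C"
    using sum_prox_power_bounded by blast
  \<comment> \<open>on the contact circles, no power of prox with exponent k + 1 exceeds this number\<close>
  define \<theta> :: real where "\<theta> = exp (-1/16)"
  have \<theta>: "\<theta> < 1" by (simp add: \<theta>_def)
  define C' where "C' = C / (1 - \<theta>) + 2 * (\<Sum>k. (a k)\<^sup>2)"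
  have "exp (real J * height (contact n) - Re ((z / of_real (cmod z)) ^ J) * swing (contact n) - C') \<le> cmod (ring_product z)"
    if n: "n \<ge> 1" and z: "cmod z = sqrt (real J) * contact n" for n z
  proof -
    define x where "x = contact n"
    define c where "c = Re ((z / of_real (cmod z)) ^ J)"
    have xp: "x > 0" using contact_bounds(1)[of n] n by (simp add: x_def)
    have z0: "z \<noteq> 0" using z xp sqrt_J by (auto simp: x_def)
    have xz: "x = cmod z / sqrt (real J)" using z sqrt_J by (simp add: x_def)
    note xi = ring_factor_via_xi[OF z0 xz]
    have per: "exp (- c * (a k * prox x k ^ J) - 2 * (a k)\<^sup>2 - prox x k ^ Suc k / (1 - \<theta>)) \<le> cmod (perturbed J (ring_size J k) (a k) (\<xi> k z))" for k
    proof -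
      have xi1: "cmod (\<xi> k z) \<le> 1" unfolding xi using prox_bounds[OF xp] by simp
      have "exp (- a k * Re (\<xi> k z ^ J) - 2 * (a k)\<^sup>2) \<le> cmod (1 - of_real (a k) * \<xi> k z ^ J)"
        using xi1 a0[of k] a_upper[of k] by (intro norm_1_minus_ge_exp) (auto simp: norm_power power_le_one)
      moreover have "exp (- (prox x k ^ Suc k) / (1 - \<theta>)) \<le> 1 - prox x k ^ Suc k"
        using prox_bounds[OF xp, of k] prox_power_contact[OF n, of k] \<theta>
        by (intro one_minus_ge_exp) (auto simp: \<theta>_def x_def simp del: power_Suc)
      moreover have "1 - prox x k ^ Suc k \<le> 1 - cmod (\<xi> k z) ^ (ring_size J k - J)"
        unfolding xi using prox_power_N(1)[OF xp, of k] by linarith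
      ultimately have "exp (- a k * Re (\<xi> k z ^ J) - 2 * (a k)\<^sup>2) * exp (- (prox x k ^ Suc k) / (1 - \<theta>))
        \<le> cmod (1 - of_real (a k) * \<xi> k z ^ J) * (1 - cmod (\<xi> k z) ^ (ring_size J k - J))"
        by (intro mult_mono) (auto intro: order_trans)
      also have "\<dots> \<le> cmod (perturbed J (ring_size J k) (a k) (\<xi> k z))"
        by (rule perturbed_lower[OF xi1 a0 a_upper(1) ring_size_facts(1)])
      finally show ?thesis unfolding exp_add[symmetric] xi c_def[symmetric] by (simp add: algebra_simps del: power_Suc)
    qed
    let ?L = "\<lambda>m. real J * height x + (\<Sum>k<m. - c * (a k * prox x k ^ J) - 2 * (a k)\<^sup>2 - prox x k ^ Suc k / (1 - \<theta>))"
    have bd: "exp (real J * height x - c * (\<Sum>k<m. a k * prox x k ^ J) - C') \<le> cmod (\<Prod>k<m. ring_factor k z)" if m: "m \<ge> slope x" for m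
    proof -
      have "exp (?L m) = exp (real J * height x) * (\<Prod>k<m. exp (- c * (a k * prox x k ^ J) - 2 * (a k)\<^sup>2 - prox x k ^ Suc k / (1 - \<theta>)))"
        by (simp only: exp_add exp_sum[OF finite_lessThan])
      also have "\<dots> \<le> exp (real J * height x) * (\<Prod>k<m. cmod (perturbed J (ring_size J k) (a k) (\<xi> k z)))"
        using per by (intro mult_left_mono prod_mono) auto
      also have "\<dots> = cmod (\<Prod>k<m. ring_factor k z)"
        unfolding prod_norm[symmetric] xi prod_max_eq[OF xp m, symmetric] by (rule prod.distrib[symmetric])
      finally have 1: "exp (?L m) \<le> cmod (\<Prod>k<m. ring_factor k z)" .
      have "(\<Sum>k<m. - c * (a k * prox x k ^ J) - 2 * (a k)\<^sup>2 - prox x k ^ Suc k / (1 - \<theta>))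
        = - c * (\<Sum>k<m. a k * prox x k ^ J) - 2 * (\<Sum>k<m. (a k)\<^sup>2) - (\<Sum>k<m. prox x k ^ Suc k) / (1 - \<theta>)"
        by (simp only: sum_subtractf sum_distrib_left sum_divide_distrib)
      moreover have "(\<Sum>k<m. (a k)\<^sup>2) \<le> (\<Sum>k. (a k)\<^sup>2)" using a2 by (intro sum_le_suminf) auto
      moreover have "(\<Sum>k<m. prox x k ^ Suc k) / (1 - \<theta>) \<le> C / (1 - \<theta>)"
        using C[OF xp] \<theta> by (intro divide_right_mono) auto
      ultimately have "real J * height x - c * (\<Sum>k<m. a k * prox x k ^ J) - C' \<le> ?L m"
        unfolding C'_def by (simp only:)
      then show ?thesis using 1 by (meson exp_le_cancel_iff order_trans)
    qed
    have "(\<lambda>m. \<Sum>k<m. a k * prox x k ^ J) \<longlonglongrightarrow> swing x"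
      unfolding swing_def using summable_LIMSEQ[OF summable_swing[OF xp]] .
    then have "(\<lambda>m. exp (real J * height x - c * (\<Sum>k<m. a k * prox x k ^ J) - C')) \<longlonglongrightarrow> exp (real J * height x - c * swing x - C')"
      by (intro tendsto_intros)
    moreover have "\<forall>\<^sub>F m in sequentially. exp (real J * height x - c * (\<Sum>k<m. a k * prox x k ^ J) - C') \<le> cmod (\<Prod>k<m. ring_factor k z)"
      using eventually_ge_at_top[of "slope x"] by eventually_elim (rule bd)
    ultimately have "exp (real J * height x - c * swing x - C') \<le> cmod (ring_product z)"
      by (intro tendsto_le[OF _ tendsto_norm[OF ring_product_limit]]) auto
    then show ?thesis by (simp add: x_def c_def)
  qed
  then show ?thesis by blast
qed

lemma height_upper: assumes "x \<ge> 2" shows "height x \<le> x\<^sup>2 / 2 - (ln (x / 2))\<^sup>2 / 10"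
proof -
  have "x \<le> \<kappa> (slope x)" by (rule slope(2)) simp
  also have "\<dots> \<le> 9/8 * (real (slope x) + 1)" by (rule \<kappa>_le)
  finally have "x / 2 \<le> real (slope x) + 1" by simp
  then have "ln (x / 2) \<le> ln (real (slope x) + 1)" using assms by (subst ln_le_cancel_iff) auto
  moreover have "0 \<le> ln (x / 2)" using assms by simp
  ultimately have "(ln (x / 2))\<^sup>2 \<le> (ln (real (slope x) + 1))\<^sup>2" by (intro power_mono)
  then show ?thesis unfolding height_def using tangent_line_le[of x "slope x"] assms by linarith
qed

lemma height_contact: "height (contact n) = (contact n)\<^sup>2 / 2 - (ln (real n + 1))\<^sup>2 / 10"
  unfolding height_def slope_contact by (rule tangent_line_at_contact)

end

section \<open>Entire functions that are small in sectors\<close>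

text \<open>
  The maximum principle for \<open>h(z)/(z - z0)\<^sup>p\<close>. The free exponent p trades the two boundary values against each other,
  as in Hadamard's three circles theorem.
\<close>

lemma two_constants_annulus:
  assumes h: "h holomorphic_on UNIV" and r: "0 < r" "r \<le> R"
    and inner: "\<And>z. cmod (z - z0) = r \<Longrightarrow> cmod (h z) \<le> \<epsilon>"
    and outer: "\<And>z. cmod (z - z0) = R \<Longrightarrow> cmod (h z) \<le> M"
    and w: "r \<le> cmod (w - z0)" "cmod (w - z0) \<le> R" and pos: "0 \<le> \<epsilon>" "0 \<le> M"
  shows "cmod (h w) \<le> \<epsilon> * (cmod (w - z0) / r) ^ p + M * (cmod (w - z0) / R) ^ p"
proof -
  define S where "S = cball z0 R - ball z0 r"
  define B where "B = \<epsilon> / r ^ p + M / R ^ p"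
  have Rp: "R > 0" using r by simp
  have nz: "z - z0 \<noteq> 0" if "z \<in> S" for z using that r by (auto simp: S_def dist_norm)
  have clS: "closed S" unfolding S_def by (intro closed_Diff) auto
  have hol: "(\<lambda>z. h z / (z - z0) ^ p) holomorphic_on S"
    using nz by (intro holomorphic_intros holomorphic_on_subset[OF h]) auto
  have "cmod (h w / (w - z0) ^ p) \<le> B"
  proof (rule maximum_modulus_frontier[where f = "\<lambda>z. h z / (z - z0) ^ p" and S = S and \<xi> = w])
    show "(\<lambda>z. h z / (z - z0) ^ p) holomorphic_on interior S"
      using hol interior_subset by (rule holomorphic_on_subset)
    show "continuous_on (closure S) (\<lambda>z. h z / (z - z0) ^ p)"
      using holomorphic_on_imp_continuous_on[OF hol] clS by simp
    show "bounded S" unfolding S_def by (rule bounded_subset[OF bounded_cball]) auto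
    show "w \<in> S" using w by (auto simp: S_def dist_norm norm_minus_commute)
    fix z assume z: "z \<in> frontier S"
    have zS: "z \<in> S" using z clS frontier_subset_closed by blast
    have "ball z0 R - cball z0 r \<subseteq> S" by (auto simp: S_def)
    moreover have "open (ball z0 R - cball z0 r)" by (intro open_Diff) auto
    ultimately have "ball z0 R - cball z0 r \<subseteq> interior S" by (simp add: interior_maximal)
    then have "z \<notin> ball z0 R - cball z0 r" using z by (auto simp: frontier_def)
    then consider "cmod (z - z0) = R" | "cmod (z - z0) = r"
      using zS by (auto simp: S_def dist_norm norm_minus_commute)
    then show "cmod (h z / (z - z0) ^ p) \<le> B"
    proof cases
      case 1
      have "cmod (h z / (z - z0) ^ p) = cmod (h z) / R ^ p" by (simp add: norm_divide norm_power 1)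
      also have "\<dots> \<le> M / R ^ p" using outer[OF 1] Rp by (intro divide_right_mono) auto
      also have "\<dots> \<le> B" using pos r by (simp add: B_def)
      finally show ?thesis .
    next
      case 2
      have "cmod (h z / (z - z0) ^ p) = cmod (h z) / r ^ p" by (simp add: norm_divide norm_power 2)
      also have "\<dots> \<le> \<epsilon> / r ^ p" using inner[OF 2] r by (intro divide_right_mono) auto
      also have "\<dots> \<le> B" using pos Rp by (simp add: B_def)
      finally show ?thesis .
    qed
  qed
  moreover have wp: "cmod (w - z0) > 0" using w r by linarith
  ultimately have "cmod (h w) \<le> B * cmod (w - z0) ^ p"
    by (simp add: norm_divide norm_power pos_divide_le_eq)
  also have "\<dots> = \<epsilon> * (cmod (w - z0) / r) ^ p + M * (cmod (w - z0) / R) ^ p"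
    by (simp add: B_def power_divide distrib_right)
  finally show ?thesis .
qed

lemma exp_neg_square_ln_tendsto_0:
  fixes \<alpha> \<beta> :: real
  shows "(\<lambda>n. exp (- (ln (real n + 1))\<^sup>2 + \<alpha> * ln (real n + 1) + \<beta>)) \<longlonglongrightarrow> 0"
proof (rule tendsto_sandwich[OF _ _ tendsto_const])
  have lim: "filterlim (\<lambda>n. ln (real n + 1)) at_top sequentially" by real_asymp
  have "\<forall>\<^sub>F n in sequentially. \<alpha> + 1 \<le> ln (real n + 1)"
    using lim by (simp add: filterlim_at_top)
  moreover have "\<forall>\<^sub>F n in sequentially. 0 \<le> ln (real n + 1)" by (intro always_eventually) simp
  ultimately show "\<forall>\<^sub>F n in sequentially. exp (- (ln (real n + 1))\<^sup>2 + \<alpha> * ln (real n + 1) + \<beta>) \<le> exp (\<beta> - ln (real n + 1))"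
  proof eventually_elim
    case (elim n)
    have "(\<alpha> + 1) * ln (real n + 1) \<le> ln (real n + 1) * ln (real n + 1)" using elim by (intro mult_right_mono)
    then show ?case by (simp add: power2_eq_square algebra_simps)
  qed
  show "(\<lambda>n. exp (\<beta> - ln (real n + 1))) \<longlonglongrightarrow> 0" by real_asymp
qed (auto intro: always_eventually)

text \<open>
  The right-hand side is the modulus of the exponential of a polynomial, so the bound extends from the circle into the disc.
\<close>

lemma sector_bound_inside:
  assumes h: "h holomorphic_on UNIV" and \<rho>: "\<rho> > 0"
    and circ: "\<And>z. cmod z = \<rho> \<Longrightarrow> cmod (h z) \<le> exp (P + W * Re ((z / of_real (cmod z)) ^ J))"
    and z: "cmod z \<le> \<rho>"
  shows "cmod (h z) \<le> exp (P + W * Re ((z / of_real \<rho>) ^ J))"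
proof -
  define F where "F z = h z * exp (- of_real W * (z / of_real \<rho>) ^ J)" for z
  have r0: "complex_of_real \<rho> \<noteq> 0" using \<rho> by simp
  have hol: "F holomorphic_on A" for A
    unfolding F_def[abs_def] using r0 by (intro holomorphic_intros holomorphic_on_subset[OF h]) auto
  have nF: "cmod (F z) = cmod (h z) * exp (- W * Re ((z / of_real \<rho>) ^ J))" for z
    by (simp add: F_def norm_mult)
  have "cmod (F z) \<le> exp P"
  proof (rule maximum_modulus_frontier[where f = F and S = "cball 0 \<rho>" and \<xi> = z])
    show "F holomorphic_on interior (cball 0 \<rho>)" by (rule hol)
    show "continuous_on (closure (cball 0 \<rho>)) F" by (rule holomorphic_on_imp_continuous_on[OF hol])
    show "bounded (cball (0::complex) \<rho>)" by simp
    show "z \<in> cball 0 \<rho>" using z by simp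
    fix w :: complex assume "w \<in> frontier (cball 0 \<rho>)"
    then have w: "cmod w = \<rho>" using \<rho> by (simp add: frontier_cball)
    have "cmod (F w) \<le> exp (P + W * Re ((w / of_real \<rho>) ^ J)) * exp (- W * Re ((w / of_real \<rho>) ^ J))"
      unfolding nF using circ[OF w] w by (intro mult_right_mono) auto
    also have "\<dots> = exp P" by (simp add: exp_add[symmetric])
    finally show "cmod (F w) \<le> exp P" .
  qed
  then have "cmod (F z) * exp (W * Re ((z / of_real \<rho>) ^ J)) \<le> exp P * exp (W * Re ((z / of_real \<rho>) ^ J))"
    by (intro mult_right_mono) auto
  moreover have "cmod (F z) * exp (W * Re ((z / of_real \<rho>) ^ J)) = cmod (h z)"
    by (simp add: nF mult.assoc exp_add[symmetric])
  ultimately show ?thesis by (simp add: exp_add)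
qed

text \<open>
  Write l = ln (n + 1) and \<open>\<rho>\<close> for the radius of the n-th circle. Around a point of modulus \<open>3\<rho>/4\<close> in the middle of
  a sector where \<open>Re z\<^sup>J\<close> is negative, h is at most \<open>exp(-l\<^sup>2 + O(l))\<close> in a disc of radius proportional to \<open>\<rho>\<close>. On the circle number \<open>n\<^sup>2\<close>, of
  radius about \<open>\<rho>\<^sup>2\<close>, it is at most \<open>exp(O(l\<^sup>2))\<close>. A fixed point w lies in between, at a distance of order \<open>\<rho>\<close>, so an exponent p of order l in
  \<open>two_constants_annulus\<close> costs only \<open>exp(O(l))\<close> on the small side and gains \<open>exp(-pl/2)\<close> on the large side.
\<close>

theorem entire_vanishes_by_sector_decay:
  fixes h :: "complex \<Rightarrow> complex" and J :: nat and W :: "nat \<Rightarrow> real"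
  assumes h: "h holomorphic_on UNIV" and J: "J \<ge> 1"
    and circ: "\<And>n z. n \<ge> n1 \<Longrightarrow> cmod z = sqrt (real J) * contact n \<Longrightarrow>
      cmod (h z) \<le> exp (B * (ln (real n + 1))\<^sup>2 + D * ln (real n + 1) + D' + W n * Re ((z / of_real (cmod z)) ^ J))"
    and Wl: "\<And>n. n \<ge> n1 \<Longrightarrow> A * (ln (real n + 1))\<^sup>2 \<le> W n"
    and Wu: "\<And>n. n \<ge> n1 \<Longrightarrow> W n \<le> C * (ln (real n + 1))\<^sup>2"
    and BA: "B + 1 \<le> (3/4) ^ J / 2 * A" and pos: "0 \<le> B" "0 \<le> C" "0 \<le> D" "0 \<le> A"
  shows "h = (\<lambda>z. 0)"
proof
  fix w :: complex
  \<comment> \<open>centre line of a sector: the J-th power is minus (3/4)^J\<close>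
  define \<zeta> where "\<zeta> = of_real (3/4) * cis (pi / real J)"
  define \<mu> :: real where "\<mu> = (3/4) ^ J / 2"
  have \<mu>: "\<mu> > 0" by (simp add: \<mu>_def)
  have \<zeta>J: "\<zeta> ^ J = - of_real ((3/4) ^ J)"
    using J by (simp add: \<zeta>_def power_mult_distrib Complex.DeMoivre power_divide)
  have n\<zeta>: "cmod \<zeta> = 3/4" by (simp add: \<zeta>_def norm_mult)
  obtain \<delta>0 where \<delta>0: "\<delta>0 > 0" "\<And>v. cmod (v - \<zeta>) < \<delta>0 \<Longrightarrow> cmod (v ^ J - \<zeta> ^ J) < \<mu>"
  proof -
    have "isCont (\<lambda>v. v ^ J) \<zeta>" by (intro continuous_intros)
    then show ?thesis using that \<mu> unfolding continuous_at_eps_delta dist_norm by metis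
  qed
  define \<delta> where "\<delta> = min (\<delta>0 / 2) (1/8)"
  have \<delta>: "0 < \<delta>" "\<delta> < \<delta>0" "\<delta> \<le> 1/8" using \<delta>0 by (auto simp: \<delta>_def)
  have neg: "Re (v ^ J) \<le> - \<mu>" if "cmod (v - \<zeta>) \<le> \<delta>" for v
  proof -
    have "cmod (v ^ J - \<zeta> ^ J) < \<mu>" using \<delta>0(2)[of v] that \<delta> by simp
    then have "Re (v ^ J - \<zeta> ^ J) < \<mu>" using complex_Re_le_cmod[of "v ^ J - \<zeta> ^ J"] by linarith
    then show ?thesis unfolding \<zeta>J by (simp add: \<mu>_def)
  qed
  \<comment> \<open>half of it exceeds the growth exponent 4 (B + C) on the outer circle by 1\<close>
  define K0 where "K0 = 2 * (4 * (B + C) + 1)"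
  have K0: "K0 > 0" using pos by (simp add: K0_def)
  define l where "l n = ln (real n + 1)" for n
  define \<rho> where "\<rho> n = sqrt (real J) * contact n" for n
  define \<alpha>1 where "\<alpha>1 = D + K0 * ln (1 / \<delta>)"
  define \<beta>1 where "\<beta>1 = D' + ln (1 / \<delta>)"
  have l0: "l n \<ge> 0" for n by (simp add: l_def)
  have sJ: "sqrt (real J) \<ge> 1" using J by simp
  have \<rho>n: "real n \<le> \<rho> n" for n
  proof -
    have "1 * real n \<le> \<rho> n" unfolding \<rho>_def using sJ contact_bounds(1)[of n] by (intro mult_mono) auto
    then show ?thesis by simp
  qed
  have main: "cmod (h w) \<le> exp (- (l n)\<^sup>2 + \<alpha>1 * l n + \<beta>1) + exp (- (l n)\<^sup>2 + 2 * D * l n + D')"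
    if n: "n \<ge> n1" "n \<ge> 32" "real n \<ge> 8 * cmod w" for n
  proof -
    \<comment> \<open>index of the outer circle: squaring the index roughly squares the radius but only doubles its logarithm\<close>
    define N where "N = n * n"
    have Nn1: "N \<ge> n1" "N \<ge> n" unfolding N_def using n le_square[of n] by linarith+
    have np: "0 < real n" "0 < real N" using n(2) by (simp_all add: N_def)
    have \<rho>p: "\<rho> n > 0" "\<rho> N > 0" by (rule less_le_trans[OF np(1) \<rho>n], rule less_le_trans[OF np(2) \<rho>n])
    have inside: "cmod (h z) \<le> exp (B * (l m)\<^sup>2 + D * l m + D' + W m * Re ((z / of_real (\<rho> m)) ^ J))"
      if m: "m \<ge> n1" "cmod z \<le> \<rho> m" "\<rho> m > 0" for m z
    proof (rule sector_bound_inside[OF h m(3) _ m(2)])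
      fix v :: complex assume "cmod v = \<rho> m"
      then have "cmod v = sqrt (real J) * contact m" by (simp only: \<rho>_def)
      from circ[OF m(1) this] show "cmod (h v) \<le> exp (B * (l m)\<^sup>2 + D * l m + D' + W m * Re ((v / of_real (cmod v)) ^ J))"
        by (simp only: l_def)
    qed
    have ratio: "\<rho> n / (\<rho> N / 2) \<le> exp (- l n / 2)"
    proof -
      have "\<rho> n / (\<rho> N / 2) = 2 * (contact n / contact N)" using sJ by (simp add: \<rho>_def)
      also have "\<dots> \<le> 2 * ((real n + 1) / real N)"
        using contact_bounds[of n] contact_bounds(1)[of N] n Nn1 by (intro mult_left_mono frac_le) auto
      also have "\<dots> \<le> 4 / real n" using n by (simp add: N_def field_simps)
      also have "\<dots> \<le> 1 / sqrt (real n + 1)"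
      proof -
        have "sqrt (real n + 1) \<le> real n / 4"
        proof (rule real_le_lsqrt)
          have "32 * real n \<le> real n * real n" using n by (intro mult_right_mono) auto
          moreover have "real n \<ge> 32" using n by simp
          moreover have "(real n / 4)\<^sup>2 = real n * real n / 16" by (simp add: power2_eq_square)
          ultimately show "real n + 1 \<le> (real n / 4)\<^sup>2" by linarith
        qed (use n in auto)
        then show ?thesis using n by (simp add: field_simps)
      qed
      also have "1 / sqrt (real n + 1) = exp (- l n / 2)"
      proof -
        have "sqrt (real n + 1) = exp (ln (sqrt (real n + 1)))" by simp
        also have "\<dots> = exp (l n / 2)" by (simp add: ln_sqrt l_def)
        finally show ?thesis by (simp add: exp_minus inverse_eq_divide)
      qed
      finally show ?thesis .
    qed
    have half: "\<rho> n \<le> \<rho> N / 2"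
    proof -
      have "exp (- l n / 2) \<le> 1" using l0[of n] by simp
      then have "\<rho> n / (\<rho> N / 2) \<le> 1" using ratio by linarith
      then show ?thesis using \<rho>p by (simp add: divide_le_eq)
    qed
    define z0 where "z0 = of_real (\<rho> n) * \<zeta>"
    have nz0: "cmod z0 = 3/4 * \<rho> n" using \<rho>p by (simp add: z0_def norm_mult n\<zeta>)
    define \<epsilon> where "\<epsilon> = exp (- (l n)\<^sup>2 + D * l n + D')"
    define M where "M = exp (4 * (B + C) * (l n)\<^sup>2 + 2 * D * l n + D')"
    have inner: "cmod (h z) \<le> \<epsilon>" if z: "cmod (z - z0) = \<delta> * \<rho> n" for z
    proof -
      have v: "cmod (z / of_real (\<rho> n) - \<zeta>) = \<delta>"
      proof -
        have "z / of_real (\<rho> n) - \<zeta> = (z - z0) / of_real (\<rho> n)" using \<rho>p by (simp add: z0_def field_simps)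
        then show ?thesis using z \<rho>p by (simp add: norm_divide)
      qed
      have "cmod z \<le> cmod z0 + \<delta> * \<rho> n" using z norm_triangle_ineq[of z0 "z - z0"] by simp
      also have "\<dots> \<le> 3/4 * \<rho> n + 1/8 * \<rho> n" unfolding nz0 using \<delta> \<rho>p by (intro add_left_mono mult_right_mono) auto
      also have "\<dots> \<le> \<rho> n" using \<rho>p by simp
      finally have zr: "cmod z \<le> \<rho> n" .
      have Wn: "0 \<le> W n" by (rule order_trans[OF _ Wl[OF n(1)]]) (use pos in simp)
      have "W n * Re ((z / of_real (\<rho> n)) ^ J) \<le> W n * (- \<mu>)"
        using neg[of "z / of_real (\<rho> n)"] v Wn by (intro mult_left_mono) auto
      also have "\<dots> \<le> A * (l n)\<^sup>2 * (- \<mu>)"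
        using Wl[OF n(1)] \<mu> unfolding l_def by (intro mult_right_mono_neg) auto
      also have "\<dots> = - (\<mu> * A) * (l n)\<^sup>2" by simp
      also have "\<dots> \<le> - (B + 1) * (l n)\<^sup>2" using BA unfolding \<mu>_def[symmetric] by (intro mult_right_mono) auto
      finally have "B * (l n)\<^sup>2 + D * l n + D' + W n * Re ((z / of_real (\<rho> n)) ^ J) \<le> - (l n)\<^sup>2 + D * l n + D'"
        by (simp add: algebra_simps)
      then show ?thesis unfolding \<epsilon>_def using inside[OF n(1) zr \<rho>p(1)] by (meson exp_le_cancel_iff order_trans)
    qed
    have lN: "l N \<le> 2 * l n"
    proof -
      have "real N + 1 \<le> (real n + 1)\<^sup>2" by (simp add: N_def power2_eq_square algebra_simps)
      then have "l N \<le> ln ((real n + 1)\<^sup>2)" unfolding l_def by (subst ln_le_cancel_iff) (auto simp: add_pos_nonneg)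
      then show ?thesis by (simp add: l_def ln_realpow)
    qed
    have outer: "cmod (h z) \<le> M" if z: "cmod (z - z0) = \<rho> N / 2" for z
    proof -
      have "cmod z \<le> cmod z0 + \<rho> N / 2" using z norm_triangle_ineq[of z0 "z - z0"] by simp
      also have "\<dots> \<le> \<rho> N" using half \<rho>p nz0 by linarith
      finally have zr: "cmod z \<le> \<rho> N" .
      have "cmod ((z / of_real (\<rho> N)) ^ J) \<le> 1"
        using zr \<rho>p by (simp add: norm_power norm_divide power_le_one divide_le_eq)
      then have "Re ((z / of_real (\<rho> N)) ^ J) \<le> 1" using complex_Re_le_cmod order_trans by blast
      moreover have "0 \<le> W N" by (rule order_trans[OF _ Wl[OF Nn1(1)]]) (use pos in simp)
      ultimately have "W N * Re ((z / of_real (\<rho> N)) ^ J) \<le> W N" using mult_left_mono[of _ 1 "W N"] by simp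
      also have "\<dots> \<le> C * (l N)\<^sup>2" using Wu[OF Nn1(1)] by (simp add: l_def)
      finally have "B * (l N)\<^sup>2 + D * l N + D' + W N * Re ((z / of_real (\<rho> N)) ^ J) \<le> (B + C) * (l N)\<^sup>2 + D * l N + D'"
        by (simp add: algebra_simps)
      also have "\<dots> \<le> (B + C) * (2 * l n)\<^sup>2 + D * (2 * l n) + D'"
        using lN l0[of N] pos by (intro add_mono mult_left_mono power_mono) auto
      also have "\<dots> = 4 * (B + C) * (l n)\<^sup>2 + 2 * D * l n + D'" by (simp add: power_mult_distrib)
      finally show ?thesis unfolding M_def using inside[OF Nn1(1) zr \<rho>p(2)] by (meson exp_le_cancel_iff order_trans)
    qed
    have w8: "cmod w \<le> \<rho> n / 8" using n \<rho>n[of n] by simp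
    have wz: "\<delta> * \<rho> n \<le> cmod (w - z0)" "cmod (w - z0) \<le> \<rho> n"
    proof -
      have "\<delta> * \<rho> n \<le> 1/8 * \<rho> n" using \<delta> \<rho>p by (intro mult_right_mono) auto
      moreover have "cmod z0 - cmod w \<le> cmod (w - z0)"
        using norm_triangle_ineq2[of z0 w] by (simp add: norm_minus_commute)
      ultimately show "\<delta> * \<rho> n \<le> cmod (w - z0)" using w8 nz0 \<rho>p(1) by linarith
      show "cmod (w - z0) \<le> \<rho> n" using norm_triangle_ineq4[of w z0] w8 nz0 \<rho>p by simp
    qed
    define p where "p = nat \<lceil>K0 * l n\<rceil>"
    have p: "K0 * l n \<le> real p" "real p \<le> K0 * l n + 1"
    proof -
      have "0 \<le> K0 * l n" using K0 l0[of n] by simp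
      then have "real p = of_int \<lceil>K0 * l n\<rceil>" by (simp add: p_def)
      then show "K0 * l n \<le> real p" "real p \<le> K0 * l n + 1"
        using ceiling_correct[of "K0 * l n"] by linarith+
    qed
    have "cmod (h w) \<le> \<epsilon> * (cmod (w - z0) / (\<delta> * \<rho> n)) ^ p + M * (cmod (w - z0) / (\<rho> N / 2)) ^ p"
    proof (rule two_constants_annulus[OF h _ _ inner outer])
      show "0 < \<delta> * \<rho> n" using \<delta> \<rho>p by simp
      show "\<delta> * \<rho> n \<le> \<rho> N / 2" using wz half by linarith
      show "cmod (w - z0) \<le> \<rho> N / 2" using wz half by linarith
    qed (use wz in \<open>auto simp: \<epsilon>_def M_def\<close>)
    also have "\<epsilon> * (cmod (w - z0) / (\<delta> * \<rho> n)) ^ p \<le> exp (- (l n)\<^sup>2 + \<alpha>1 * l n + \<beta>1)"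
    proof -
      have "cmod (w - z0) / (\<delta> * \<rho> n) \<le> \<rho> n / (\<delta> * \<rho> n)" using wz \<delta> \<rho>p by (intro divide_right_mono) auto
      also have "\<dots> = exp (ln (1 / \<delta>))" using \<delta> \<rho>p by simp
      finally have "(cmod (w - z0) / (\<delta> * \<rho> n)) ^ p \<le> exp (ln (1 / \<delta>)) ^ p" using \<delta> \<rho>p by (intro power_mono) auto
      also have "\<dots> = exp (real p * ln (1 / \<delta>))" by (simp only: exp_of_nat_mult)
      also have "\<dots> \<le> exp ((K0 * l n + 1) * ln (1 / \<delta>))"
      proof -
        have "0 \<le> ln (1 / \<delta>)" using \<delta> by (intro ln_ge_zero) (simp add: le_divide_eq)
        then show ?thesis using p(2) by (simp only: exp_le_cancel_iff mult_right_mono)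
      qed
      finally have "\<epsilon> * (cmod (w - z0) / (\<delta> * \<rho> n)) ^ p \<le> \<epsilon> * exp ((K0 * l n + 1) * ln (1 / \<delta>))"
        by (intro mult_left_mono) (auto simp: \<epsilon>_def)
      also have "\<dots> = exp (- (l n)\<^sup>2 + \<alpha>1 * l n + \<beta>1)"
        unfolding \<epsilon>_def \<alpha>1_def \<beta>1_def exp_add[symmetric] by (simp add: algebra_simps)
      finally show ?thesis .
    qed
    also have "M * (cmod (w - z0) / (\<rho> N / 2)) ^ p \<le> exp (- (l n)\<^sup>2 + 2 * D * l n + D')"
    proof -
      have "cmod (w - z0) / (\<rho> N / 2) \<le> \<rho> n / (\<rho> N / 2)" using wz \<rho>p by (intro divide_right_mono) auto
      also have "\<dots> \<le> exp (- l n / 2)" by (rule ratio)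
      finally have "(cmod (w - z0) / (\<rho> N / 2)) ^ p \<le> exp (- l n / 2) ^ p" using \<rho>p by (intro power_mono) auto
      also have "\<dots> = exp (real p * (- l n / 2))" by (simp only: exp_of_nat_mult)
      also have "\<dots> \<le> exp (K0 * l n * (- l n / 2))"
        using p(1) l0[of n] by (simp only: exp_le_cancel_iff) (intro mult_right_mono_neg, auto)
      finally have "M * (cmod (w - z0) / (\<rho> N / 2)) ^ p \<le> M * exp (K0 * l n * (- l n / 2))"
        by (intro mult_left_mono) (auto simp: M_def)
      also have "\<dots> = exp (- (l n)\<^sup>2 + 2 * D * l n + D')"
        unfolding M_def K0_def exp_add[symmetric] by (simp add: algebra_simps power2_eq_square)
      finally show ?thesis .
    qed
    finally show ?thesis by simp
  qed
  \<comment> \<open>w is fixed and n arbitrary, so both terms may be sent to 0\<close>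
  have "(\<lambda>n. exp (- (l n)\<^sup>2 + \<alpha>1 * l n + \<beta>1) + exp (- (l n)\<^sup>2 + 2 * D * l n + D')) \<longlonglongrightarrow> 0 + 0"
    unfolding l_def by (intro tendsto_add exp_neg_square_ln_tendsto_0)
  moreover have "\<forall>\<^sub>F n in sequentially. cmod (h w) \<le> exp (- (l n)\<^sup>2 + \<alpha>1 * l n + \<beta>1) + exp (- (l n)\<^sup>2 + 2 * D * l n + D')"
  proof -
    have "\<forall>\<^sub>F n in sequentially. real n \<ge> 8 * cmod w"
      using filterlim_real_sequentially by (simp add: filterlim_at_top)
    then show ?thesis using eventually_ge_at_top[of n1] eventually_ge_at_top[of 32]
      by eventually_elim (rule main)
  qed
  ultimately have "cmod (h w) \<le> 0 + 0" by (intro tendsto_lowerbound) auto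
  then show "h w = 0" by simp
qed

section \<open>Zero multisets under multiplication and division\<close>

lemma entire_eventually_nonzero:
  assumes f: "f holomorphic_on UNIV" and nz: "f \<noteq> (\<lambda>z. 0)"
  shows "\<forall>\<^sub>F w in at z. f w \<noteq> (0::complex)"
proof -
  obtain b where "f b \<noteq> 0" using nz by auto
  then have "\<forall>\<^sub>F w in at z. f w \<noteq> 0 \<and> w \<in> UNIV"
    by (intro non_zero_neighbour_alt[OF f]) auto
  then show ?thesis by simp
qed

lemma entire_analytic: "f holomorphic_on UNIV \<Longrightarrow> f analytic_on {z}"
  by (meson analytic_on_holomorphic analytic_on_subset open_UNIV subset_UNIV holomorphic_on_subset)

text \<open>
  The case distinction in \<^const>\<open>zero_mset\<close> disappears for entire functions other than 0, and multiplicities become additive.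
\<close>

lemma zero_mset_eq_zorder:
  assumes f: "f holomorphic_on UNIV" and nz: "f \<noteq> (\<lambda>z. 0)"
  shows "int (zero_mset f z) = zorder f z"
proof -
  have fr: "\<exists>\<^sub>F w in at z. f w \<noteq> 0"
    by (rule eventually_frequently[OF _ entire_eventually_nonzero[OF f nz]]) simp
  note an = entire_analytic[OF f, of z]
  show ?thesis using zorder_ge_0[OF an fr] zorder_eq_0_iff[OF an fr] by (auto simp: zero_mset_def)
qed

lemma deriv_linear_factor: "deriv (\<lambda>w::complex. w - n) z = 1"
  by (rule DERIV_imp_deriv) (auto intro!: derivative_eq_intros)

lemma zorder_linear_factor: "zorder (\<lambda>w::complex. w - n) z = (if z = n then 1 else 0)"
proof (cases "z = n")
  case True
  have "zorder (\<lambda>w::complex. w - n) n = 1"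
  proof (rule zorder_zero_eqI')
    show "(\<lambda>w. w - n) analytic_on {n}" by (intro analytic_intros)
    show "(deriv ^^ nat 1) (\<lambda>w. w - n) n \<noteq> 0"
      by (simp add: deriv_linear_factor)
  qed auto
  then show ?thesis using True by simp
next
  case False
  have "zorder (\<lambda>w::complex. w - n) z = 0"
    by (rule zorder_eq_0I) (use False in \<open>auto intro!: analytic_intros\<close>)
  then show ?thesis using False by simp
qed

lemma zero_mset_linear_factor:
  assumes g: "g holomorphic_on UNIV" and nz: "g \<noteq> (\<lambda>z. 0)"
  shows "zero_mset (\<lambda>w. (w - n) * g w) z = zero_mset g z + (if z = n then 1 else 0)"
    and "(\<lambda>w. (w - n) * g w) \<noteq> (\<lambda>z. 0)" and "(\<lambda>w. (w - n) * g w) holomorphic_on UNIV"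
proof -
  show hol: "(\<lambda>w. (w - n) * g w) holomorphic_on UNIV" by (intro holomorphic_intros g)
  have ev: "\<forall>\<^sub>F w in at z. (w - n) * g w \<noteq> 0" for z
  proof -
    have "\<forall>\<^sub>F w in at z. w - n \<noteq> 0"
      by (rule entire_eventually_nonzero) (auto intro!: holomorphic_intros simp: fun_eq_iff intro: exI[of _ "n + 1"])
    then show ?thesis using entire_eventually_nonzero[OF g nz, of z] by eventually_elim simp
  qed
  show nz': "(\<lambda>w. (w - n) * g w) \<noteq> (\<lambda>z. 0)"
  proof
    assume "(\<lambda>w. (w - n) * g w) = (\<lambda>z. 0)"
    then have "\<forall>\<^sub>F w in at (0::complex). False" using ev[of 0] by (simp add: fun_eq_iff)
    then show False by simp
  qed
  have "zorder (\<lambda>w. (w - n) * g w) z = zorder (\<lambda>w. w - n) z + zorder g z"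
    by (intro zorder_times_analytic entire_analytic g ev) (intro holomorphic_intros)
  then have "int (zero_mset (\<lambda>w. (w - n) * g w) z) = int (zero_mset g z + (if z = n then 1 else 0))"
    unfolding zero_mset_eq_zorder[OF hol nz'] zorder_linear_factor of_nat_add zero_mset_eq_zorder[OF g nz] by auto
  then show "zero_mset (\<lambda>w. (w - n) * g w) z = zero_mset g z + (if z = n then 1 else 0)" by linarith
qed

text \<open>
  At a zero of g the quotient has the limit \<open>f'/g'\<close>, so the singularity is removable.
\<close>

lemma entire_quotient:
  fixes f g :: "complex \<Rightarrow> complex"
  assumes f: "f holomorphic_on UNIV" and g: "g holomorphic_on UNIV"
    and simple: "\<And>z. g z = 0 \<Longrightarrow> deriv g z \<noteq> 0" and van: "\<And>z. g z = 0 \<Longrightarrow> f z = 0"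
  shows "\<exists>h. h holomorphic_on UNIV \<and> (\<forall>z. f z = g z * h z)"
proof -
  define h where "h z = (if g z = 0 then deriv f z / deriv g z else f z / g z)" for z
  have open_nz: "open {z. g z \<noteq> 0}"
  proof -
    have "open (g -` (- {0}))"
      by (intro open_vimage holomorphic_on_imp_continuous_on[OF g]) auto
    then show ?thesis by (simp add: vimage_def)
  qed
  have h_nz: "h holomorphic_on S" if "S \<subseteq> {z. g z \<noteq> 0}" for S
  proof -
    have "(\<lambda>z. f z / g z) holomorphic_on S"
      using that by (intro holomorphic_intros holomorphic_on_subset[OF f] holomorphic_on_subset[OF g]) auto
    then show ?thesis by (rule holomorphic_transform) (use that in \<open>auto simp: h_def\<close>)
  qed
  have at_zero: "h field_differentiable at z" if z: "g z = 0" for z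
  proof -
    have gz: "(g has_field_derivative deriv g z) (at z)" and fz: "(f has_field_derivative deriv f z) (at z)"
      by (rule holomorphic_derivI[OF g] holomorphic_derivI[OF f]; simp)+
    have "g \<noteq> (\<lambda>z. 0)"
    proof
      assume "g = (\<lambda>z. 0)"
      then have "deriv g z = 0" by (simp add: DERIV_imp_deriv)
      then show False using simple[OF z] by simp
    qed
    from entire_eventually_nonzero[OF g this, of z]
    obtain r where r: "r > 0" "\<And>w. w \<noteq> z \<Longrightarrow> dist w z < r \<Longrightarrow> g w \<noteq> 0"
      unfolding eventually_at by auto
    have lim: "((\<lambda>w. f w / g w) \<longlongrightarrow> h z) (at z)"
      by (rule lhopital_complex_simple[OF fz gz van[OF z] z simple[OF z]]) (simp add: h_def z)
    have "\<forall>\<^sub>F w in at z. f w / g w = h w"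
      unfolding eventually_at by (intro exI[of _ r]) (use r in \<open>auto simp: h_def\<close>)
    then have "(h \<longlongrightarrow> h z) (at z)" by (rule Lim_transform_eventually[OF lim])
    then have ch: "isCont h z" by (simp add: isCont_def)
    have hp: "h holomorphic_on (ball z r - {z})"
      by (rule h_nz) (use r(2) in \<open>auto simp: dist_commute\<close>)
    have "continuous_on (ball z r) h"
    proof (rule continuous_at_imp_continuous_on, intro ballI)
      fix w assume w: "w \<in> ball z r"
      show "isCont h w"
      proof (cases "w = z")
        case False
        have "h field_differentiable at w"
          by (rule holomorphic_on_imp_differentiable_at[OF hp]) (use w False in auto)
        then show ?thesis by (rule field_differentiable_imp_continuous_at)
      qed (use ch in simp)
    qed
    then have "h holomorphic_on ball z r"
      using hp by (intro no_isolated_singularity[of "ball z r" h "{z}"]) auto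
    then show ?thesis by (rule holomorphic_on_imp_differentiable_at) (use r in auto)
  qed
  have "h field_differentiable at z" for z
  proof (cases "g z = 0")
    case False
    then show ?thesis
      by (intro holomorphic_on_imp_differentiable_at[OF h_nz[OF subset_refl] open_nz]) simp
  qed (rule at_zero)
  then have "h holomorphic_on UNIV" by (simp add: holomorphic_on_def field_differentiable_at_within)
  moreover have "f z = g z * h z" for z using van[of z] by (simp add: h_def)
  ultimately show ?thesis by blast
qed

definition root_poly :: "complex multiset \<Rightarrow> complex \<Rightarrow> complex" where
  "root_poly N z = (\<Prod>x\<in>#N. z - x)"

lemma root_poly_empty [simp]: "root_poly {#} = (\<lambda>z. 1)"
  by (simp add: root_poly_def fun_eq_iff)

lemma root_poly_add [simp]: "root_poly (add_mset x N) z = (z - x) * root_poly N z"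
  by (simp add: root_poly_def)

lemma root_poly_holomorphic: "root_poly N holomorphic_on A"
proof (induction N)
  case (add x N)
  have "root_poly (add_mset x N) = (\<lambda>z. (z - x) * root_poly N z)" by (simp add: fun_eq_iff)
  then show ?case using add by (auto intro!: holomorphic_intros)
qed (auto intro: holomorphic_intros)

lemma root_poly_zero_iff: "root_poly N z = 0 \<longleftrightarrow> z \<in># N"
  by (induction N) auto

lemma root_poly_upper: "\<exists>C>0. \<forall>z. cmod (root_poly N z) \<le> C * (1 + cmod z) ^ size N"
proof (induction N)
  case empty show ?case by (intro exI[of _ 1]) auto
next
  case (add x N)
  then obtain C where C: "C > 0" "\<And>z. cmod (root_poly N z) \<le> C * (1 + cmod z) ^ size N" by blast
  have "cmod (root_poly (add_mset x N) z) \<le> ((1 + cmod x) * C) * (1 + cmod z) ^ size (add_mset x N)" for z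
  proof -
    have "cmod (z - x) \<le> cmod z + cmod x" by (rule norm_triangle_ineq4)
    also have "\<dots> \<le> (1 + cmod x) * (1 + cmod z)" by (simp add: algebra_simps)
    finally have "cmod (root_poly (add_mset x N) z) \<le> ((1 + cmod x) * (1 + cmod z)) * (C * (1 + cmod z) ^ size N)"
      using C(2)[of z] by (simp add: norm_mult mult_mono)
    then show ?thesis by (simp add: mult_ac)
  qed
  moreover have "(1 + cmod x) * C > 0" using C(1) by (intro mult_pos_pos) (auto simp: add_pos_nonneg)
  ultimately show ?case by blast
qed

lemma root_poly_lower: "\<exists>R. \<forall>z. cmod z \<ge> R \<longrightarrow> 1 \<le> cmod (root_poly N z)"
proof (induction N)
  case (add x N)
  then obtain R where R: "\<And>z. cmod z \<ge> R \<Longrightarrow> 1 \<le> cmod (root_poly N z)" by blast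
  have "1 \<le> cmod (root_poly (add_mset x N) z)" if z: "cmod z \<ge> max R (1 + cmod x)" for z
  proof -
    have "1 \<le> cmod (z - x)" using norm_triangle_ineq2[of z x] z by simp
    then have "1 * 1 \<le> cmod (z - x) * cmod (root_poly N z)" using R[of z] z by (intro mult_mono) auto
    then show ?thesis by (simp add: norm_mult)
  qed
  then show ?case by blast
qed auto

lemma remove_zeros:
  assumes "g holomorphic_on UNIV" "g \<noteq> (\<lambda>z. 0)" "\<And>z. count N z \<le> zero_mset g z"
  shows "\<exists>h. h holomorphic_on UNIV \<and> h \<noteq> (\<lambda>z. 0) \<and> (\<forall>z. g z = h z * root_poly N z) \<and>
     (\<forall>z. zero_mset h z = zero_mset g z - count N z)"
  using assms
proof (induction N arbitrary: g)
  case empty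
  then show ?case by (intro exI[of _ g]) auto
next
  case (add n N)
  have "zero_mset g n > 0" using add.prems(3)[of n] by simp
  then have gn: "g n = 0" by (simp add: zero_mset_def split: if_splits)
  have lin: "(\<lambda>w::complex. w - n) holomorphic_on UNIV" by (intro holomorphic_intros)
  have "deriv (\<lambda>w::complex. w - n) z \<noteq> 0" for z by (simp add: deriv_linear_factor)
  then obtain g1 where g1: "g1 holomorphic_on UNIV" "\<And>z. g z = (z - n) * g1 z"
    using entire_quotient[OF add.prems(1) lin] gn by auto
  have g1nz: "g1 \<noteq> (\<lambda>z. 0)" using g1(2) add.prems(2) by auto
  have g_eq: "g = (\<lambda>w. (w - n) * g1 w)" using g1(2) by (simp add: fun_eq_iff)
  have zm: "zero_mset g z = zero_mset g1 z + (if z = n then 1 else 0)" for z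
    unfolding g_eq by (rule zero_mset_linear_factor(1)[OF g1(1) g1nz])
  have "count N z \<le> zero_mset g1 z" for z using add.prems(3)[of z] zm[of z] by (auto split: if_splits)
  from add.IH[OF g1(1) g1nz this] obtain h where h: "h holomorphic_on UNIV" "h \<noteq> (\<lambda>z. 0)"
    "\<And>z. g1 z = h z * root_poly N z" "\<And>z. zero_mset h z = zero_mset g1 z - count N z" by blast
  show ?case
  proof (intro exI[of _ h] conjI allI)
    show "g z = h z * root_poly (add_mset n N) z" for z by (simp add: g1(2) h(3))
    show "zero_mset h z = zero_mset g z - count (add_mset n N) z" for z by (simp add: h(4) zm)
  qed (use h in auto)
qed

lemma add_zeros:
  assumes "g holomorphic_on UNIV" "g \<noteq> (\<lambda>z. 0)"
  shows "(\<lambda>z. g z * root_poly P z) holomorphic_on UNIV \<and> (\<lambda>z. g z * root_poly P z) \<noteq> (\<lambda>z. 0) \<and>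
    (\<forall>z. zero_mset (\<lambda>z. g z * root_poly P z) z = zero_mset g z + count P z)"
proof (induction P)
  case empty show ?case using assms by simp
next
  case (add n P)
  have eq: "(\<lambda>z. g z * root_poly (add_mset n P) z) = (\<lambda>z. (z - n) * (g z * root_poly P z))"
    by (simp add: fun_eq_iff)
  have h: "(\<lambda>z. g z * root_poly P z) holomorphic_on UNIV" "(\<lambda>z. g z * root_poly P z) \<noteq> (\<lambda>z. 0)"
    and zm: "\<And>z. zero_mset (\<lambda>z. g z * root_poly P z) z = zero_mset g z + count P z"
    using add by blast+
  show ?case unfolding eq
    using zero_mset_linear_factor[OF h, of n] zm by (simp add: fun_eq_iff)
qed

section \<open>Uniqueness for the perturbed rings\<close>

text \<open>
  The parameters vanish on the first \<open>k0\<close> circles, which makes the two sets agree in a given disc and the remaining displacements small.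
  The constant c stays fixed while \<open>k0\<close> grows, so that the bound on the displacements depends on L only.
\<close>

definition amp :: "real \<Rightarrow> nat \<Rightarrow> nat \<Rightarrow> real" where
  "amp c k0 k = (if k < k0 then 0 else c * (ln (real k + 1))\<^sup>2 / (real k + 1))"

lemma amp_nonneg: "c \<ge> 0 \<Longrightarrow> 0 \<le> amp c k0 k"
  by (simp add: amp_def)

lemma amp_le: "c \<ge> 0 \<Longrightarrow> amp c k0 k \<le> c * (ln (real k + 1))\<^sup>2 / (real k + 1)"
  by (simp add: amp_def)

lemma amp_small:
  assumes "\<epsilon> > 0"
  shows "\<exists>K. \<forall>k0\<ge>K. \<forall>k. amp c k0 k \<le> \<epsilon>"
proof -
  have "(\<lambda>k. c * ((ln (real k + 1))\<^sup>2 / (real k + 1))) \<longlonglongrightarrow> c * 0"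
    by (intro tendsto_mult tendsto_const) real_asymp
  then have "\<forall>\<^sub>F k in sequentially. c * ((ln (real k + 1))\<^sup>2 / (real k + 1)) < \<epsilon>"
    using assms by (intro order_tendstoD(2)) auto
  then obtain K where "\<And>k. k \<ge> K \<Longrightarrow> c * ((ln (real k + 1))\<^sup>2 / (real k + 1)) < \<epsilon>"
    by (auto simp: eventually_sequentially)
  then show ?thesis using assms by (intro exI[of _ K]) (auto simp: amp_def less_imp_le)
qed

lemma summable_amp_square:
  assumes c: "c \<ge> 0" shows "summable (\<lambda>k. (amp c k0 k)\<^sup>2)"
proof -
  have "summable (\<lambda>k. ((ln (real k + 1))\<^sup>2 / (real k + 1))\<^sup>2)"
  proof (rule summable_comparison_test_bigo)
    show "summable (\<lambda>k. norm (real k powr (-3/2)))" by (simp add: summable_real_powr_iff)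
    show "(\<lambda>k. ((ln (real k + 1))\<^sup>2 / (real k + 1))\<^sup>2) \<in> O(\<lambda>k. real k powr (-3/2))" by real_asymp
  qed
  then have "summable (\<lambda>k. c\<^sup>2 * ((ln (real k + 1))\<^sup>2 / (real k + 1))\<^sup>2)" by (rule summable_mult)
  then show ?thesis
  proof (rule summable_comparison_test'[where N = 0])
    fix k :: nat
    have "(amp c k0 k)\<^sup>2 \<le> (c * (ln (real k + 1))\<^sup>2 / (real k + 1))\<^sup>2"
      using amp_le[OF c] amp_nonneg[OF c] by (intro power_mono)
    then show "norm ((amp c k0 k)\<^sup>2) \<le> c\<^sup>2 * ((ln (real k + 1))\<^sup>2 / (real k + 1))\<^sup>2"
      by (simp add: power_mult_distrib power_divide)
  qed
qed

lemma sum_inverse_squares_le: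
  assumes "n \<ge> 1" "n \<le> m"
  shows "(\<Sum>k=n..<m. 1 / (real k + 1)\<^sup>2) \<le> 1 / real n - 1 / real m"
  using assms(2)
proof (induction m rule: dec_induct)
  case (step m)
  have m: "real m > 0" using step assms(1) by simp
  have "1 / (real m + 1)\<^sup>2 \<le> 1 / (real m * (real m + 1))"
    using m by (intro divide_left_mono) (auto simp: power2_eq_square)
  also have "\<dots> = 1 / real m - 1 / (real m + 1)" using m by (simp add: field_simps)
  finally have "1 / (real m + 1)\<^sup>2 \<le> 1 / real m - 1 / real (Suc m)" by (simp add: add.commute)
  then show ?case using step by simp
qed simp

locale amp_config = ring_config J "amp c k0" for J c k0 +
  assumes J3: "J \<ge> 3" and cpos: "c > 0"
begin

lemma c_nonneg: "0 \<le> c" using cpos by simp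

text \<open>
  The circles from n to 2n suffice: there are n of them, each with a parameter of order \<open>ln\<^sup>2 n / n\<close> and at comparable radius.
\<close>

lemma swing_lower:
  assumes n: "n \<ge> k0" "n \<ge> 1"
  shows "c / 2 * (1/3) ^ J * (ln (real n + 1))\<^sup>2 \<le> swing (contact n)"
proof -
  let ?l = "ln (real n + 1)" and ?x = "contact n"
  have xp: "?x > 0" using contact_bounds(1)[of n] n by linarith
  have summand: "c * ?l\<^sup>2 / (2 * real n) * (1/3) ^ J \<le> amp c k0 k * prox ?x k ^ J" if k: "k \<in> {n..<2 * n}" for k
  proof (rule mult_mono)
    have "?l\<^sup>2 \<le> (ln (real k + 1))\<^sup>2" using k by (intro power_mono) auto
    then have "c * ?l\<^sup>2 / (2 * real n) \<le> c * (ln (real k + 1))\<^sup>2 / (real k + 1)"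
      using k n cpos by (intro frac_le mult_left_mono) (auto simp: less_imp_le)
    then show "c * ?l\<^sup>2 / (2 * real n) \<le> amp c k0 k" using k n by (simp add: amp_def)
    have "\<kappa> k \<le> 9/8 * (real k + 1)" by (rule \<kappa>_le)
    also have "\<dots> \<le> 9/8 * (2 * real n)" using k by (intro mult_left_mono) auto
    also have "\<dots> \<le> 3 * ?x" using contact_bounds(1)[of n] n by simp
    finally have "1/3 \<le> ?x / \<kappa> k" by (simp add: field_simps)
    moreover have "1 \<le> \<kappa> k / ?x"
      using \<kappa>_above_contact[of n] \<kappa>_mono[of n k] k xp by (simp add: le_divide_eq)
    ultimately have "1/3 \<le> ?x / \<kappa> k" "1/3 \<le> \<kappa> k / ?x" by linarith+
    then have "1/3 \<le> prox ?x k" by (simp only: prox_def min.bounded_iff)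
    then show "(1/3) ^ J \<le> prox ?x k ^ J" by (intro power_mono) auto
  qed (use c_nonneg amp_nonneg[OF c_nonneg] in auto)
  have "c / 2 * (1/3) ^ J * ?l\<^sup>2 = (\<Sum>k=n..<2*n. c * ?l\<^sup>2 / (2 * real n) * (1/3) ^ J)"
    using n by simp
  also have "\<dots> \<le> (\<Sum>k=n..<2*n. amp c k0 k * prox ?x k ^ J)" by (intro sum_mono summand)
  also have "\<dots> \<le> swing ?x"
    unfolding swing_def using a0 prox_bounds[OF xp] by (intro sum_le_suminf summable_swing[OF xp]) (auto simp: less_imp_le)
  finally show ?thesis .
qed

text \<open>
  Circles inside contribute at most \<open>a\<^sub>k \<kappa>\<^sub>k / x\<close>, of order \<open>ln\<^sup>2 n / n\<close> each. For the circles outside,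
  \<open>ln K \<le> 2 (K/m) ln m\<close> with m = n + 1 and K = k + 1 bounds the logarithm of the larger index, and \<open>J \<ge> 3\<close> leaves the
  summable decay \<open>m/K\<^sup>2\<close>.
\<close>

lemma swing_upper:
  assumes n: "n \<ge> 2"
  shows "swing (contact n) \<le> 66 * c * (ln (real n + 1))\<^sup>2"
proof -
  let ?l = "ln (real n + 1)" and ?x = "contact n"
  have xp: "?x > 0" using contact_bounds(1)[of n] n by linarith
  have l1: "?l \<ge> 1"
  proof -
    have "exp 1 \<le> real n + 1" using exp_le n by linarith
    then have "ln (exp 1) \<le> ?l" using n by (subst ln_le_cancel_iff) auto
    then show ?thesis by simp
  qed
  have qle: "prox ?x k ^ J \<le> prox ?x k ^ i" if "i \<le> J" for k i
    using prox_bounds[OF xp, of k] that by (intro power_decreasing) auto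
  have below: "amp c k0 k * prox ?x k ^ J \<le> 9/8 * c * ?l\<^sup>2 / real n" if k: "k < n" for k
  proof -
    have "prox ?x k ^ J \<le> prox ?x k ^ 1" using J3 by (intro qle) auto
    also have "\<dots> \<le> \<kappa> k / ?x" by (simp add: prox_def)
    also have "\<dots> \<le> (9/8 * (real k + 1)) / real n"
      using \<kappa>_le[of k] contact_bounds(1)[of n] n xp by (intro frac_le) auto
    finally have qb: "prox ?x k ^ J \<le> (9/8 * (real k + 1)) / real n" .
    have "(ln (real k + 1))\<^sup>2 \<le> ?l\<^sup>2" using k by (intro power_mono) auto
    then have "c * (ln (real k + 1))\<^sup>2 / (real k + 1) \<le> c * ?l\<^sup>2 / (real k + 1)"
      using cpos by (intro divide_right_mono mult_left_mono) auto
    then have ab: "amp c k0 k \<le> c * ?l\<^sup>2 / (real k + 1)" using amp_le[OF c_nonneg, of k0 k] cpos by linarith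
    have "amp c k0 k * prox ?x k ^ J \<le> (c * ?l\<^sup>2 / (real k + 1)) * ((9/8 * (real k + 1)) / real n)"
      using ab qb a0[of k] prox_bounds[OF xp, of k] cpos by (intro mult_mono) auto
    also have "\<dots> = 9/8 * c * ?l\<^sup>2 / real n"
    proof -
      have "(A / K) * ((9/8 * K) / m) = 9/8 * A / m" if "K \<noteq> 0" for A K m :: real using that by simp
      from this[of "real k + 1"] show ?thesis by simp
    qed
    finally show ?thesis .
  qed
  have above: "amp c k0 k * prox ?x k ^ J \<le> 32 * c * ?l\<^sup>2 * (real n + 1) * (1 / (real k + 1)\<^sup>2)" if k: "k \<ge> n" for k
  proof -
    define K where "K = real k + 1"
    define m where "m = real n + 1"
    have Km: "K \<ge> m" "m \<ge> 3" "K > 0" using k n by (auto simp: K_def m_def)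
    have "ln K = ln m + ln (K / m)" using Km by (simp add: ln_div)
    also have "ln (K / m) \<le> K / m - 1" using Km by (intro ln_le_minus_one) auto
    also have "ln m + (K / m - 1) \<le> ln m * (K / m) + ln m * (K / m)"
    proof -
      have "1 \<le> K / m" using Km by simp
      then have "ln m * 1 \<le> ln m * (K / m)" "1 * (K / m) \<le> ln m * (K / m)"
        using l1 unfolding m_def[symmetric] by (intro mult_left_mono mult_right_mono; simp)+
      then show ?thesis by linarith
    qed
    finally have "ln K \<le> 2 * ln m * K / m" by (simp add: mult_ac)
    then have "(ln K)\<^sup>2 \<le> (2 * ln m * K / m)\<^sup>2" using Km by (intro power_mono) auto
    then have "c * (ln K)\<^sup>2 / K \<le> c * (2 * ln m * K / m)\<^sup>2 / K"
      using cpos Km by (intro divide_right_mono mult_left_mono) auto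
    also have "\<dots> = 4 * c * (ln m)\<^sup>2 * K / m\<^sup>2" using Km by (simp add: field_simps power2_eq_square)
    finally have ab: "amp c k0 k \<le> 4 * c * (ln m)\<^sup>2 * K / m\<^sup>2"
      using amp_le[OF c_nonneg, of k0 k] cpos unfolding K_def by linarith
    have "prox ?x k ^ J \<le> prox ?x k ^ 3" using J3 by (intro qle) auto
    also have "\<dots> \<le> (2 * m / K) ^ 3"
    proof (intro power_mono)
      have "prox ?x k \<le> ?x / \<kappa> k" by (simp add: prox_def)
      also have "\<dots> \<le> m / (K / 2)"
        using contact_bounds(2)[of n] \<kappa>_half[of k] xp Km unfolding m_def K_def by (intro frac_le) auto
      finally show "prox ?x k \<le> 2 * m / K" by (simp add: mult_ac)
    qed (use prox_bounds[OF xp, of k] in auto)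
    finally have qb: "prox ?x k ^ J \<le> (2 * m / K) ^ 3" .
    have "amp c k0 k * prox ?x k ^ J \<le> (4 * c * (ln m)\<^sup>2 * K / m\<^sup>2) * (2 * m / K) ^ 3"
      using ab qb a0[of k] prox_bounds[OF xp, of k] cpos Km by (intro mult_mono) auto
    also have "\<dots> = 32 * c * (ln m)\<^sup>2 * m * (1 / K\<^sup>2)"
      using Km by (simp add: field_simps power2_eq_square power3_eq_cube)
    finally show ?thesis unfolding K_def m_def .
  qed
  have "(\<Sum>k<m. amp c k0 k * prox ?x k ^ J) \<le> 66 * c * ?l\<^sup>2" for m
  proof -
    have "(\<Sum>k<m. amp c k0 k * prox ?x k ^ J) \<le> (\<Sum>k<m + n. amp c k0 k * prox ?x k ^ J)"
      using a0 prox_bounds[OF xp] by (intro sum_mono2) (auto simp: less_imp_le)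
    also have "\<dots> = (\<Sum>k<n. amp c k0 k * prox ?x k ^ J) + (\<Sum>k=n..<m + n. amp c k0 k * prox ?x k ^ J)"
      by (subst sum.union_disjoint[symmetric]) (auto intro: sum.cong)
    also have "(\<Sum>k<n. amp c k0 k * prox ?x k ^ J) \<le> (\<Sum>k<n. 9/8 * c * ?l\<^sup>2 / real n)" by (intro sum_mono below) auto
    also have "\<dots> = 9/8 * c * ?l\<^sup>2" using n by simp
    also have "(\<Sum>k=n..<m + n. amp c k0 k * prox ?x k ^ J) \<le> (\<Sum>k=n..<m + n. 32 * c * ?l\<^sup>2 * (real n + 1) * (1 / (real k + 1)\<^sup>2))"
      by (intro sum_mono above) auto
    also have "\<dots> = 32 * c * ?l\<^sup>2 * (real n + 1) * (\<Sum>k=n..<m + n. 1 / (real k + 1)\<^sup>2)"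
      by (rule sum_distrib_left[symmetric])
    also have "\<dots> \<le> 32 * c * ?l\<^sup>2 * (real n + 1) * (1 / real n)"
    proof (intro mult_left_mono)
      have "(\<Sum>k=n..<m + n. 1 / (real k + 1)\<^sup>2) \<le> 1 / real n - 1 / real (m + n)"
        using n by (intro sum_inverse_squares_le) auto
      then show "(\<Sum>k=n..<m + n. 1 / (real k + 1)\<^sup>2) \<le> 1 / real n"
        using divide_nonneg_nonneg[of 1 "real (m + n)"] by linarith
    qed (use cpos in auto)
    also have "\<dots> = 32 * c * ?l\<^sup>2 * ((real n + 1) / real n)" by simp
    also have "\<dots> \<le> 32 * c * ?l\<^sup>2 * (3/2)"
      using cpos n by (intro mult_left_mono) (auto simp: divide_le_eq)
    finally have "(\<Sum>k<m. amp c k0 k * prox ?x k ^ J) \<le> 9/8 * (c * ?l\<^sup>2) + 48 * (c * ?l\<^sup>2)" by simp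
    moreover have "0 \<le> c * ?l\<^sup>2" using cpos by simp
    ultimately show ?thesis by simp
  qed
  then show ?thesis unfolding swing_def by (rule suminf_le_const[OF summable_swing[OF xp]])
qed

end

text \<open>
  Removed points are compensated by the factor \<open>root_poly N\<close>; the quotient h by the ring product is entire because its zeros are simple. The value of
  c makes the oscillation, taken at the centre of a sector, outweigh the radial loss \<open>J/10\<close> with 1 to spare.
\<close>

lemma perturbed_uniqueness:
  assumes cfg: "amp_config J c k0" and ceq: "c = 4 * (real J / 10 + 1) * 4 ^ J"
    and M: "finite_modification (simple (ring_set J (amp c k0))) M"
  shows "fock_uniqueness M"
  unfolding fock_uniqueness_def
proof (intro ballI impI)
  interpret amp_config J c k0 by (rule cfg)
  fix f assume f: "f \<in> fock_space" and van: "vanishes_on f M"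
  have fhol: "f holomorphic_on UNIV" using f by (simp add: fock_space_def)
  obtain N P where NP: "\<And>z. count N z \<le> simple (ring_set J (amp c k0)) z"
    "M = (\<lambda>z. simple (ring_set J (amp c k0)) z - count N z + count P z)"
    using M unfolding finite_modification_def by blast
  define g where "g z = f z * root_poly N z" for z
  have ghol: "g holomorphic_on UNIV" unfolding g_def[abs_def] by (intro holomorphic_intros fhol root_poly_holomorphic)
  have gvan: "g z = 0" if z: "ring_product z = 0" for z
  proof (cases "z \<in># N")
    case True then show ?thesis by (simp add: g_def root_poly_zero_iff)
  next
    case False
    then have "count N z = 0" by (simp add: count_eq_zero_iff)
    then have "0 < M z" using z by (simp add: NP(2) simple_def ring_product_zero_iff)
    then have "(deriv ^^ 0) f z = 0" using van unfolding vanishes_on_def by blast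
    then show ?thesis by (simp add: g_def)
  qed
  obtain h where h: "h holomorphic_on UNIV" "\<And>z. g z = ring_product z * h z"
    using entire_quotient[OF ghol ring_product_holomorphic ring_product_simple_zero gvan] by auto
  obtain C1 where C1: "C1 > 0" "\<And>z. (cmod (f z))\<^sup>2 \<le> C1 * (1 + cmod z)\<^sup>2 * exp ((cmod z)\<^sup>2)"
    using fock_space_growth[OF f] by blast
  obtain C2 where C2: "C2 > 0" "\<And>z. cmod (root_poly N z) \<le> C2 * (1 + cmod z) ^ size N"
    using root_poly_upper by blast
  obtain C3 where C3: "\<And>n z. n \<ge> 1 \<Longrightarrow> cmod z = sqrt (real J) * contact n \<Longrightarrow>
     exp (real J * height (contact n) - Re ((z / of_real (cmod z)) ^ J) * swing (contact n) - C3) \<le> cmod (ring_product z)"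
    using ring_product_lower[OF summable_amp_square[OF c_nonneg]] by blast
  have fb: "cmod (f z) \<le> sqrt C1 * (1 + cmod z) * exp ((cmod z)\<^sup>2 / 2)" for z
  proof (rule power2_le_imp_le)
    have "(exp ((cmod z)\<^sup>2 / 2))\<^sup>2 = exp ((cmod z)\<^sup>2)" by (simp add: exp_double[symmetric])
    then show "(cmod (f z))\<^sup>2 \<le> (sqrt C1 * (1 + cmod z) * exp ((cmod z)\<^sup>2 / 2))\<^sup>2"
      using C1 by (simp add: power_mult_distrib)
  qed (use C1 in auto)
  define d where "d = Suc (size N)"
  have gb: "cmod (g z) \<le> (sqrt C1 * C2) * (1 + cmod z) ^ d * exp ((cmod z)\<^sup>2 / 2)" for z
  proof -
    have "cmod (g z) \<le> (sqrt C1 * (1 + cmod z) * exp ((cmod z)\<^sup>2 / 2)) * (C2 * (1 + cmod z) ^ size N)"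
      unfolding g_def norm_mult using fb C2 C1 by (intro mult_mono) auto
    then show ?thesis by (simp add: d_def mult_ac)
  qed
  define C4 where "C4 = sqrt C1 * C2"
  have C4: "C4 > 0" using C1 C2 by (simp add: C4_def)
  have "h = (\<lambda>z. 0)"
  proof (rule entire_vanishes_by_sector_decay[where J = J and W = "\<lambda>n. swing (contact n)" and B = "real J / 10"
        and A = "c / 2 * (1/3) ^ J" and C = "66 * c" and D = "real d" and D' = "ln C4 + real d * ln (3 * real J) + C3"
        and ?n1.0 = "max k0 2"])
    show "h holomorphic_on UNIV" by (rule h(1))
    show "1 \<le> J" using J by simp
    show "c / 2 * (1/3) ^ J * (ln (real n + 1))\<^sup>2 \<le> swing (contact n)" if "n \<ge> max k0 2" for n
      using that by (intro swing_lower) auto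
    show "swing (contact n) \<le> 66 * c * (ln (real n + 1))\<^sup>2" if "n \<ge> max k0 2" for n
      using that by (intro swing_upper) auto
    have "(3/4) ^ J * (1/3) ^ J = ((1/4) ^ J :: real)" unfolding power_mult_distrib[symmetric] by simp
    then have "(3/4) ^ J / 2 * (c / 2 * (1/3) ^ J) = c / 4 * (1/4) ^ J" by simp
    also have "\<dots> = (real J / 10 + 1) * (4 ^ J * (1/4) ^ J)" unfolding ceq by simp
    also have "4 ^ J * (1/4) ^ J = (1 :: real)" unfolding power_mult_distrib[symmetric] by simp
    finally show "real J / 10 + 1 \<le> (3/4) ^ J / 2 * (c / 2 * (1/3) ^ J)" by simp
    fix n z assume n: "n \<ge> max k0 2" and z: "cmod z = sqrt (real J) * contact n"
    define s where "s = (ln (real n + 1))\<^sup>2"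
    define cz where "cz = Re ((z / of_real (cmod z)) ^ J)"
    have lo: "exp (real J * height (contact n) - cz * swing (contact n) - C3) \<le> cmod (ring_product z)"
      using C3[OF _ z] n by (simp add: cz_def)
    have hh: "real J * height (contact n) = (cmod z)\<^sup>2 / 2 - real J / 10 * s"
      unfolding height_contact z s_def by (simp add: power_mult_distrib right_diff_distrib)
    have poly: "(1 + cmod z) ^ d \<le> exp (real d * (ln (3 * real J) + ln (real n + 1)))"
    proof -
      have "sqrt (real J) \<le> real J" using J by (intro real_le_lsqrt) (auto simp: power2_eq_square)
      then have "cmod z \<le> real J * (real n + 1/2)" unfolding z using contact_bounds(2)[of n] contact_bounds(1)[of n] by (intro mult_mono) auto
      also have "real J * (real n + 1/2) \<le> real J * (real n + 1)" by (intro mult_left_mono) auto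
      finally have "cmod z \<le> real J * (real n + 1)" .
      moreover have "1 * 1 \<le> real J * (real n + 1)" using J by (intro mult_mono) auto
      ultimately have "1 + cmod z \<le> 3 * real J * (real n + 1)" by linarith
      also have "\<dots> = exp (ln (3 * real J) + ln (real n + 1))" using J by (simp add: exp_add)
      finally have "(1 + cmod z) ^ d \<le> exp (ln (3 * real J) + ln (real n + 1)) ^ d" by (intro power_mono) auto
      then show ?thesis by (simp only: exp_of_nat_mult)
    qed
    have Gp: "cmod (ring_product z) > 0" using lo by (rule less_le_trans[OF exp_gt_zero])
    have "cmod (h z) * exp (real J * height (contact n) - cz * swing (contact n) - C3) \<le> cmod (h z) * cmod (ring_product z)"
      using lo by (intro mult_left_mono) auto
    also have "\<dots> = cmod (g z)" by (simp add: h(2) norm_mult)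
    also have "\<dots> \<le> C4 * (1 + cmod z) ^ d * exp ((cmod z)\<^sup>2 / 2)" using gb by (simp add: C4_def)
    also have "\<dots> \<le> C4 * exp (real d * (ln (3 * real J) + ln (real n + 1))) * exp ((cmod z)\<^sup>2 / 2)"
      using poly C4 by (intro mult_right_mono mult_left_mono) auto
    also have "\<dots> = exp (ln C4 + real d * (ln (3 * real J) + ln (real n + 1)) + (cmod z)\<^sup>2 / 2)"
      using C4 by (simp add: exp_add)
    finally have "cmod (h z) \<le> exp (ln C4 + real d * (ln (3 * real J) + ln (real n + 1)) + (cmod z)\<^sup>2 / 2)
        / exp (real J * height (contact n) - cz * swing (contact n) - C3)"
      by (subst pos_le_divide_eq) simp_all
    also have "\<dots> = exp (real J / 10 * s + real d * ln (real n + 1) + (ln C4 + real d * ln (3 * real J) + C3) + swing (contact n) * cz)"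
      unfolding exp_diff[symmetric] hh by (simp add: algebra_simps)
    finally show "cmod (h z) \<le> exp (real J / 10 * (ln (real n + 1))\<^sup>2 + real d * ln (real n + 1) +
       (ln C4 + real d * ln (3 * real J) + C3) + swing (contact n) * Re ((z / of_real (cmod z)) ^ J))"
      by (simp only: s_def cz_def)
  qed (use c_nonneg in auto)
  then have g0: "f z * root_poly N z = 0" for z using h(2)[of z] by (simp add: g_def)
  have "f z = 0" for z
  proof (rule continuous_constant_on_closure[of "- set_mset N" f 0])
    have cl: "closure (- set_mset N) = UNIV"
      by (simp add: closure_complement empty_interior_finite)
    show "continuous_on (closure (- set_mset N)) f"
      unfolding cl by (rule holomorphic_on_imp_continuous_on[OF fhol])
    show "f x = 0" if "x \<in> - set_mset N" for x using g0[of x] that by (simp add: root_poly_zero_iff)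
    show "z \<in> closure (- set_mset N)" by (simp add: cl)
  qed
  then show "f = (\<lambda>z. 0)" by auto
qed

text \<open>
  With \<open>u = ln (t/b)\<close> the exponent is \<open>mu - \<alpha>u\<^sup>2\<close> plus a constant, and a quadratic polynomial in u is bounded above.
\<close>

lemma power_times_exp_bound:
  fixes b t \<alpha> :: real assumes b: "b \<ge> 1" and t: "t \<ge> b" and \<alpha>: "\<alpha> > 0"
  shows "(1 + t) ^ m * exp (- \<alpha> * (ln (t / b))\<^sup>2) \<le> exp (real m * ln (2 * b) + (real m)\<^sup>2 / (4 * \<alpha>))"
proof -
  define u where "u = ln (t / b)"
  have tp: "t > 0" using b t by simp
  have "1 + t \<le> 2 * b * (t / b)" using b t by simp
  also have "\<dots> = exp (ln (2 * b) + u)" using b tp by (simp add: exp_add u_def)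
  finally have "(1 + t) ^ m \<le> exp (ln (2 * b) + u) ^ m" using tp by (intro power_mono) auto
  also have "\<dots> = exp (real m * (ln (2 * b) + u))" by (simp only: exp_of_nat_mult)
  finally have "(1 + t) ^ m * exp (- \<alpha> * u\<^sup>2) \<le> exp (real m * (ln (2 * b) + u)) * exp (- \<alpha> * u\<^sup>2)"
    by (intro mult_right_mono) auto
  also have "\<dots> = exp (real m * ln (2 * b) + (real m * u - \<alpha> * u\<^sup>2))"
    by (simp add: exp_add[symmetric] algebra_simps)
  also have "\<dots> \<le> exp (real m * ln (2 * b) + (real m)\<^sup>2 / (4 * \<alpha>))"
  proof -
    have "0 \<le> (2 * \<alpha> * u - real m)\<^sup>2" by simp
    then have "(real m * u - \<alpha> * u\<^sup>2) * (4 * \<alpha>) \<le> (real m)\<^sup>2" by (simp add: power2_eq_square algebra_simps)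
    then have "real m * u - \<alpha> * u\<^sup>2 \<le> (real m)\<^sup>2 / (4 * \<alpha>)" using \<alpha> by (subst pos_le_divide_eq) auto
    then show ?thesis by simp
  qed
  finally show ?thesis by (simp add: u_def)
qed

section \<open>Zero sets from the regular rings, and the theorem\<close>

lemma zero_mset_ring_product:
  assumes "ring_config J a"
  shows "zero_mset (ring_config.ring_product J a) = simple (ring_set J a)"
proof -
  interpret ring_config J a by (rule assms)
  have "zero_mset ring_product z = simple (ring_set J a) z" for z
  proof (cases "ring_product z = 0")
    case True
    have "zorder ring_product z = 1"
      by (rule zorder_zero_eqI'[OF entire_analytic[OF ring_product_holomorphic]])
        (use True ring_product_simple_zero[OF True] in auto)
    then show ?thesis using True ring_product_zero_iff by (simp add: zero_mset_def simple_def)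
  next
    case False
    then show ?thesis using ring_product_zero_iff by (simp add: zero_mset_def simple_def)
  qed
  then show ?thesis by auto
qed

text \<open>
  Far out, dividing by \<open>root_poly N\<close> does not increase the modulus and multiplying by \<open>root_poly P\<close> costs a power of |z|, which
  the factor \<open>exp(-(J/10) ln\<^sup>2 |z|)\<close> absorbs.
\<close>

lemma unperturbed_zero_set:
  assumes J: "J \<ge> 2" and M: "finite_modification (simple (ring_set J (\<lambda>_. 0))) M"
  shows "fock_zero_set M"
proof -
  interpret ring_config J "\<lambda>_. 0" by unfold_locales (use J in auto)
  have zG: "zero_mset ring_product = simple (ring_set J (\<lambda>_. 0))" by (rule zero_mset_ring_product) unfold_locales
  have Gnz: "ring_product \<noteq> (\<lambda>z. 0)"
  proof
    assume 0: "ring_product = (\<lambda>z. 0)"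
    then have "deriv ring_product 0 = 0" by (simp add: DERIV_imp_deriv)
    then show False using ring_product_simple_zero[of 0] 0 by simp
  qed
  obtain N P where NP: "\<And>z. count N z \<le> simple (ring_set J (\<lambda>_. 0)) z"
    "M = (\<lambda>z. simple (ring_set J (\<lambda>_. 0)) z - count N z + count P z)"
    using M unfolding finite_modification_def by blast
  obtain h where h: "h holomorphic_on UNIV" "h \<noteq> (\<lambda>z. 0)" "\<And>z. ring_product z = h z * root_poly N z"
    "\<And>z. zero_mset h z = zero_mset ring_product z - count N z"
    using remove_zeros[OF ring_product_holomorphic Gnz, of N] NP(1) unfolding zG by blast
  define f where "f z = h z * root_poly P z" for z
  have f: "f holomorphic_on UNIV" "f \<noteq> (\<lambda>z. 0)" "\<And>z. zero_mset f z = zero_mset h z + count P z"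
    using add_zeros[OF h(1,2), of P] unfolding f_def[abs_def] by blast+
  have zf: "zero_mset f = M" by (simp add: fun_eq_iff f(3) h(4) zG NP(2))
  obtain C1 where C1: "\<And>z. z \<noteq> 0 \<Longrightarrow> cmod (ring_product z) \<le> exp (real J * height (cmod z / sqrt (real J)) + C1)"
    using ring_product_upper_unperturbed by blast
  obtain C2 where C2: "C2 > 0" "\<And>z. cmod (root_poly P z) \<le> C2 * (1 + cmod z) ^ size P"
    using root_poly_upper by blast
  obtain R1 where R1: "\<And>z. cmod z \<ge> R1 \<Longrightarrow> 1 \<le> cmod (root_poly N z)"
    using root_poly_lower by blast
  define b where "b = 2 * sqrt (real J)"
  have b: "b \<ge> 1" using sqrt_J(1) unfolding b_def by linarith
  define R0 where "R0 = max R1 b"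
  define d where "d = size P"
  define \<alpha> where "\<alpha> = real J / 5"
  have \<alpha>: "\<alpha> > 0" using J by (simp add: \<alpha>_def)
  define m where "m = 2 * d + 4"
  define K1 where "K1 = (C2 * exp C1)\<^sup>2 * exp (real m * ln (2 * b) + (real m)\<^sup>2 / (4 * \<alpha>))"
  define \<phi> where "\<phi> z = (cmod (f z))\<^sup>2 * exp (- (cmod z)\<^sup>2) * (1 + cmod z) ^ 4" for z
  have far: "\<phi> z \<le> K1" if z: "cmod z \<ge> R0" for z
  proof -
    have zb: "cmod z \<ge> b" "cmod z \<ge> R1" using z by (auto simp: R0_def)
    have z0: "z \<noteq> 0" using zb b by auto
    let ?x = "cmod z / sqrt (real J)"
    let ?u = "ln (cmod z / b)"
    have x2: "?x \<ge> 2" using zb sqrt_J by (simp add: b_def le_divide_eq)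
    have "real J * height ?x \<le> real J * (?x\<^sup>2 / 2 - (ln (?x / 2))\<^sup>2 / 10)"
      by (intro mult_left_mono height_upper x2) simp
    also have "\<dots> = (cmod z)\<^sup>2 / 2 - \<alpha> / 2 * ?u\<^sup>2"
    proof -
      have e: "?x / 2 = cmod z / b" by (simp add: b_def)
      have Jx: "real J * ?x\<^sup>2 = (cmod z)\<^sup>2" using J by (simp add: power_divide)
      have "real J * (?x\<^sup>2 / 2 - (ln (?x / 2))\<^sup>2 / 10) = real J * ?x\<^sup>2 / 2 - real J / 5 / 2 * (ln (?x / 2))\<^sup>2"
        by (simp add: right_diff_distrib)
      then show ?thesis unfolding e Jx \<alpha>_def .
    qed
    finally have hb: "real J * height ?x \<le> (cmod z)\<^sup>2 / 2 - \<alpha> / 2 * ?u\<^sup>2" .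
    have "cmod (h z) * 1 \<le> cmod (h z) * cmod (root_poly N z)" using R1[OF zb(2)] by (intro mult_left_mono) auto
    also have "\<dots> = cmod (ring_product z)" by (simp add: h(3) norm_mult)
    also have "\<dots> \<le> exp ((cmod z)\<^sup>2 / 2 - \<alpha> / 2 * ?u\<^sup>2 + C1)"
      using C1[OF z0] hb by (meson add_right_mono exp_le_cancel_iff order_trans)
    finally have "cmod (h z) \<le> exp ((cmod z)\<^sup>2 / 2 - \<alpha> / 2 * ?u\<^sup>2 + C1)" by simp
    then have "cmod (f z) \<le> exp ((cmod z)\<^sup>2 / 2 - \<alpha> / 2 * ?u\<^sup>2 + C1) * (C2 * (1 + cmod z) ^ d)"
      unfolding f_def norm_mult d_def using C2 by (intro mult_mono) auto
    then have "(cmod (f z))\<^sup>2 \<le> (exp ((cmod z)\<^sup>2 / 2 - \<alpha> / 2 * ?u\<^sup>2 + C1) * (C2 * (1 + cmod z) ^ d))\<^sup>2"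
      by (intro power_mono) auto
    also have "\<dots> = exp ((cmod z)\<^sup>2) * exp (- \<alpha> * ?u\<^sup>2) * (C2 * exp C1)\<^sup>2 * (1 + cmod z) ^ (2 * d)"
    proof -
      have "(exp ((cmod z)\<^sup>2 / 2 - \<alpha> / 2 * ?u\<^sup>2 + C1))\<^sup>2 = exp ((cmod z)\<^sup>2) * exp (- \<alpha> * ?u\<^sup>2) * (exp C1)\<^sup>2"
        by (simp add: exp_double[symmetric] exp_add[symmetric] algebra_simps)
      moreover have "((1 + cmod z) ^ d)\<^sup>2 = (1 + cmod z) ^ (2 * d)" by (simp add: power_mult[symmetric] mult.commute)
      ultimately show ?thesis by (simp add: power_mult_distrib)
    qed
    finally have "\<phi> z \<le> (exp ((cmod z)\<^sup>2) * exp (- \<alpha> * ?u\<^sup>2) * (C2 * exp C1)\<^sup>2 * (1 + cmod z) ^ (2 * d)) * exp (- (cmod z)\<^sup>2) * (1 + cmod z) ^ 4"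
      unfolding \<phi>_def by (intro mult_right_mono) auto
    also have "\<dots> = (C2 * exp C1)\<^sup>2 * ((1 + cmod z) ^ m * exp (- \<alpha> * ?u\<^sup>2)) * (exp ((cmod z)\<^sup>2) * exp (- (cmod z)\<^sup>2))"
      by (simp only: m_def power_add mult_ac)
    also have "exp ((cmod z)\<^sup>2) * exp (- (cmod z)\<^sup>2) = 1" by (simp add: exp_add[symmetric])
    also have "(C2 * exp C1)\<^sup>2 * ((1 + cmod z) ^ m * exp (- \<alpha> * ?u\<^sup>2)) * 1 \<le> K1"
      unfolding K1_def mult_1_right using power_times_exp_bound[OF b zb(1) \<alpha>, of m] by (intro mult_left_mono) auto
    finally show ?thesis .
  qed
  have "continuous_on (cball 0 R0) \<phi>"
    unfolding \<phi>_def by (intro continuous_intros holomorphic_on_imp_continuous_on holomorphic_on_subset[OF f(1)]) auto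
  then have "bounded (\<phi> ` cball 0 R0)" by (intro compact_imp_bounded compact_continuous_image) auto
  then obtain K2 where "\<forall>y\<in>\<phi> ` cball 0 R0. norm y \<le> K2" unfolding bounded_iff by blast
  then have K2: "\<bar>\<phi> z\<bar> \<le> K2" if "cmod z \<le> R0" for z using that by simp
  have "f \<in> fock_space"
  proof (rule fock_spaceI_decay[OF f(1)])
    fix z
    have "\<phi> z \<le> max K1 K2"
    proof (cases "cmod z \<ge> R0")
      case True then show ?thesis using far[OF True] by simp
    next
      case False then show ?thesis using K2[of z] by simp
    qed
    moreover have "0 < 1 + cmod z" by (simp add: add_pos_nonneg)
    then have "0 < (1 + cmod z) ^ 4" by (rule zero_less_power)
    ultimately show "(cmod (f z))\<^sup>2 * exp (- (cmod z)\<^sup>2) \<le> max K1 K2 / (1 + cmod z) ^ 4"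
      by (simp add: \<phi>_def pos_le_divide_eq)
  qed
  then show ?thesis unfolding fock_zero_set_def using f(2) zf by blast
qed

text \<open>
  A vertex moves by at most four times the parameter of its circle. The constant on the right depends on J and c only.
\<close>

lemma displacement_bound:
  assumes "ring_config J a" and c: "c \<ge> 0"
  shows "4 * (c * (ln (real k + 1))\<^sup>2 / (real k + 1))
    \<le> 12 * real J * c * (ln (2 + ring_radius J k))\<^sup>2 / (1 + ring_radius J k)"
proof -
  interpret ring_config J a by (rule assms(1))
  have r1: "\<kappa> k \<le> ring_radius J k"
  proof -
    have "1 * \<kappa> k \<le> sqrt (real J) * \<kappa> k" using sqrt_J by (intro mult_right_mono) (auto simp: less_imp_le)
    then show ?thesis by (simp add: ring_radius_def)
  qed
  have "1 / (real k + 1) \<le> 1" by simp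
  then have "real k + 1 \<le> 2 + ring_radius J k" using \<kappa>_lower'[of k] r1 by linarith
  then have "ln (real k + 1) \<le> ln (2 + ring_radius J k)" by (subst ln_le_cancel_iff) (auto simp: add_pos_pos)
  then have l2: "(ln (real k + 1))\<^sup>2 \<le> (ln (2 + ring_radius J k))\<^sup>2" by (intro power_mono) auto
  have "sqrt (real J) \<le> real J" using J by (intro real_le_lsqrt) (auto simp: power2_eq_square)
  then have "ring_radius J k \<le> real J * (9/8 * (real k + 1))"
    unfolding ring_radius_def using \<kappa>_le[of k] by (intro mult_mono) (auto simp: less_imp_le)
  moreover have "1 * 1 \<le> real J * (real k + 1)" using J by (intro mult_mono) auto
  ultimately have r2: "1 + ring_radius J k \<le> 3 * real J * (real k + 1)" unfolding mult.assoc mult.left_commute[of "real J"] by linarith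
  have rp: "0 < 1 + ring_radius J k" by (simp add: add_pos_pos)
  have "4 * (c * (ln (real k + 1))\<^sup>2 / (real k + 1)) = 12 * real J * c * (ln (real k + 1))\<^sup>2 / (3 * real J * (real k + 1))"
  proof -
    have "4 * (c * A / K) = 12 * j * c * A / (3 * j * K)" if "j \<noteq> 0" "K \<noteq> 0" for j A K :: real
      using that by (simp add: field_simps)
    from this[of "real J" "real k + 1" "(ln (real k + 1))\<^sup>2"] J show ?thesis by linarith
  qed
  also have "\<dots> \<le> 12 * real J * c * (ln (2 + ring_radius J k))\<^sup>2 / (1 + ring_radius J k)"
    using l2 r2 rp c by (intro frac_le mult_left_mono) auto
  finally show ?thesis .
qed

theorem theoremA:
  fixes L :: nat
  shows "\<exists>C\<^sub>L :: real. \<forall>\<eta> > 0. \<forall>R > 0.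
    \<exists>(\<Lambda>p :: complex set) (\<Lambda>m :: complex set) (T :: complex \<Rightarrow> complex).
      uniform_discrete \<Lambda>p \<and> uniform_discrete \<Lambda>m \<and> bij_betw T \<Lambda>p \<Lambda>m \<and>
      ((\<exists>\<beta>. bounded_matching \<beta> \<Lambda>p sqrt_pi_lattice) \<and>
       (\<exists>\<beta>. bounded_matching \<beta> \<Lambda>m sqrt_pi_lattice) \<and>
       disc_discrepancy_linear \<Lambda>p \<and> disc_discrepancy_linear \<Lambda>m) \<and>
      ((\<forall>z\<in>\<Lambda>p. cmod (T z) = cmod z) \<and>
       (\<forall>z\<in>\<Lambda>p. cmod z \<le> R \<longrightarrow> T z = z) \<and>
       \<Lambda>p \<inter> cball 0 R = \<Lambda>m \<inter> cball 0 R \<and>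
       (SUP z\<in>\<Lambda>p. ereal (cmod (T z - z))) < ereal \<eta> \<and>
       (\<forall>z\<in>\<Lambda>p. cmod (T z - z) \<le> C\<^sub>L * (ln (2 + cmod z))\<^sup>2 / (1 + cmod z))) \<and>
      ((\<forall>r. radial_count (simple \<Lambda>p) r = radial_count (simple \<Lambda>m) r) \<and>
       (\<forall>\<rho> > 0. \<forall>j \<in> {1..L}. circle_moment \<Lambda>p j \<rho> = circle_moment \<Lambda>m j \<rho>) \<and>
       (\<exists>\<rho>\<^sub>0. \<forall>\<rho> > \<rho>\<^sub>0. \<forall>j \<in> {1..L}. circle_moment \<Lambda>p j \<rho> = 0 \<and> circle_moment \<Lambda>m j \<rho> = 0)) \<and>
      ((\<forall>M. finite_modification (simple \<Lambda>p) M \<longrightarrow> fock_zero_set M) \<and>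
       (\<forall>M. finite_modification (simple \<Lambda>m) M \<longrightarrow> fock_uniqueness M))"
proof -
  \<comment> \<open>rotation by 2 pi / J with J > L annihilates the moments up to L, and the estimates of the swing need J at least 3\<close>
  define J where "J = L + 3"
  define c where "c = 4 * (real J / 10 + 1) * 4 ^ J"
  have J: "J \<ge> 3" "J \<ge> 2" by (auto simp: J_def)
  have c: "c > 0" by (simp add: c_def add_pos_nonneg)
  show ?thesis
  proof (rule exI[of _ "12 * real J * c"], intro allI impI)
    fix \<eta> R :: real assume \<eta>: "\<eta> > 0" and R: "R > 0"
    obtain K where K: "\<And>k0 k. k0 \<ge> K \<Longrightarrow> amp c k0 k \<le> min (1/8) (\<eta> / 8)"
      using amp_small[of "min (1/8) (\<eta> / 8)" c] \<eta> by auto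
    \<comment> \<open>far enough out to make all displacements small and to leave the disc of radius R untouched\<close>
    define k0 where "k0 = max K (nat \<lceil>2 * R\<rceil>)"
    define a where "a = amp c k0"
    have a8: "a k \<le> 1/8" and a\<eta>: "a k \<le> \<eta> / 8" for k using K[of k0 k] by (auto simp: a_def k0_def)
    have k0R: "2 * R \<le> real k0" unfolding k0_def by linarith
    have a0: "0 \<le> a k" for k using amp_nonneg[of c k0 k] c by (simp add: a_def)
    have cfg: "amp_config J c k0"
      by unfold_locales (use J c a8 a0 in \<open>auto simp: a_def\<close>)
    interpret p: ring_config J "\<lambda>_. 0" by unfold_locales (use J in auto)
    interpret m: ring_config J a by unfold_locales (use J a0 a8 in auto)
    define \<Lambda>p where "\<Lambda>p = ring_set J (\<lambda>_. 0)"
    define \<Lambda>m where "\<Lambda>m = ring_set J a"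
    define T where "T = ring_point J a \<circ> inv_into (ring_index J) (ring_point J (\<lambda>_. 0))"
    have T_ring_point: "T (ring_point J (\<lambda>_. 0) i) = ring_point J a i" if "i \<in> ring_index J" for i
      using inv_into_f_f[OF p.inj_ring_point that] by (simp add: T_def)
    have bij: "bij_betw T \<Lambda>p \<Lambda>m"
    proof -
      have "bij_betw (inv_into (ring_index J) (ring_point J (\<lambda>_. 0))) \<Lambda>p (ring_index J)"
        unfolding \<Lambda>p_def ring_set_def by (intro bij_betw_inv_into inj_on_imp_bij_betw p.inj_ring_point)
      moreover have "bij_betw (ring_point J a) (ring_index J) \<Lambda>m"
        unfolding \<Lambda>m_def ring_set_def by (intro inj_on_imp_bij_betw m.inj_ring_point)
      ultimately show ?thesis unfolding T_def by (rule bij_betw_trans)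
    qed
    have ring_pointE: "\<exists>k n. (k, n) \<in> ring_index J \<and> z = ring_point J (\<lambda>_. 0) (k, n)" if "z \<in> \<Lambda>p" for z
      using that by (auto simp: \<Lambda>p_def ring_set_def)
    have norm: "cmod (T z) = cmod z" if "z \<in> \<Lambda>p" for z
      using ring_pointE[OF that] T_ring_point by (auto simp: p.cmod_ring_point m.cmod_ring_point)
    have disp: "cmod (ring_point J a (k, n) - ring_point J (\<lambda>_. 0) (k, n)) \<le> 4 * a k" for k n
      using m.ring_point_displacement[of k n] ring_point_regular[OF J(2), of k n] by simp
    have near: "T z = z" if z: "z \<in> \<Lambda>p" "cmod z \<le> R" for z
    proof -
      obtain k n where kn: "(k, n) \<in> ring_index J" "z = ring_point J (\<lambda>_. 0) (k, n)" using ring_pointE[OF z(1)] by blast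
      have "(real k + 1) / 2 \<le> R" using p.ring_radius_ge[of k] z(2) by (simp add: kn(2) p.cmod_ring_point)
      then have "real k < real k0" using k0R by (simp add: field_simps)
      then have "a k = 0" by (simp add: a_def amp_def)
      then show ?thesis using disp[of k n] T_ring_point[OF kn(1)] kn(2) by simp
    qed
    have near_sets: "\<Lambda>p \<inter> cball 0 R = \<Lambda>m \<inter> cball 0 R"
    proof (intro equalityI subsetI)
      fix z assume z: "z \<in> \<Lambda>p \<inter> cball 0 R"
      then have Tz: "T z = z" using near by simp
      have "T z \<in> \<Lambda>m" using bij z by (auto simp: bij_betw_def)
      then show "z \<in> \<Lambda>m \<inter> cball 0 R" using z Tz by simp
    next
      fix z assume z: "z \<in> \<Lambda>m \<inter> cball 0 R"
      then obtain w where w: "w \<in> \<Lambda>p" "z = T w" using bij by (auto simp: bij_betw_def)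
      then have "T w = w" using near[of w] norm[of w] z by simp
      then show "z \<in> \<Lambda>p \<inter> cball 0 R" using w z by simp
    qed
    have "(SUP z\<in>\<Lambda>p. ereal (cmod (T z - z))) \<le> ereal (\<eta> / 2)"
    proof (rule SUP_least)
      fix z assume "z \<in> \<Lambda>p"
      then obtain k n where kn: "(k, n) \<in> ring_index J" "z = ring_point J (\<lambda>_. 0) (k, n)" using ring_pointE by blast
      then show "ereal (cmod (T z - z)) \<le> ereal (\<eta> / 2)"
        using disp[of k n] a\<eta>[of k] T_ring_point[OF kn(1)] by simp
    qed
    also have "\<dots> < ereal \<eta>" using \<eta> by simp
    finally have sup: "(SUP z\<in>\<Lambda>p. ereal (cmod (T z - z))) < ereal \<eta>" .
    have dispC: "cmod (T z - z) \<le> 12 * real J * c * (ln (2 + cmod z))\<^sup>2 / (1 + cmod z)" if z: "z \<in> \<Lambda>p" for z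
    proof -
      obtain k n where kn: "(k, n) \<in> ring_index J" "z = ring_point J (\<lambda>_. 0) (k, n)" using ring_pointE[OF z] by blast
      have "cmod (T z - z) \<le> 4 * a k" using disp[of k n] T_ring_point[OF kn(1)] kn(2) by simp
      also have "\<dots> \<le> 4 * (c * (ln (real k + 1))\<^sup>2 / (real k + 1))"
        using amp_le[of c k0 k] c by (simp add: a_def)
      also have "\<dots> \<le> 12 * real J * c * (ln (2 + ring_radius J k))\<^sup>2 / (1 + ring_radius J k)"
        using c by (intro displacement_bound[OF p.ring_config_axioms]) simp
      also have "ring_radius J k = cmod z" by (simp add: kn(2) p.cmod_ring_point)
      finally show ?thesis .
    qed
    obtain cl Dl where lat: "tiled_by sqrt_pi_lattice cl Dl" using sqrt_pi_lattice_tiled by blast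
    obtain cp Dp where tp: "tiled_by \<Lambda>p cp Dp" unfolding \<Lambda>p_def using p.tiled_ring_set by blast
    obtain cm Dm where tm: "tiled_by \<Lambda>m cm Dm" unfolding \<Lambda>m_def using m.tiled_ring_set by blast
    have mom: "circle_moment \<Lambda>p j \<rho> = 0" "circle_moment \<Lambda>m j \<rho> = 0" if "\<rho> > 0" "j \<in> {1..L}" for j \<rho>
      using that p.circle_moment_ring_set[of j \<rho>] m.circle_moment_ring_set[of j \<rho>] by (auto simp: \<Lambda>p_def \<Lambda>m_def J_def)
    show "\<exists>(\<Lambda>p :: complex set) (\<Lambda>m :: complex set) (T :: complex \<Rightarrow> complex).
      uniform_discrete \<Lambda>p \<and> uniform_discrete \<Lambda>m \<and> bij_betw T \<Lambda>p \<Lambda>m \<and>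
      ((\<exists>\<beta>. bounded_matching \<beta> \<Lambda>p sqrt_pi_lattice) \<and>
       (\<exists>\<beta>. bounded_matching \<beta> \<Lambda>m sqrt_pi_lattice) \<and>
       disc_discrepancy_linear \<Lambda>p \<and> disc_discrepancy_linear \<Lambda>m) \<and>
      ((\<forall>z\<in>\<Lambda>p. cmod (T z) = cmod z) \<and>
       (\<forall>z\<in>\<Lambda>p. cmod z \<le> R \<longrightarrow> T z = z) \<and>
       \<Lambda>p \<inter> cball 0 R = \<Lambda>m \<inter> cball 0 R \<and>
       (SUP z\<in>\<Lambda>p. ereal (cmod (T z - z))) < ereal \<eta> \<and>
       (\<forall>z\<in>\<Lambda>p. cmod (T z - z) \<le> 12 * real J * c * (ln (2 + cmod z))\<^sup>2 / (1 + cmod z))) \<and>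
      ((\<forall>r. radial_count (simple \<Lambda>p) r = radial_count (simple \<Lambda>m) r) \<and>
       (\<forall>\<rho> > 0. \<forall>j \<in> {1..L}. circle_moment \<Lambda>p j \<rho> = circle_moment \<Lambda>m j \<rho>) \<and>
       (\<exists>\<rho>\<^sub>0. \<forall>\<rho> > \<rho>\<^sub>0. \<forall>j \<in> {1..L}. circle_moment \<Lambda>p j \<rho> = 0 \<and> circle_moment \<Lambda>m j \<rho> = 0)) \<and>
      ((\<forall>M. finite_modification (simple \<Lambda>p) M \<longrightarrow> fock_zero_set M) \<and>
       (\<forall>M. finite_modification (simple \<Lambda>m) M \<longrightarrow> fock_uniqueness M))"
    proof (rule exI[of _ \<Lambda>p], rule exI[of _ \<Lambda>m], rule exI[of _ T], intro conjI)
      show "uniform_discrete \<Lambda>p" unfolding \<Lambda>p_def by (rule p.uniform_discrete_ring_set)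
      show "uniform_discrete \<Lambda>m" unfolding \<Lambda>m_def by (rule m.uniform_discrete_ring_set)
      show "bij_betw T \<Lambda>p \<Lambda>m" by (rule bij)
      show "\<exists>\<beta>. bounded_matching \<beta> \<Lambda>p sqrt_pi_lattice" by (rule tiled_bounded_matching[OF tp lat])
      show "\<exists>\<beta>. bounded_matching \<beta> \<Lambda>m sqrt_pi_lattice" by (rule tiled_bounded_matching[OF tm lat])
      show "disc_discrepancy_linear \<Lambda>p" by (rule tiled_disc_discrepancy[OF tp])
      show "disc_discrepancy_linear \<Lambda>m" by (rule tiled_disc_discrepancy[OF tm])
      show "\<forall>z\<in>\<Lambda>p. cmod (T z) = cmod z" using norm by blast
      show "\<forall>z\<in>\<Lambda>p. cmod z \<le> R \<longrightarrow> T z = z" using near by blast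
      show "\<Lambda>p \<inter> cball 0 R = \<Lambda>m \<inter> cball 0 R" by (rule near_sets)
      show "(SUP z\<in>\<Lambda>p. ereal (cmod (T z - z))) < ereal \<eta>" by (rule sup)
      show "\<forall>z\<in>\<Lambda>p. cmod (T z - z) \<le> 12 * real J * c * (ln (2 + cmod z))\<^sup>2 / (1 + cmod z)"
        using dispC by blast
      show "\<forall>r. radial_count (simple \<Lambda>p) r = radial_count (simple \<Lambda>m) r"
        using radial_count_bij[OF bij norm] by blast
      show "\<forall>\<rho> > 0. \<forall>j \<in> {1..L}. circle_moment \<Lambda>p j \<rho> = circle_moment \<Lambda>m j \<rho>"
        by (simp add: mom)
      show "\<exists>\<rho>\<^sub>0. \<forall>\<rho> > \<rho>\<^sub>0. \<forall>j \<in> {1..L}. circle_moment \<Lambda>p j \<rho> = 0 \<and> circle_moment \<Lambda>m j \<rho> = 0"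
        by (rule exI[of _ 0]) (simp add: mom)
      show "\<forall>M. finite_modification (simple \<Lambda>p) M \<longrightarrow> fock_zero_set M"
        using unperturbed_zero_set[OF J(2)] by (simp add: \<Lambda>p_def)
      show "\<forall>M. finite_modification (simple \<Lambda>m) M \<longrightarrow> fock_uniqueness M"
        using perturbed_uniqueness[OF cfg c_def] by (simp add: \<Lambda>m_def a_def)
    qed
  qed
qed

end
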